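(* Let $n\ge3$ and let $K\subset\mathbb{R}^n$ be a compact set with $B_{2,2}(K)=0$. Define $\Omega:=\mathbb{R}^n\setminus K$ and let $-\Delta_{c,\Omega}$ be the operator $-\Delta$ in $L^2(\Omega;d^nx)$ with domain $C_0^\infty(\Omega)$. Then the Friedrichs and Krein--von Neumann extensions of $-\Delta_{c,\Omega}$ coincide, that is, $$(-\Delta_{c,\Omega})_F=(-\Delta_{c,\Omega})_K.$$ As a consequence, $-\Delta|_{C_0^\infty(\Omega)}$ has a unique nonnegative self-adjoint extension in $L^2(\Omega;d^nx)$.
   Context: For a densely defined nonnegative symmetric operator $S$ in a Hilbert space, $S_F$ (Friedrichs extension) and $S_K$ (Krein--von Neumann extension) are, respectively, the largest and the smallest nonnegative self-adjoint extensions of $S$, in the order: for nonnegative self-adjoint $A,B$, $A\le B$ iff $\mathrm{dom}(B^{1/2})\subseteq\mathrm{dom}(A^{1/2})$ and $\|A^{1/2}u\|\le\|B^{1/2}u\|$ for $u\in\mathrm{dom}(B^{1/2})$. Bessel capacity: for $\alpha>0$ let $g_\alpha$ be the Bessel kernel, the function with (unitary) Fourier transform $\widehat{g_\alpha}(\xi)=(2\pi)^{-n/2}(1+|\xi|^2)^{-\alpha/2}$, $\xi\in\mathbb R^n$. For compact $K\subset\mathbb R^n$, $$B_{\alpha,2}(K):=\inf\{\|f\|^2_{L^2(\mathbb R^n;d^nx)}\,|\,g_\alpha*f\ge1\text{ on }K,\ f\ge0\}.$$ *)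

theory Defs
  imports "HOL-Analysis.Analysis"
begin

section \<open>The Hilbert space \<open>L\<^sup>2(M)\<close>\<close>

text \<open>
  Vectors of \<open>L\<^sup>2(M)\<close> are handled through representatives: complex-valued, square-integrable
  measurable functions, two of which represent the same vector iff they agree almost everywhere.
  Values outside \<open>space M\<close> are irrelevant.
\<close>

definition L2 :: "'a measure \<Rightarrow> ('a \<Rightarrow> complex) set" where
  "L2 M = {f. f \<in> borel_measurable M \<and> integrable M (\<lambda>x. (cmod (f x))\<^sup>2)}"

definition L2_eq :: "'a measure \<Rightarrow> ('a \<Rightarrow> complex) \<Rightarrow> ('a \<Rightarrow> complex) \<Rightarrow> bool" where
  "L2_eq M f g \<longleftrightarrow> (AE x in M. f x = g x)"

definition L2_inner :: "'a measure \<Rightarrow> ('a \<Rightarrow> complex) \<Rightarrow> ('a \<Rightarrow> complex) \<Rightarrow> complex" where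
  "L2_inner M f g = (\<integral>x. f x * cnj (g x) \<partial>M)"

definition L2_norm :: "'a measure \<Rightarrow> ('a \<Rightarrow> complex) \<Rightarrow> real" where
  "L2_norm M f = sqrt (\<integral>x. (cmod (f x))\<^sup>2 \<partial>M)"


section \<open>Unbounded operators in \<open>L\<^sup>2(M)\<close>\<close>

text \<open>
  An operator is given by its graph, taken as a set of pairs of representatives that is saturated
  with respect to almost-everywhere equality. Thus equality of operators is equality of sets,
  ``\<open>A\<close> extends \<open>S\<close>'' is \<open>S \<subseteq> A\<close>, the domain is \<open>Domain A\<close>, and the product of operators (with its
  natural domain) is relational composition.
\<close>

type_synonym 'a L2_operator = "(('a \<Rightarrow> complex) \<times> ('a \<Rightarrow> complex)) set"

definition linear_operator :: "'a measure \<Rightarrow> 'a L2_operator \<Rightarrow> bool" where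
  "linear_operator M T \<longleftrightarrow>
     T \<subseteq> L2 M \<times> L2 M \<and>
     ((\<lambda>_. 0), (\<lambda>_. 0)) \<in> T \<and>
     (\<forall>(f, u) \<in> T. \<forall>(g, v) \<in> T. ((\<lambda>x. f x + g x), (\<lambda>x. u x + v x)) \<in> T) \<and>
     (\<forall>(f, u) \<in> T. \<forall>c. ((\<lambda>x. c * f x), (\<lambda>x. c * u x)) \<in> T) \<and>
     (\<forall>(f, u) \<in> T. \<forall>g \<in> L2 M. \<forall>v \<in> L2 M. L2_eq M f g \<and> L2_eq M u v \<longrightarrow> (g, v) \<in> T) \<and>
     (\<forall>f u v. (f, u) \<in> T \<and> (f, v) \<in> T \<longrightarrow> L2_eq M u v)"

definition densely_defined :: "'a measure \<Rightarrow> 'a L2_operator \<Rightarrow> bool" where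
  "densely_defined M T \<longleftrightarrow>
     (\<forall>f \<in> L2 M. \<forall>\<epsilon>>0. \<exists>g \<in> Domain T. L2_norm M (\<lambda>x. f x - g x) < \<epsilon>)"

definition adjoint_operator :: "'a measure \<Rightarrow> 'a L2_operator \<Rightarrow> 'a L2_operator" where
  "adjoint_operator M T =
     {(g, v). g \<in> L2 M \<and> v \<in> L2 M \<and> (\<forall>(f, u) \<in> T. L2_inner M u g = L2_inner M f v)}"

definition selfadjoint_operator :: "'a measure \<Rightarrow> 'a L2_operator \<Rightarrow> bool" where
  "selfadjoint_operator M T \<longleftrightarrow>
     linear_operator M T \<and> densely_defined M T \<and> adjoint_operator M T = T"

definition nonneg_operator :: "'a measure \<Rightarrow> 'a L2_operator \<Rightarrow> bool" where
  "nonneg_operator M T \<longleftrightarrow>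
     (\<forall>(f, u) \<in> T. Im (L2_inner M u f) = 0 \<and> 0 \<le> Re (L2_inner M u f))"

text \<open>The nonnegative square root \<open>A\<^sup>1\<^sup>/\<^sup>2\<close> of a nonnegative self-adjoint operator \<open>A\<close>, i.e. its
  unique nonnegative self-adjoint square root.\<close>

definition sqrt_operator :: "'a measure \<Rightarrow> 'a L2_operator \<Rightarrow> 'a L2_operator" where
  "sqrt_operator M A =
     (THE R. selfadjoint_operator M R \<and> nonneg_operator M R \<and> R O R = A)"

definition operator_le :: "'a measure \<Rightarrow> 'a L2_operator \<Rightarrow> 'a L2_operator \<Rightarrow> bool" where
  "operator_le M A B \<longleftrightarrow>
     Domain (sqrt_operator M B) \<subseteq> Domain (sqrt_operator M A) \<and>
     (\<forall>f u v. (f, u) \<in> sqrt_operator M A \<and> (f, v) \<in> sqrt_operator M B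
        \<longrightarrow> L2_norm M u \<le> L2_norm M v)"

definition nonneg_selfadjoint_extensions :: "'a measure \<Rightarrow> 'a L2_operator \<Rightarrow> 'a L2_operator set" where
  "nonneg_selfadjoint_extensions M S =
     {A. selfadjoint_operator M A \<and> nonneg_operator M A \<and> S \<subseteq> A}"

definition friedrichs_extension :: "'a measure \<Rightarrow> 'a L2_operator \<Rightarrow> 'a L2_operator" where
  "friedrichs_extension M S =
     (THE A. A \<in> nonneg_selfadjoint_extensions M S \<and>
        (\<forall>B \<in> nonneg_selfadjoint_extensions M S. operator_le M B A))"

definition krein_extension :: "'a measure \<Rightarrow> 'a L2_operator \<Rightarrow> 'a L2_operator" where
  "krein_extension M S =
     (THE A. A \<in> nonneg_selfadjoint_extensions M S \<and>
        (\<forall>B \<in> nonneg_selfadjoint_extensions M S. operator_le M A B))"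


section \<open>The minimal Laplacian\<close>

definition partial :: "'a::euclidean_space \<Rightarrow> ('a \<Rightarrow> complex) \<Rightarrow> 'a \<Rightarrow> complex" where
  "partial b f = (\<lambda>x. frechet_derivative f (at x) b)"

fun C_order :: "nat \<Rightarrow> ('a::euclidean_space \<Rightarrow> complex) \<Rightarrow> bool" where
  "C_order 0 f \<longleftrightarrow> continuous_on UNIV f"
| "C_order (Suc k) f \<longleftrightarrow> f differentiable_on UNIV \<and> (\<forall>b\<in>Basis. C_order k (partial b f))"

text \<open>\<open>C\<^sub>0\<^sup>\<infinity>(\<Omega>)\<close>, with functions extended by zero to the whole space.\<close>

definition test_functions :: "'a::euclidean_space set \<Rightarrow> ('a \<Rightarrow> complex) set" where
  "test_functions \<Omega> =
     {\<phi>. (\<forall>k. C_order k \<phi>) \<and> compact (closure {x. \<phi> x \<noteq> 0}) \<and> closure {x. \<phi> x \<noteq> 0} \<subseteq> \<Omega>}"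

definition laplacian :: "('a::euclidean_space \<Rightarrow> complex) \<Rightarrow> 'a \<Rightarrow> complex" where
  "laplacian f = (\<lambda>x. \<Sum>b\<in>Basis. partial b (partial b f) x)"

definition lebesgue_measure_on :: "'a::euclidean_space set \<Rightarrow> 'a measure" where
  "lebesgue_measure_on \<Omega> = restrict_space lborel \<Omega>"

definition minimal_laplacian :: "'a::euclidean_space set \<Rightarrow> 'a L2_operator" where
  "minimal_laplacian \<Omega> =
     {(f, u). f \<in> L2 (lebesgue_measure_on \<Omega>) \<and> u \<in> L2 (lebesgue_measure_on \<Omega>) \<and>
        (\<exists>\<phi> \<in> test_functions \<Omega>. L2_eq (lebesgue_measure_on \<Omega>) f \<phi> \<and>
           L2_eq (lebesgue_measure_on \<Omega>) u (\<lambda>x. - laplacian \<phi> x))}"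


section \<open>Bessel capacity\<close>

text \<open>Unitary Fourier transform of an integrable function.\<close>

definition fourier :: "('a::euclidean_space \<Rightarrow> complex) \<Rightarrow> 'a \<Rightarrow> complex" where
  "fourier f \<xi> = (2 * pi) powr (- real DIM('a) / 2) *\<^sub>R (\<integral>x. cis (- (\<xi> \<bullet> x)) * f x \<partial>lborel)"

text \<open>For \<open>\<alpha> > 0\<close> the Bessel kernel is an integrable function, determined by its Fourier transform
  up to a null set. The choice of representative is immaterial, since the kernel only enters through
  convolutions.\<close>

definition bessel_kernel :: "real \<Rightarrow> 'a::euclidean_space \<Rightarrow> real" where
  "bessel_kernel \<alpha> =
     (SOME g. integrable lborel g \<and>
        (\<forall>\<xi>. fourier (\<lambda>x. complex_of_real (g x)) \<xi> =
           complex_of_real ((2 * pi) powr (- real DIM('a) / 2) *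
             (1 + (norm \<xi>)\<^sup>2) powr (- \<alpha> / 2))))"

text \<open>The Bessel kernel is nonnegative almost everywhere, so for \<open>f \<ge> 0\<close> the convolution
  is a pointwise defined function with values in \<open>[0, \<infinity>]\<close>. Functions \<open>f\<close> outside \<open>L\<^sup>2\<close> only
  contribute the value \<open>\<infinity>\<close> to the infimum.\<close>

definition bessel_potential :: "real \<Rightarrow> ('a::euclidean_space \<Rightarrow> real) \<Rightarrow> 'a \<Rightarrow> ennreal" where
  "bessel_potential \<alpha> f x = (\<integral>\<^sup>+y. ennreal (bessel_kernel \<alpha> (x - y) * f y) \<partial>lborel)"

text \<open>The Bessel capacity \<open>B\<^sub>\<alpha>\<^sub>,\<^sub>2(K)\<close> of a compact set \<open>K\<close>.\<close>

definition bessel_capacity2 :: "real \<Rightarrow> 'a::euclidean_space set \<Rightarrow> ennreal" where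
  "bessel_capacity2 \<alpha> K =
     Inf {(\<integral>\<^sup>+x. ennreal ((f x)\<^sup>2) \<partial>lborel) | f.
            f \<in> borel_measurable lborel \<and> (\<forall>x. 0 \<le> f x) \<and> (\<forall>x\<in>K. 1 \<le> bessel_potential \<alpha> f x)}"

end

theory Submission
  imports Defs "HOL-Probability.Probability"
begin

text \<open>
  The minimal Laplacian on \<open>\<Omega> = \<real>\<^sup>n - K\<close> is even essentially self-adjoint, so that its adjoint is the only
  self-adjoint extension; the Friedrichs and Krein extensions then coincide for trivial reasons.

  Vanishing capacity provides \<open>f \<ge> 0\<close> of small \<open>L\<^sup>2\<close> norm whose potential \<open>u = g\<^sub>2 * f\<close>, a lower
  semicontinuous function with \<open>u - \<Delta>u = f\<close>, exceeds \<open>1/2\<close> near \<open>K\<close>. Mollifying and localising \<open>u\<close> gives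
  \<open>v \<in> C\<^sub>0\<^sup>\<infinity>(\<real>\<^sup>n)\<close> with \<open>v \<ge> 1/2\<close> near \<open>K\<close> and small \<open>H\<^sup>2\<close> norm. For a profile \<open>P\<close> with \<open>P(0) = 1\<close>
  and \<open>P = 0\<close> on \<open>[1/2, \<infinity>)\<close>, the function \<open>\<psi> P(v)\<close> is a test function on \<open>\<Omega>\<close> close to \<open>\<psi>\<close> in graph norm;
  the dangerous term \<open>P''(v) |\<nabla>v|\<^sup>2\<close> is controlled by \<open>\<integral> (\<partial>\<^sub>b v)\<^sup>4 / (1 + v)\<^sup>2 \<le> 9 \<integral> (\<Delta>v)\<^sup>2\<close>. Hence the adjoint of the
  minimal Laplacian on \<open>\<Omega>\<close> is that on \<open>\<real>\<^sup>n\<close>, and mollification and dilated cutoffs show that every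
  element of its graph is a limit of elements of the graph of the minimal Laplacian.
\<close>

section \<open>Smooth functions\<close>

text \<open>Approximation is needed in the graph norm of the Laplacian. In form domains potentials
  may be truncated by min and max, but such truncation destroys second derivatives, so a smooth
  profile of the potential takes its place, and then the squared gradient enters the Laplacian.
  Integrating \<open>\<partial>\<^sub>b (v (\<partial>\<^sub>b v)\<^sup>3)\<close> would bound its
  square norm only with a factor v on the second derivative, that is, with a sup bound that a
  potential need not have; the weight 1/(1 + v) replaces that bound, and the profile, living on
  small values, absorbs the weight. A second obstacle: the capacity speaks of pointwise values of a
  potential on a set that may be null, for a kernel fixed only by its Fourier transform. Writing
  that kernel as a superposition of heat kernels gives positivity and, by Fatou, lower
  semicontinuity at every point. A pointwise bound on K thus spreads to a neighbourhood, where
  almost-everywhere arguments can take over.\<close>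

definition pdiff :: "'a::euclidean_space \<Rightarrow> ('a \<Rightarrow> 'b::real_normed_vector) \<Rightarrow> 'a \<Rightarrow> 'b" where
  "pdiff b f = (\<lambda>x. frechet_derivative f (at x) b)"

text \<open>\<open>C_order\<close> with an arbitrary codomain: the analysis is done for real
  functions, and the complex test functions of the statement are reached at the end through the same
  recursion.\<close>

fun Ck :: "nat \<Rightarrow> ('a::euclidean_space \<Rightarrow> 'b::real_normed_vector) \<Rightarrow> bool" where
  "Ck 0 f \<longleftrightarrow> continuous_on UNIV f"
| "Ck (Suc k) f \<longleftrightarrow> f differentiable_on UNIV \<and> (\<forall>b\<in>Basis. Ck k (pdiff b f))"

definition smooth :: "('a::euclidean_space \<Rightarrow> 'b::real_normed_vector) \<Rightarrow> bool" where
  "smooth f \<longleftrightarrow> (\<forall>k. Ck k f)"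

lemma pdiff_eq: "(f has_derivative D) (at x) \<Longrightarrow> pdiff b f x = D b"
  using frechet_derivative_at unfolding pdiff_def by metis

lemma Ck_differentiable: "Ck (Suc k) f \<Longrightarrow> f differentiable (at x)"
  by (simp add: differentiable_on_def)

lemma Ck_continuous: "Ck k f \<Longrightarrow> continuous_on UNIV f"
  by (cases k) (auto simp: differentiable_imp_continuous_on)

lemma Ck_mono: "Ck (Suc k) f \<Longrightarrow> Ck k f"
  by (induction k arbitrary: f) (auto simp: differentiable_imp_continuous_on)

lemma frechet_derivative_sum_pdiff:
  assumes "f differentiable (at x)"
  shows "frechet_derivative f (at x) h = (\<Sum>b\<in>Basis. (h \<bullet> b) *\<^sub>R pdiff b f x)"
proof -
  have "linear (frechet_derivative f (at x))"
    using assms by (rule linear_frechet_derivative)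
  then have "frechet_derivative f (at x) (\<Sum>b\<in>Basis. (h \<bullet> b) *\<^sub>R b)
      = (\<Sum>b\<in>Basis. (h \<bullet> b) *\<^sub>R frechet_derivative f (at x) b)"
    by (simp add: linear_sum linear_scale)
  then show ?thesis
    by (simp add: euclidean_representation pdiff_def)
qed

lemma pdiff_const [simp]: "pdiff b (\<lambda>x. c) = (\<lambda>x. 0)"
  using pdiff_eq[OF has_derivative_const] by auto

lemma Ck_const [simp]: "Ck k (\<lambda>x. c)"
  by (induction k arbitrary: c) auto

lemma pdiff_compose_linear:
  assumes "bounded_linear L" "f differentiable (at x)"
  shows "pdiff b (\<lambda>x. L (f x)) x = L (pdiff b f x)"
  using pdiff_eq[OF bounded_linear.has_derivative[OF assms(1) assms(2)[unfolded frechet_derivative_works]]]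
  by (simp add: pdiff_def)

lemma Ck_compose_linear: "bounded_linear L \<Longrightarrow> Ck k f \<Longrightarrow> Ck k (\<lambda>x. L (f x))"
proof (induction k arbitrary: f)
  case 0
  then show ?case
    by (simp add: bounded_linear.continuous_on)
next
  case (Suc k)
  have "pdiff b (\<lambda>x. L (f x)) = (\<lambda>x. L (pdiff b f x))" for b
    using pdiff_compose_linear[OF Suc.prems(1)] Ck_differentiable[OF Suc.prems(2)] by blast
  moreover have "(\<lambda>x. L (f x)) differentiable_on UNIV"
    using bounded_linear.has_derivative[OF Suc.prems(1)] Ck_differentiable[OF Suc.prems(2)]
    unfolding differentiable_on_def differentiable_def by blast
  ultimately show ?case
    using Suc by simp
qed

lemma pdiff_linear: "bounded_linear L \<Longrightarrow> pdiff b L = (\<lambda>x. L b)"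
  using pdiff_eq[OF bounded_linear_imp_has_derivative] by blast

lemma Ck_linear: "bounded_linear L \<Longrightarrow> Ck k L"
  by (cases k)
    (auto simp: pdiff_linear linear_continuous_on bounded_linear_imp_differentiable_on)

lemma pdiff_add:
  assumes "f differentiable (at x)" "g differentiable (at x)"
  shows "pdiff b (\<lambda>x. f x + g x) x = pdiff b f x + pdiff b g x"
  using pdiff_eq[OF has_derivative_add[OF assms[unfolded frechet_derivative_works]]]
  by (simp add: pdiff_def)

lemma Ck_add: "Ck k f \<Longrightarrow> Ck k g \<Longrightarrow> Ck k (\<lambda>x. f x + g x)"
proof (induction k arbitrary: f g)
  case 0
  then show ?case by (simp add: continuous_on_add)
next
  case (Suc k)
  have "pdiff b (\<lambda>x. f x + g x) = (\<lambda>x. pdiff b f x + pdiff b g x)" for b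
    using pdiff_add Ck_differentiable Suc.prems by blast
  then show ?case
    using Suc by simp
qed

lemma Ck_sum: "finite I \<Longrightarrow> (\<And>i. i \<in> I \<Longrightarrow> Ck k (f i)) \<Longrightarrow> Ck k (\<lambda>x. \<Sum>i\<in>I. f i x)"
  by (induction I rule: finite_induct) (auto intro: Ck_add)

lemma pdiff_mult:
  fixes f g :: "'a::euclidean_space \<Rightarrow> real"
  assumes "f differentiable (at x)" "g differentiable (at x)"
  shows "pdiff b (\<lambda>x. f x * g x) x = pdiff b f x * g x + f x * pdiff b g x"
  using pdiff_eq[OF has_derivative_mult[OF assms[unfolded frechet_derivative_works]]]
  by (simp add: pdiff_def)

lemma Ck_mult:
  fixes f g :: "'a::euclidean_space \<Rightarrow> real"
  shows "Ck k f \<Longrightarrow> Ck k g \<Longrightarrow> Ck k (\<lambda>x. f x * g x)"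
proof (induction k arbitrary: f g)
  case 0
  then show ?case by (simp add: continuous_on_mult)
next
  case (Suc k)
  have "pdiff b (\<lambda>x. f x * g x) = (\<lambda>x. pdiff b f x * g x + f x * pdiff b g x)" for b
    using pdiff_mult Ck_differentiable Suc.prems by blast
  then show ?case
    using Suc Ck_mono[OF Suc.prems(1)] Ck_mono[OF Suc.prems(2)] by (auto intro!: Ck_add)
qed

lemma pdiff_affine:
  assumes "f differentiable (at (c *\<^sub>R x + a))"
  shows "pdiff b (\<lambda>x. f (c *\<^sub>R x + a)) x = c *\<^sub>R pdiff b f (c *\<^sub>R x + a)"
proof -
  have "((\<lambda>x. f (c *\<^sub>R x + a)) has_derivative
      (\<lambda>h. frechet_derivative f (at (c *\<^sub>R x + a)) (c *\<^sub>R h))) (at x)"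
    by (rule has_derivative_compose[where f="\<lambda>x. c *\<^sub>R x + a"])
       (use assms in \<open>auto simp: frechet_derivative_works intro!: derivative_eq_intros\<close>)
  from pdiff_eq[OF this] show ?thesis
    using linear_scale[OF linear_frechet_derivative[OF assms]] by (simp add: pdiff_def)
qed

lemma Ck_scaleR: "Ck k f \<Longrightarrow> Ck k (\<lambda>x. c *\<^sub>R f x)"
  by (rule Ck_compose_linear[OF bounded_linear_scaleR_right])

lemma Ck_affine: "Ck k f \<Longrightarrow> Ck k (\<lambda>x. f (c *\<^sub>R x + a))"
proof (induction k arbitrary: f)
  case 0
  then show ?case
    by (auto intro!: continuous_on_compose2[of UNIV f] continuous_intros)
next
  case (Suc k)
  have d: "f differentiable (at y)" for y
    using Ck_differentiable Suc.prems by blast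
  have "pdiff b (\<lambda>x. f (c *\<^sub>R x + a)) = (\<lambda>x. c *\<^sub>R pdiff b f (c *\<^sub>R x + a))" for b
    using pdiff_affine d by blast
  moreover have "(\<lambda>x. f (c *\<^sub>R x + a)) differentiable (at x)" for x
    by (rule differentiable_compose[of f "\<lambda>x. c *\<^sub>R x + a"]) (auto simp: d)
  ultimately show ?case
    using Suc by (auto intro!: Ck_scaleR simp: differentiable_on_def)
qed

lemma pdiff_chain:
  fixes F :: "real \<Rightarrow> real"
  assumes "(F has_real_derivative d) (at (w x))" "w differentiable (at x)"
  shows "pdiff b (\<lambda>x. F (w x)) x = d * pdiff b w x"
  using pdiff_eq[OF has_derivative_compose[OF assms(2)[unfolded frechet_derivative_works]
        assms(1)[unfolded has_field_derivative_def]]]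
  by (simp add: pdiff_def)

lemma pdiff_real: "(F has_real_derivative d) (at t) \<Longrightarrow> pdiff 1 F t = d"
  using pdiff_eq[of F "(*) d" t 1] by (simp add: has_field_derivative_def)

lemma Ck_real_has_derivative:
  fixes F :: "real \<Rightarrow> real"
  assumes "Ck (Suc k) F"
  shows "(F has_real_derivative pdiff 1 F t) (at t)"
proof -
  obtain d where "(F has_real_derivative d) (at t)"
    using Ck_differentiable[OF assms] real_differentiable_def by blast
  with pdiff_real[OF this] show ?thesis
    by simp
qed

lemma Ck_compose:
  fixes F :: "real \<Rightarrow> real"
  shows "Ck k F \<Longrightarrow> Ck k w \<Longrightarrow> Ck k (\<lambda>x. F (w x))"
proof (induction k arbitrary: F)
  case 0
  then show ?case
    by (auto intro!: continuous_on_compose2[of UNIV F])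
next
  case (Suc k)
  note d = Ck_real_has_derivative[OF Suc.prems(1)]
  have w: "w differentiable (at x)" for x
    using Ck_differentiable Suc.prems by blast
  have "pdiff b (\<lambda>x. F (w x)) = (\<lambda>x. pdiff 1 F (w x) * pdiff b w x)" for b
    using pdiff_chain[OF d w] by blast
  moreover have "(\<lambda>x. F (w x)) differentiable (at x)" for x
    by (rule differentiable_compose[of F w])
       (use w d real_differentiable_def in auto)
  ultimately show ?case
    using Suc Ck_mono[OF Suc.prems(2)] by (auto intro!: Ck_mult simp: differentiable_on_def)
qed

section \<open>Calculus of infinitely differentiable functions\<close>

lemma smooth_CkD: "smooth f \<Longrightarrow> Ck k f"
  by (simp add: smooth_def)

lemma smooth_pdiff: "smooth f \<Longrightarrow> b \<in> Basis \<Longrightarrow> smooth (pdiff b f)"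
  unfolding smooth_def using Ck.simps(2) by blast

lemma smooth_differentiable: "smooth f \<Longrightarrow> f differentiable (at x)"
  unfolding smooth_def using Ck_differentiable by blast

lemma smooth_continuous: "smooth f \<Longrightarrow> continuous_on S f"
  using Ck_continuous continuous_on_subset by (metis smooth_def subset_UNIV)

lemma smooth_measurable [measurable_dest]: "smooth f \<Longrightarrow> f \<in> borel_measurable borel"
  using borel_measurable_continuous_onI smooth_continuous by blast

lemma smooth_const [simp]: "smooth (\<lambda>x. c)"
  by (simp add: smooth_def)

lemma smooth_add: "smooth f \<Longrightarrow> smooth g \<Longrightarrow> smooth (\<lambda>x. f x + g x)"
  by (simp add: smooth_def Ck_add)

lemma smooth_sum: "finite I \<Longrightarrow> (\<And>i. i \<in> I \<Longrightarrow> smooth (f i)) \<Longrightarrow> smooth (\<lambda>x. \<Sum>i\<in>I. f i x)"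
  by (simp add: smooth_def Ck_sum)

lemma smooth_compose_linear: "bounded_linear L \<Longrightarrow> smooth f \<Longrightarrow> smooth (\<lambda>x. L (f x))"
  by (simp add: smooth_def Ck_compose_linear)

lemma smooth_mult:
  fixes f g :: "'a::euclidean_space \<Rightarrow> real"
  shows "smooth f \<Longrightarrow> smooth g \<Longrightarrow> smooth (\<lambda>x. f x * g x)"
  by (simp add: smooth_def Ck_mult)

lemma smooth_cmult:
  fixes f :: "'a::euclidean_space \<Rightarrow> real"
  shows "smooth f \<Longrightarrow> smooth (\<lambda>x. c * f x)"
  by (simp add: smooth_mult)

lemma smooth_minus: "smooth f \<Longrightarrow> smooth (\<lambda>x. - f x)"
  by (rule smooth_compose_linear[OF bounded_linear_minus[OF bounded_linear_ident]])

lemma smooth_diff: "smooth f \<Longrightarrow> smooth g \<Longrightarrow> smooth (\<lambda>x. f x - g x)"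
  using smooth_add[OF _ smooth_minus] by fastforce

lemma smooth_affine: "smooth f \<Longrightarrow> smooth (\<lambda>x. f (c *\<^sub>R x + a))"
  by (simp add: smooth_def Ck_affine)

lemma smooth_reflect: "smooth f \<Longrightarrow> smooth (\<lambda>x. f (a - x))"
  using smooth_affine[of f "-1" a] by simp

lemma smooth_compose:
  fixes F :: "real \<Rightarrow> real"
  shows "smooth F \<Longrightarrow> smooth w \<Longrightarrow> smooth (\<lambda>x. F (w x))"
  by (simp add: smooth_def Ck_compose)

lemma smooth_inner_self: "smooth (\<lambda>x::'a::euclidean_space. x \<bullet> x)"
proof -
  have "smooth (\<lambda>x::'a. \<Sum>b\<in>Basis. (x \<bullet> b) * (x \<bullet> b))"
    by (intro smooth_sum smooth_mult) (auto simp: smooth_def Ck_linear bounded_linear_inner_left)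
  then show ?thesis
    by (simp flip: euclidean_inner)
qed

lemma smooth_real_has_derivative:
  "smooth (F :: real \<Rightarrow> real) \<Longrightarrow> (F has_real_derivative pdiff 1 F t) (at t)"
  unfolding smooth_def using Ck_real_has_derivative by blast

lemma smooth_line_derivative:
  fixes f :: "'a::euclidean_space \<Rightarrow> real"
  assumes "f differentiable (at (x + t *\<^sub>R b))"
  shows "((\<lambda>t. f (x + t *\<^sub>R b)) has_real_derivative pdiff b f (x + t *\<^sub>R b)) (at t)"
proof -
  have "((\<lambda>t. f (x + t *\<^sub>R b)) has_derivative
      (\<lambda>h. frechet_derivative f (at (x + t *\<^sub>R b)) (h *\<^sub>R b))) (at t)"
    by (rule has_derivative_compose[where f="\<lambda>t. x + t *\<^sub>R b"])
       (use assms in \<open>auto simp: frechet_derivative_works intro!: derivative_eq_intros\<close>)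
  then show ?thesis
    using linear_scale[OF linear_frechet_derivative[OF assms]]
    by (simp add: has_field_derivative_def pdiff_def mult_commute_abs)
qed

text \<open>Schwarz's theorem: the second difference over a parallelogram is symmetric in b and c.
  Two uses of the mean value theorem turn it into t*t times a mixed derivative at a point near x,
  and continuity of the mixed derivatives identifies the limits for both orders.\<close>

lemma pdiff_commute:
  fixes f :: "'a::euclidean_space \<Rightarrow> real"
  assumes f: "Ck 2 f" and bc: "b \<in> Basis" "c \<in> Basis"
  shows "pdiff b (pdiff c f) x = pdiff c (pdiff b f) x"
proof -
  let ?S = "\<lambda>b c t. f (x + t *\<^sub>R b + t *\<^sub>R c) - f (x + t *\<^sub>R b) - f (x + t *\<^sub>R c) + f x"
  have mv: "\<exists>s r. 0 < s \<and> s < t \<and> 0 < r \<and> r < t \<and>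
      ?S b c t = t * t * pdiff c (pdiff b f) (x + s *\<^sub>R b + r *\<^sub>R c)"
    if t: "0 < t" and bc: "b \<in> Basis" "c \<in> Basis" for t b c
  proof -
    have d: "f differentiable (at y)" "pdiff b f differentiable (at y)" for y
      using f bc by (auto simp: numeral_2_eq_2 differentiable_on_def)
    have "\<exists>s. 0 < s \<and> s < t \<and>
        (f ((x + t *\<^sub>R c) + t *\<^sub>R b) - f (x + t *\<^sub>R b)) - (f ((x + t *\<^sub>R c) + 0 *\<^sub>R b) - f (x + 0 *\<^sub>R b))
         = (t - 0) * (pdiff b f ((x + t *\<^sub>R c) + s *\<^sub>R b) - pdiff b f (x + s *\<^sub>R b))"
      by (rule MVT2[OF t]) (intro DERIV_diff smooth_line_derivative d)
    then obtain s where s: "0 < s" "s < t" "?S b c t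
         = t * (pdiff b f ((x + t *\<^sub>R c) + s *\<^sub>R b) - pdiff b f (x + s *\<^sub>R b))"
      by (auto simp: algebra_simps)
    have "\<exists>r. 0 < r \<and> r < t \<and>
        pdiff b f ((x + s *\<^sub>R b) + t *\<^sub>R c) - pdiff b f ((x + s *\<^sub>R b) + 0 *\<^sub>R c)
        = (t - 0) * pdiff c (pdiff b f) ((x + s *\<^sub>R b) + r *\<^sub>R c)"
      by (rule MVT2[OF t]) (intro smooth_line_derivative d)
    with s show ?thesis
      by (force simp: algebra_simps)
  qed
  have lim: "(\<lambda>n. ?S b c (inverse (real (Suc n))) * (real (Suc n))\<^sup>2) \<longlonglongrightarrow> pdiff c (pdiff b f) x"
    if bc: "b \<in> Basis" "c \<in> Basis" for b c
  proof -
    define t where "t n = inverse (real (Suc n))" for n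
    have t0: "t \<longlonglongrightarrow> 0"
      unfolding t_def by (rule LIMSEQ_inverse_real_of_nat)
    have tp: "0 < t n" for n
      by (simp add: t_def)
    obtain s r where sr: "0 < s n" "s n < t n" "0 < r n" "r n < t n"
        "?S b c (t n) = t n * t n * pdiff c (pdiff b f) (x + s n *\<^sub>R b + r n *\<^sub>R c)" for n
      using mv[OF tp bc] by metis
    have s0: "s \<longlonglongrightarrow> 0"
      by (rule tendsto_sandwich[OF _ _ tendsto_const t0]) (use sr(1,2) in \<open>auto intro: less_imp_le always_eventually\<close>)
    have r0: "r \<longlonglongrightarrow> 0"
      by (rule tendsto_sandwich[OF _ _ tendsto_const t0]) (use sr(3,4) in \<open>auto intro: less_imp_le always_eventually\<close>)
    have "(\<lambda>n. x + s n *\<^sub>R b + r n *\<^sub>R c) \<longlonglongrightarrow> x + 0 *\<^sub>R b + 0 *\<^sub>R c"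
      by (intro tendsto_intros s0 r0)
    moreover have "continuous_on UNIV (pdiff c (pdiff b f))"
      using f bc by (auto simp: numeral_2_eq_2)
    ultimately have "(\<lambda>n. pdiff c (pdiff b f) (x + s n *\<^sub>R b + r n *\<^sub>R c)) \<longlonglongrightarrow> pdiff c (pdiff b f) x"
      by (auto intro: continuous_on_tendsto_compose[of UNIV])
    moreover have "?S b c (t n) * (real (Suc n))\<^sup>2 = pdiff c (pdiff b f) (x + s n *\<^sub>R b + r n *\<^sub>R c)" for n
    proof -
      have 1: "t n * t n * (real (Suc n))\<^sup>2 = 1"
        by (simp add: t_def power2_eq_square divide_simps del: of_nat_Suc)
      have "t n * t n * y * (real (Suc n))\<^sup>2 = (t n * t n * (real (Suc n))\<^sup>2) * y" for y
        by (simp only: mult_ac)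
      then show ?thesis
        unfolding sr(5) 1 by simp
    qed
    ultimately show ?thesis
      unfolding t_def by simp
  qed
  have "?S b c t = ?S c b t" for t
    by (simp add: algebra_simps)
  with lim[OF bc] lim[OF bc(2,1)] show ?thesis
    using LIMSEQ_unique by fastforce
qed

section \<open>A flat function\<close>

text \<open>For m = 0 this is the classical flat function exp(-1/t) extended by zero. The powers of
  1/t are included so that the family is closed under differentiation up to linear combinations,
  which makes smoothness an induction over all m at once.\<close>

definition flat :: "nat \<Rightarrow> real \<Rightarrow> real" where
  "flat m t = (if 0 < t then inverse t ^ m * exp (- inverse t) else 0)"

lemma flat_at_right: "(flat m \<longlongrightarrow> 0) (at_right 0)"
proof -
  have "((\<lambda>x::real. x ^ m / exp x) \<longlongrightarrow> 0) at_top"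
    by (rule tendsto_power_div_exp_0)
  then have "((\<lambda>t::real. inverse t ^ m / exp (inverse t)) \<longlongrightarrow> 0) (at_right 0)"
    by (rule filterlim_compose) (rule filterlim_inverse_at_top_right)
  then show ?thesis
    by (rule Lim_transform_eventually)
       (auto simp: flat_def exp_minus divide_inverse eventually_at_right_field intro!: exI[of _ 1])
qed

lemma flat_has_derivative:
  "(flat m has_real_derivative (flat (m + 2) t - m * flat (Suc m) t)) (at t)"
proof (cases t "0::real" rule: linorder_cases)
  case less
  have "((\<lambda>_. 0) has_real_derivative 0) (at t)" by simp
  then have "(flat m has_real_derivative 0) (at t)"
    by (rule has_field_derivative_transform_within_open[of _ _ _ "{..<0}"])
       (use less in \<open>auto simp: flat_def\<close>)
  with less show ?thesis
    by (simp add: flat_def)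
next
  case greater
  have "((\<lambda>t. inverse t ^ m * exp (- inverse t)) has_real_derivative
      (flat (m + 2) t - m * flat (Suc m) t)) (at t)"
    using greater
    by (intro derivative_eq_intros refl, auto simp: flat_def, cases m)
       (auto simp: power2_eq_square algebra_simps)
  then show ?thesis
    by (rule has_field_derivative_transform_within_open[of _ _ _ "{0<..}"])
       (use greater in \<open>auto simp: flat_def\<close>)
next
  case equal
  \<comment> \<open>The difference quotient of \<open>flat m\<close> at 0 is
    \<open>flat (Suc m)\<close> on the right, so the limit from the right is already known.\<close>
  have R: "((\<lambda>h. (flat m h - flat m 0) / h) \<longlongrightarrow> 0) (at_right 0)"
    by (rule Lim_transform_eventually[OF flat_at_right[of "Suc m"]])
       (auto simp: flat_def divide_inverse eventually_at_right_field intro!: exI[of _ 1])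
  have L: "((\<lambda>h. (flat m h - flat m 0) / h) \<longlongrightarrow> 0) (at_left 0)"
    by (rule Lim_transform_eventually[OF tendsto_const[of 0]])
       (auto simp: flat_def eventually_at_left_field intro!: exI[of _ "-1"])
  have "((\<lambda>h. (flat m h - flat m 0) / h) \<longlongrightarrow> 0) (at 0)"
    using R L filterlim_split_at by blast
  then show ?thesis
    using equal by (simp add: has_field_derivative_iff flat_def)
qed

lemma smooth_flat: "smooth (flat m)"
proof -
  have "Ck k (flat m)" for k
  proof (induction k arbitrary: m)
    case 0
    then show ?case
      using DERIV_isCont[OF flat_has_derivative] by (simp add: continuous_at_imp_continuous_on)
  next
    case (Suc k)
    have "pdiff 1 (flat m) = (\<lambda>t. flat (m + 2) t + (- real m) *\<^sub>R flat (Suc m) t)"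
      using pdiff_real[OF flat_has_derivative] by fastforce
    moreover have "Ck k (\<lambda>t. flat (m + 2) t + (- real m) *\<^sub>R flat (Suc m) t)"
      by (intro Ck_add Ck_scaleR Suc)
    moreover have "flat m differentiable_on UNIV"
      using flat_has_derivative real_differentiable_def by (auto simp: differentiable_on_def)
    ultimately show ?case
      by simp
  qed
  then show ?thesis
    by (simp add: smooth_def)
qed

lemma flat_nonneg: "0 \<le> flat m t"
  by (simp add: flat_def)

section \<open>Compactly supported functions and integration by parts\<close>

text \<open>No closure is taken and C is arbitrary; closedness of C is required where derivatives
  have to vanish off C. This lets supports be enlarged and combined freely.\<close>

definition supp_in :: "'a::topological_space set \<Rightarrow> ('a \<Rightarrow> 'b::zero) \<Rightarrow> bool" where
  "supp_in C f \<longleftrightarrow> (\<forall>x. x \<notin> C \<longrightarrow> f x = 0)"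

definition testf :: "'a::euclidean_space set \<Rightarrow> ('a \<Rightarrow> real) set" where
  "testf \<Omega> = {\<phi>. smooth \<phi> \<and> (\<exists>C. compact C \<and> C \<subseteq> \<Omega> \<and> supp_in C \<phi>)}"

definition lap :: "('a::euclidean_space \<Rightarrow> real) \<Rightarrow> 'a \<Rightarrow> real" where
  "lap f = (\<lambda>x. \<Sum>b\<in>Basis. pdiff b (pdiff b f) x)"

lemma supp_in_mono: "supp_in C f \<Longrightarrow> C \<subseteq> D \<Longrightarrow> supp_in D f"
  by (auto simp: supp_in_def)

lemma supp_in_pdiff:
  assumes "supp_in C f" "closed C"
  shows "supp_in C (pdiff b f)"
  unfolding supp_in_def
proof (intro allI impI)
  fix x assume "x \<notin> C"
  then have "(f has_derivative (\<lambda>h. 0)) (at x)"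
    using assms
    by (intro has_derivative_transform_within_open[OF has_derivative_const[of 0], where s="- C"])
       (auto simp: supp_in_def)
  then show "pdiff b f x = 0"
    by (rule pdiff_eq)
qed

lemma supp_in_lap: "supp_in C f \<Longrightarrow> closed C \<Longrightarrow> supp_in C (lap f)"
proof -
  assume "supp_in C f" "closed C"
  then have "supp_in C (pdiff b (pdiff b f))" for b
    by (intro supp_in_pdiff)
  then show ?thesis
    by (simp add: lap_def supp_in_def)
qed

lemma smooth_lap: "smooth f \<Longrightarrow> smooth (lap f)"
  unfolding lap_def by (intro smooth_sum smooth_pdiff) auto

lemma testf_smooth: "\<phi> \<in> testf \<Omega> \<Longrightarrow> smooth \<phi>"
  by (simp add: testf_def)

lemma testfI: "smooth \<phi> \<Longrightarrow> compact C \<Longrightarrow> C \<subseteq> \<Omega> \<Longrightarrow> supp_in C \<phi> \<Longrightarrow> \<phi> \<in> testf \<Omega>"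
  unfolding testf_def by blast

lemma testfE:
  assumes "\<phi> \<in> testf \<Omega>"
  obtains C where "smooth \<phi>" "compact C" "C \<subseteq> \<Omega>" "supp_in C \<phi>" "closed C"
  using assms compact_imp_closed unfolding testf_def by blast

lemma testf_mult: "\<phi> \<in> testf \<Omega> \<Longrightarrow> smooth f \<Longrightarrow> (\<lambda>x. \<phi> x * f x) \<in> testf \<Omega>"
  by (erule testfE, rule testfI, erule (1) smooth_mult, assumption, assumption) (simp add: supp_in_def)

lemma testf_add:
  assumes "\<phi> \<in> testf \<Omega>" "\<psi> \<in> testf \<Omega>"
  shows "(\<lambda>x. \<phi> x + \<psi> x) \<in> testf \<Omega>"
proof -
  obtain C where C: "compact C" "C \<subseteq> \<Omega>" "supp_in C \<phi>"
    using assms(1) by (rule testfE)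
  obtain D where D: "compact D" "D \<subseteq> \<Omega>" "supp_in D \<psi>"
    using assms(2) by (rule testfE)
  show ?thesis
  proof (rule testfI)
    show "smooth (\<lambda>x. \<phi> x + \<psi> x)"
      using assms by (intro smooth_add testf_smooth)
    show "compact (C \<union> D)"
      using C D by (intro compact_Un)
  qed (use C D in \<open>auto simp: supp_in_def\<close>)
qed

lemma testf_pdiff: "\<phi> \<in> testf \<Omega> \<Longrightarrow> b \<in> Basis \<Longrightarrow> pdiff b \<phi> \<in> testf \<Omega>"
  by (erule testfE, rule testfI, erule (1) smooth_pdiff, assumption, assumption) (rule supp_in_pdiff)

lemma testf_lap: "\<phi> \<in> testf \<Omega> \<Longrightarrow> lap \<phi> \<in> testf \<Omega>"
  by (erule testfE, rule testfI, erule smooth_lap, assumption, assumption) (rule supp_in_lap)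

lemma compact_support_bounded:
  fixes f :: "'a::euclidean_space \<Rightarrow> 'b::real_normed_vector"
  assumes "continuous_on UNIV f" "compact C" "supp_in C f"
  obtains B where "0 < B" "\<And>x. norm (f x) \<le> B"
proof -
  have "bounded (f ` C)"
    using assms(1,2) by (intro compact_imp_bounded compact_continuous_image continuous_on_subset[OF assms(1)]) auto
  then obtain B where "0 < B" "\<forall>y\<in>f ` C. norm y \<le> B"
    using bounded_pos by blast
  with assms(3) have "norm (f x) \<le> B" for x
    by (cases "x \<in> C") (auto simp: supp_in_def)
  with \<open>0 < B\<close> show ?thesis
    by (rule that)
qed

lemma compact_support_integrable:
  fixes f :: "'a::euclidean_space \<Rightarrow> 'b::{banach,second_countable_topology}"
  assumes "continuous_on UNIV f" "compact C" "supp_in C f"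
  shows "integrable lborel f"
proof -
  have "integrable lborel (\<lambda>x. indicator C x *\<^sub>R f x)"
    using assms by (intro borel_integrable_compact continuous_on_subset[OF assms(1)]) auto
  moreover have "(\<lambda>x. indicator C x *\<^sub>R f x) = f"
    using assms(3) by (auto simp: supp_in_def indicator_def)
  ultimately show ?thesis
    by simp
qed

lemma testf_integrable: "\<phi> \<in> testf \<Omega> \<Longrightarrow> integrable lborel \<phi>"
  by (erule testfE, rule compact_support_integrable, erule smooth_continuous)

lemma testf_bounded:
  assumes "\<phi> \<in> testf \<Omega>"
  obtains B where "0 < B" "\<And>x. \<bar>\<phi> x\<bar> \<le> B"
proof -
  obtain C where "compact C" "supp_in C \<phi>"
    using assms by (rule testfE)
  then show ?thesis
    using compact_support_bounded[of \<phi> C] smooth_continuous[OF testf_smooth[OF assms]] that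
    by (metis real_norm_def)
qed

section \<open>Reflection and translation invariance of Lebesgue measure\<close>

lemma lborel_distr_reflect:
  "distr lborel borel (\<lambda>y. x - y) = (lborel :: 'a::euclidean_space measure)"
  by (subst lborel_affine[of "-1" x]) (auto simp: density_1)

lemma integral_reflect:
  fixes f :: "'a::euclidean_space \<Rightarrow> 'b::{banach,second_countable_topology}"
  assumes [measurable]: "f \<in> borel_measurable borel"
  shows "(\<integral>y. f (x - y) \<partial>lborel) = (\<integral>y. f y \<partial>lborel)"
  by (subst (2) lborel_distr_reflect[of x, symmetric]) (simp add: integral_distr)

lemma integrable_reflect:
  fixes f :: "'a::euclidean_space \<Rightarrow> 'b::{banach,second_countable_topology}"
  assumes [measurable]: "f \<in> borel_measurable borel"
  shows "integrable lborel (\<lambda>y. f (x - y)) \<longleftrightarrow> integrable lborel f"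
  by (subst (2) lborel_distr_reflect[of x, symmetric]) (simp add: integrable_distr_eq)

lemma nn_integral_reflect:
  fixes f :: "'a::euclidean_space \<Rightarrow> ennreal"
  assumes [measurable]: "f \<in> borel_measurable borel"
  shows "(\<integral>\<^sup>+y. f (x - y) \<partial>lborel) = (\<integral>\<^sup>+y. f y \<partial>lborel)"
  by (subst (2) lborel_distr_reflect[of x, symmetric]) (simp add: nn_integral_distr)

lemma integral_translate:
  fixes f :: "'a::euclidean_space \<Rightarrow> 'b::{banach,second_countable_topology}"
  assumes [measurable]: "f \<in> borel_measurable borel"
  shows "(\<integral>y. f (x + y) \<partial>lborel) = (\<integral>y. f y \<partial>lborel)"
  by (subst (2) lborel_distr_plus[of x, symmetric]) (simp add: integral_distr)

lemma nn_integral_translate: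
  fixes f :: "'a::euclidean_space \<Rightarrow> ennreal"
  assumes [measurable]: "f \<in> borel_measurable borel"
  shows "(\<integral>\<^sup>+y. f (x + y) \<partial>lborel) = (\<integral>\<^sup>+y. f y \<partial>lborel)"
  by (subst (2) lborel_distr_plus[of x, symmetric]) (simp add: nn_integral_distr)

section \<open>Integration by parts and Green's formulas\<close>

lemma lipschitz_of_pdiff_bound:
  fixes f :: "'a::euclidean_space \<Rightarrow> real"
  assumes f: "\<And>x. f differentiable (at x)" and B: "\<And>x. \<bar>pdiff b f x\<bar> \<le> B"
  shows "\<bar>f (x + t *\<^sub>R b) - f x\<bar> \<le> B * \<bar>t\<bar>"
proof -
  have "norm (f (x + t *\<^sub>R b) - f (x + 0 *\<^sub>R b)) \<le> B * norm (t - 0)"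
    by (rule field_differentiable_bound[of UNIV "\<lambda>t. f (x + t *\<^sub>R b)" "\<lambda>t. pdiff b f (x + t *\<^sub>R b)"])
       (use B in \<open>auto intro: smooth_line_derivative[OF f]\<close>)
  then show ?thesis
    by simp
qed

text \<open>The difference quotients of \<open>f\<close> in direction \<open>b\<close> have integral zero by translation invariance.\<close>

lemma integral_pdiff_eq_0:
  fixes f :: "'a::euclidean_space \<Rightarrow> real"
  assumes f: "\<And>x. f differentiable (at x)" "continuous_on UNIV (pdiff b f)"
    and C: "compact C" "supp_in C f"
  shows "(\<integral>x. pdiff b f x \<partial>lborel) = 0"
proof -
  have cf: "continuous_on UNIV f"
    using f(1) differentiable_imp_continuous_on by (auto simp: differentiable_on_def)
  then have [measurable]: "f \<in> borel_measurable borel" "pdiff b f \<in> borel_measurable borel"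
    using f(2) by (auto intro: borel_measurable_continuous_onI)
  obtain B where B: "0 < B" "\<And>x. norm (pdiff b f x) \<le> B"
    using compact_support_bounded[OF f(2) C(1)] supp_in_pdiff C compact_imp_closed by metis
  define t where "t n = inverse (real (Suc n))" for n
  have t0: "t \<longlonglongrightarrow> 0"
    unfolding t_def by (rule LIMSEQ_inverse_real_of_nat)
  have tp: "0 < t n" "t n \<le> 1" for n
    by (auto simp: t_def divide_simps)
  \<comment> \<open>Since \<open>t n \<le> 1\<close>, a shift by \<open>t n *\<^sub>R b\<close>
    moves points by at most the norm of b. All difference quotients therefore vanish outside this
    compact neighbourhood, and \<open>B * indicator D\<close> dominates them.\<close>
  define D where "D = {x + s |x s. x \<in> C \<and> s \<in> cball 0 (norm b)}"
  have D: "compact D"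
    unfolding D_def by (intro compact_sums C compact_cball)
  let ?q = "\<lambda>n x. (f (x + t n *\<^sub>R b) - f x) / t n"
  have int: "integrable lborel f"
    using cf C by (rule compact_support_integrable)
  have int_t: "integrable lborel (\<lambda>x. f (x + t n *\<^sub>R b))" for n
  proof -
    have "integrable (distr lborel borel ((+) (t n *\<^sub>R b))) f"
      using int by (simp add: lborel_distr_plus)
    then show ?thesis
      by (simp add: integrable_distr_eq add.commute)
  qed
  have "(\<integral>x. ?q n x \<partial>lborel) = 0" for n
    using integral_translate[of f "t n *\<^sub>R b"] int int_t[of n]
    by (simp add: Bochner_Integration.integral_diff add.commute)
  moreover have "(\<lambda>n. \<integral>x. ?q n x \<partial>lborel) \<longlonglongrightarrow> (\<integral>x. pdiff b f x \<partial>lborel)"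
  proof (rule integral_dominated_convergence[where w="\<lambda>x. B * indicator D x"])
    show "integrable lborel (\<lambda>x. B * indicator D x)"
      using D emeasure_compact_finite[OF D]
      by (intro integrable_mult_right integrable_real_indicator) (auto intro: borel_compact)
    show "AE x in lborel. (\<lambda>n. ?q n x) \<longlonglongrightarrow> pdiff b f x"
    proof (intro AE_I2)
      fix x
      have "((\<lambda>s. f (x + s *\<^sub>R b)) has_real_derivative pdiff b f (x + 0 *\<^sub>R b)) (at 0)"
        by (intro smooth_line_derivative f)
      then have "((\<lambda>h. (f (x + h *\<^sub>R b) - f x) / h) \<longlongrightarrow> pdiff b f x) (at 0)"
        by (simp add: has_field_derivative_iff)
      moreover have "filterlim t (at 0) sequentially"
        using t0 tp by (auto simp: filterlim_at less_imp_neq[symmetric] intro!: always_eventually)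
      ultimately show "(\<lambda>n. ?q n x) \<longlonglongrightarrow> pdiff b f x"
        by (rule filterlim_compose)
    qed
    show "AE x in lborel. norm (?q n x) \<le> B * indicator D x" for n
    proof (intro AE_I2)
      fix x
      have "\<bar>f (x + t n *\<^sub>R b) - f x\<bar> \<le> B * \<bar>t n\<bar>"
        using B by (intro lipschitz_of_pdiff_bound f) auto
      then have 1: "norm (?q n x) \<le> B"
        using tp[of n] by (simp add: divide_simps)
      have "f (x + t n *\<^sub>R b) = 0 \<and> f x = 0" if "x \<notin> D"
      proof -
        have D': "c + s \<in> D" if "c \<in> C" "norm s \<le> norm b" for c s
          using that by (auto simp: D_def)
        have "norm (- t n *\<^sub>R b) \<le> norm b"
          using tp[of n] by (auto simp: mult_left_le_one_le)
        then have "x \<notin> C" "x + t n *\<^sub>R b \<notin> C"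
          using D'[of x 0] D'[of "x + t n *\<^sub>R b" "- t n *\<^sub>R b"] that by auto
        then show ?thesis
          using C(2) by (auto simp: supp_in_def)
      qed
      with 1 show "norm (?q n x) \<le> B * indicator D x"
        by (auto simp: indicator_def)
    qed
  qed auto
  ultimately have "(\<lambda>n::nat. 0) \<longlonglongrightarrow> (\<integral>x. pdiff b f x \<partial>lborel)"
    by (simp only:)
  then show ?thesis
    by (simp add: LIMSEQ_const_iff)
qed

lemma integration_by_parts:
  fixes f g :: "'a::euclidean_space \<Rightarrow> real"
  assumes "f \<in> testf \<Omega>" "smooth g" "b \<in> Basis"
  shows "(\<integral>x. f x * pdiff b g x \<partial>lborel) = - (\<integral>x. pdiff b f x * g x \<partial>lborel)"
proof -
  have fg: "(\<lambda>x. f x * g x) \<in> testf \<Omega>"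
    using assms testf_mult by blast
  then obtain C where "compact C" "supp_in C (\<lambda>x. f x * g x)"
    by (rule testfE)
  then have "(\<integral>x. pdiff b (\<lambda>x. f x * g x) x \<partial>lborel) = 0"
    using fg assms(3) by (intro integral_pdiff_eq_0[of _ b C])
      (auto intro: smooth_differentiable smooth_continuous smooth_pdiff testf_smooth)
  moreover have "pdiff b (\<lambda>x. f x * g x) x = pdiff b f x * g x + f x * pdiff b g x" for x
    using assms by (intro pdiff_mult) (auto intro: smooth_differentiable testf_smooth)
  moreover have "integrable lborel (\<lambda>x. pdiff b f x * g x)" "integrable lborel (\<lambda>x. f x * pdiff b g x)"
    using assms by (auto intro!: testf_integrable testf_mult smooth_pdiff testf_pdiff)
  ultimately show ?thesis
    by simp
qed

lemma integral_lap_commute: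
  fixes f g :: "'a::euclidean_space \<Rightarrow> real"
  assumes f: "f \<in> testf \<Omega>" and g: "smooth g"
  shows "(\<integral>x. f x * lap g x \<partial>lborel) = - (\<integral>x. (\<Sum>b\<in>Basis. pdiff b f x * pdiff b g x) \<partial>lborel)"
    and "(\<integral>x. f x * lap g x \<partial>lborel) = (\<integral>x. lap f x * g x \<partial>lborel)"
proof -
  have i: "integrable lborel (\<lambda>x. f x * pdiff b (pdiff b g) x)"
      "integrable lborel (\<lambda>x. pdiff b f x * pdiff b g x)"
      "integrable lborel (\<lambda>x. pdiff b (pdiff b f) x * g x)" if "b \<in> Basis" for b
    using that f g by (auto intro!: testf_integrable testf_mult smooth_pdiff testf_pdiff)
  have "(\<integral>x. f x * lap g x \<partial>lborel) = (\<Sum>b\<in>Basis. \<integral>x. f x * pdiff b (pdiff b g) x \<partial>lborel)"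
    unfolding lap_def sum_distrib_left using i by (intro Bochner_Integration.integral_sum)
  also have "\<dots> = (\<Sum>b\<in>Basis. - (\<integral>x. pdiff b f x * pdiff b g x \<partial>lborel))"
    using f g by (intro sum.cong integration_by_parts) (auto intro: smooth_pdiff)
  finally have 1: "(\<integral>x. f x * lap g x \<partial>lborel) = (\<Sum>b\<in>Basis. - (\<integral>x. pdiff b f x * pdiff b g x \<partial>lborel))" .
  then show "(\<integral>x. f x * lap g x \<partial>lborel) = - (\<integral>x. (\<Sum>b\<in>Basis. pdiff b f x * pdiff b g x) \<partial>lborel)"
    using i(2) by (simp add: Bochner_Integration.integral_sum sum_negf)
  have "(\<integral>x. lap f x * g x \<partial>lborel) = (\<Sum>b\<in>Basis. \<integral>x. pdiff b (pdiff b f) x * g x \<partial>lborel)"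
    unfolding lap_def sum_distrib_right using i by (intro Bochner_Integration.integral_sum)
  also have "\<dots> = (\<Sum>b\<in>Basis. - (\<integral>x. pdiff b f x * pdiff b g x \<partial>lborel))"
  proof (intro sum.cong refl)
    fix b :: 'a assume b: "b \<in> Basis"
    show "(\<integral>x. pdiff b (pdiff b f) x * g x \<partial>lborel) = - (\<integral>x. pdiff b f x * pdiff b g x \<partial>lborel)"
      using integration_by_parts[OF testf_pdiff[OF f b] g b] by simp
  qed
  finally show "(\<integral>x. f x * lap g x \<partial>lborel) = (\<integral>x. lap f x * g x \<partial>lborel)"
    using 1 by simp
qed

section \<open>Square-integrable functions\<close>

definition l2 :: "('a::euclidean_space \<Rightarrow> real) \<Rightarrow> bool" where
  "l2 f \<longleftrightarrow> f \<in> borel_measurable borel \<and> integrable lborel (\<lambda>x. (f x)\<^sup>2)"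

text \<open>The squared norm. Estimates use the inequality with factors 2 and 2 for a sum in place
  of the triangle inequality, so that they stay free of square roots.\<close>

definition nsq :: "('a::euclidean_space \<Rightarrow> real) \<Rightarrow> real" where
  "nsq f = (\<integral>x. (f x)\<^sup>2 \<partial>lborel)"

lemma l2_measurable [measurable_dest]: "l2 f \<Longrightarrow> f \<in> borel_measurable borel"
  by (simp add: l2_def)

lemma l2_bound:
  assumes "integrable lborel w" "f \<in> borel_measurable borel" "AE x in lborel. (f x)\<^sup>2 \<le> w x"
  shows "l2 f"
  unfolding l2_def
proof (intro conjI Bochner_Integration.integrable_bound[OF assms(1)])
  show "AE x in lborel. norm ((f x)\<^sup>2) \<le> norm (w x)"
    using assms(3) by eventually_elim (auto intro: order_trans[OF _ abs_ge_self])
qed (use assms(2) in auto)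

lemma sum_squared_le: "(a + b)\<^sup>2 \<le> 2 * a\<^sup>2 + 2 * (b::real)\<^sup>2"
  using zero_le_power2[of "a - b"] by (simp add: power2_eq_square algebra_simps)

lemma diff_squared_le: "(a - b)\<^sup>2 \<le> 2 * a\<^sup>2 + 2 * (b::real)\<^sup>2"
  using sum_squared_le[of a "-b"] by simp

lemma l2_add: "l2 f \<Longrightarrow> l2 g \<Longrightarrow> l2 (\<lambda>x. f x + g x)"
  by (rule l2_bound[where w="\<lambda>x. 2 * (f x)\<^sup>2 + 2 * (g x)\<^sup>2"]) (auto simp: l2_def sum_squared_le)

lemma l2_diff: "l2 f \<Longrightarrow> l2 g \<Longrightarrow> l2 (\<lambda>x. f x - g x)"
  by (rule l2_bound[where w="\<lambda>x. 2 * (f x)\<^sup>2 + 2 * (g x)\<^sup>2"]) (auto simp: l2_def diff_squared_le)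

lemma l2_cmult: "l2 f \<Longrightarrow> l2 (\<lambda>x. c * f x)"
  by (auto simp: l2_def power_mult_distrib)

lemma l2_minus: "l2 f \<Longrightarrow> l2 (\<lambda>x. - f x)"
  by (simp add: l2_def)

lemma l2_zero [simp]: "l2 (\<lambda>x. 0)"
  by (simp add: l2_def)

lemma l2_sum: "finite I \<Longrightarrow> (\<And>i. i \<in> I \<Longrightarrow> l2 (f i)) \<Longrightarrow> l2 (\<lambda>x. \<Sum>i\<in>I. f i x)"
  by (induction I rule: finite_induct) (auto intro: l2_add)

lemma l2_mult_bounded:
  assumes "l2 f" "h \<in> borel_measurable borel" "\<And>x. \<bar>h x\<bar> \<le> B"
  shows "l2 (\<lambda>x. h x * f x)"
proof (rule l2_bound[where w="\<lambda>x. B\<^sup>2 * (f x)\<^sup>2"])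
  have "(h x)\<^sup>2 \<le> B\<^sup>2" for x
    using assms(3)[of x] by (metis abs_ge_zero power2_abs power_mono)
  then show "AE x in lborel. (h x * f x)\<^sup>2 \<le> B\<^sup>2 * (f x)\<^sup>2"
    by (auto simp: power_mult_distrib mult_right_mono)
qed (use assms in \<open>auto simp: l2_def\<close>)

lemma l2_testf: "\<phi> \<in> testf \<Omega> \<Longrightarrow> l2 \<phi>"
  using testf_integrable[OF testf_mult[of \<phi> \<Omega> \<phi>]] testf_smooth[of \<phi> \<Omega>]
  by (simp add: l2_def power2_eq_square smooth_measurable)

lemma l2_mult_integrable:
  assumes "l2 f" "l2 g"
  shows "integrable lborel (\<lambda>x. f x * g x)"
proof (rule Bochner_Integration.integrable_bound)
  show "integrable lborel (\<lambda>x. (f x)\<^sup>2 + (g x)\<^sup>2)"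
    using assms by (simp add: l2_def)
  have "\<bar>a * b\<bar> \<le> a\<^sup>2 + b\<^sup>2" for a b :: real
    using sum_squares_bound[of "\<bar>a\<bar>" "\<bar>b\<bar>"] mult_nonneg_nonneg[of "\<bar>a\<bar>" "\<bar>b\<bar>"]
    unfolding abs_mult power2_abs by linarith
  then show "AE x in lborel. norm (f x * g x) \<le> norm ((f x)\<^sup>2 + (g x)\<^sup>2)"
    by (simp add: order_trans[OF _ abs_ge_self])
qed (use assms in \<open>auto simp: l2_def\<close>)

lemma nsq_nonneg [simp]: "0 \<le> nsq f"
  by (simp add: nsq_def)

lemma nsq_minus [simp]: "nsq (\<lambda>x. - f x) = nsq f"
  by (simp add: nsq_def)

lemma nsq_diff_commute: "nsq (\<lambda>x. f x - g x) = nsq (\<lambda>x. g x - f x)"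
  by (simp add: nsq_def power2_commute)

lemma nsq_cmult: "nsq (\<lambda>x. c * f x) = c\<^sup>2 * nsq f"
  by (simp add: nsq_def power_mult_distrib)

lemma nsq_add_le: "l2 f \<Longrightarrow> l2 g \<Longrightarrow> nsq (\<lambda>x. f x + g x) \<le> 2 * nsq f + 2 * nsq g"
  using integral_mono[of lborel "\<lambda>x. (f x + g x)\<^sup>2" "\<lambda>x. 2 * (f x)\<^sup>2 + 2 * (g x)\<^sup>2"] l2_add[of f g]
  by (simp add: nsq_def l2_def sum_squared_le)

lemma nsq_diff_le: "l2 f \<Longrightarrow> l2 g \<Longrightarrow> nsq (\<lambda>x. f x - g x) \<le> 2 * nsq f + 2 * nsq g"
  using nsq_add_le[of f "\<lambda>x. - g x"] by (simp add: l2_minus)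

lemma nsq_mono:
  assumes "l2 g" "f \<in> borel_measurable borel" "\<And>x. \<bar>f x\<bar> \<le> \<bar>g x\<bar>"
  shows "nsq f \<le> nsq g"
proof -
  have "l2 f"
    using assms by (intro l2_bound[where w="\<lambda>x. (g x)\<^sup>2"]) (auto simp: l2_def abs_le_square_iff)
  then show ?thesis
    using assms unfolding nsq_def l2_def by (intro integral_mono) (auto simp: abs_le_square_iff)
qed

lemma nsq_mult_bounded:
  assumes "l2 f" "h \<in> borel_measurable borel" "\<And>x. \<bar>h x\<bar> \<le> B"
  shows "nsq (\<lambda>x. h x * f x) \<le> B\<^sup>2 * nsq f"
proof -
  have "\<bar>h x * f x\<bar> \<le> \<bar>B * f x\<bar>" for x
    using assms(3)[of x] by (auto simp: abs_mult intro!: mult_right_mono)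
  then have "nsq (\<lambda>x. h x * f x) \<le> nsq (\<lambda>x. B * f x)"
    using assms by (intro nsq_mono l2_cmult) auto
  then show ?thesis
    by (simp add: nsq_cmult)
qed

text \<open>The quadratic polynomial t -> nsq (t f + g) is nonnegative; it is evaluated at its
  minimiser when its leading coefficient is positive.\<close>

lemma l2_Cauchy_Schwarz:
  assumes f: "l2 f" and g: "l2 g"
  shows "(\<integral>x. f x * g x \<partial>lborel)\<^sup>2 \<le> nsq f * nsq g"
proof -
  have q: "0 \<le> t\<^sup>2 * nsq f + 2 * t * (\<integral>x. f x * g x \<partial>lborel) + nsq g" for t
  proof -
    have "0 \<le> (\<integral>x. (t * f x + g x)\<^sup>2 \<partial>lborel)"
      by simp
    also have "(\<lambda>x. (t * f x + g x)\<^sup>2) = (\<lambda>x. t\<^sup>2 * (f x)\<^sup>2 + 2 * t * (f x * g x) + (g x)\<^sup>2)"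
      by (auto simp: power2_eq_square algebra_simps)
    finally show ?thesis
      using f g l2_mult_integrable[OF f g] by (simp add: nsq_def l2_def)
  qed
  show ?thesis
  proof (cases "nsq f = 0")
    case True
    let ?I = "\<integral>x. f x * g x \<partial>lborel"
    have "?I = 0"
    proof (rule ccontr)
      assume "?I \<noteq> 0"
      \<comment> \<open>With \<open>nsq f = 0\<close> the polynomial is affine, and at this t its
        value is -1.\<close>
      with q[of "- (nsq g + 1) / (2 * ?I)"] True show False
        by (simp add: field_simps)
    qed
    with True show ?thesis by simp
  next
    case False
    then have pos: "0 < nsq f"
      using nsq_nonneg[of f] by linarith
    have "0 \<le> ((\<integral>x. f x * g x \<partial>lborel) / nsq f)\<^sup>2 * nsq f
        - 2 * ((\<integral>x. f x * g x \<partial>lborel) / nsq f) * (\<integral>x. f x * g x \<partial>lborel) + nsq g"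
      using q[of "- ((\<integral>x. f x * g x \<partial>lborel) / nsq f)"] by simp
    with pos show ?thesis
      by (simp add: power2_eq_square field_simps)
  qed
qed

lemma l2_tendsto_inner:
  assumes "\<And>n. l2 (f n)" "l2 h" "l2 g" "(\<lambda>n. nsq (\<lambda>x. f n x - h x)) \<longlonglongrightarrow> 0"
  shows "(\<lambda>n. \<integral>x. f n x * g x \<partial>lborel) \<longlonglongrightarrow> (\<integral>x. h x * g x \<partial>lborel)"
proof -
  have "(\<lambda>n. ((\<integral>x. f n x * g x \<partial>lborel) - (\<integral>x. h x * g x \<partial>lborel))\<^sup>2) \<longlonglongrightarrow> 0"
  proof (rule tendsto_sandwich[OF _ _ tendsto_const])
    show "(\<lambda>n. nsq (\<lambda>x. f n x - h x) * nsq g) \<longlonglongrightarrow> 0"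
      using tendsto_mult_right[OF assms(4), of "nsq g"] by simp
    have "((\<integral>x. f n x * g x \<partial>lborel) - (\<integral>x. h x * g x \<partial>lborel))\<^sup>2 \<le> nsq (\<lambda>x. f n x - h x) * nsq g" for n
      using l2_Cauchy_Schwarz[of "\<lambda>x. f n x - h x" g] assms(1-3)
      by (simp add: left_diff_distrib l2_diff l2_mult_integrable Bochner_Integration.integral_diff)
    then show "\<forall>\<^sub>F n in sequentially. ((\<integral>x. f n x * g x \<partial>lborel) - (\<integral>x. h x * g x \<partial>lborel))\<^sup>2
        \<le> nsq (\<lambda>x. f n x - h x) * nsq g"
      by simp
  qed auto
  from tendsto_real_sqrt[OF this]
  have "(\<lambda>n. (\<integral>x. f n x * g x \<partial>lborel) - (\<integral>x. h x * g x \<partial>lborel)) \<longlonglongrightarrow> 0"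
    by (simp add: tendsto_rabs_zero_iff)
  then show ?thesis
    by (simp add: LIM_zero_iff)
qed

lemma nsq_tendsto_dominated:
  assumes "\<And>n. f n \<in> borel_measurable borel" "l2 h" "l2 w"
    and "AE x in lborel. (\<lambda>n. f n x) \<longlonglongrightarrow> h x" "\<And>n. AE x in lborel. \<bar>f n x - h x\<bar> \<le> w x"
  shows "(\<lambda>n. nsq (\<lambda>x. f n x - h x)) \<longlonglongrightarrow> 0"
proof -
  have "(\<lambda>n. \<integral>x. (f n x - h x)\<^sup>2 \<partial>lborel) \<longlonglongrightarrow> (\<integral>x. 0 \<partial>(lborel :: 'a measure))"
  proof (rule integral_dominated_convergence[where w="\<lambda>x. (w x)\<^sup>2"])
    show "AE x in lborel. (\<lambda>n. (f n x - h x)\<^sup>2) \<longlonglongrightarrow> 0"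
      using assms(4)
    proof eventually_elim
      case (elim x)
      then have "(\<lambda>n. (f n x - h x)\<^sup>2) \<longlonglongrightarrow> (h x - h x)\<^sup>2"
        by (intro tendsto_intros)
      then show ?case by simp
    qed
    show "AE x in lborel. norm ((f n x - h x)\<^sup>2) \<le> (w x)\<^sup>2" for n
      using assms(5)[of n] by eventually_elim (simp add: abs_le_square_iff[symmetric])
  qed (use assms in \<open>auto simp: l2_def\<close>)
  then show ?thesis
    by (simp add: nsq_def)
qed

section \<open>Convolution\<close>

text \<open>The roles are asymmetric: f is a rough function and k a kernel. Derivatives always fall
  on k.\<close>

definition conv :: "('a::euclidean_space \<Rightarrow> real) \<Rightarrow> ('a \<Rightarrow> real) \<Rightarrow> 'a \<Rightarrow> real" where
  "conv f k = (\<lambda>x. \<integral>y. f y * k (x - y) \<partial>lborel)"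

lemma conv_measurable [measurable (raw)]:
  assumes [measurable]: "f \<in> borel_measurable borel" "k \<in> borel_measurable borel"
  shows "conv f k \<in> borel_measurable borel"
  unfolding conv_def by measurable

lemma compact_neighbourhood:
  fixes C :: "'a::euclidean_space set"
  assumes "compact C"
  shows "compact {c + s |c s. c \<in> C \<and> s \<in> cball 0 r}"
  using assms by (intro compact_sums compact_cball)

lemma testf_reflect:
  assumes "\<rho> \<in> testf \<Omega>"
  shows "(\<lambda>y. \<rho> (x - y)) \<in> testf UNIV"
proof -
  obtain C where C: "smooth \<rho>" "compact C" "supp_in C \<rho>"
    using assms by (rule testfE)
  have "compact ((\<lambda>c. x - c) ` C)"
    using C(2) by (intro compact_continuous_image continuous_intros)
  moreover have "supp_in ((\<lambda>c. x - c) ` C) (\<lambda>y. \<rho> (x - y))"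
    unfolding supp_in_def
  proof (intro allI impI)
    fix y assume y: "y \<notin> (\<lambda>c. x - c) ` C"
    have "x - y \<notin> C"
    proof
      assume "x - y \<in> C"
      then have "x - (x - y) \<in> (\<lambda>c. x - c) ` C"
        by (rule imageI)
      with y show False
        by simp
    qed
    then show "\<rho> (x - y) = 0"
      using C(3) by (simp add: supp_in_def)
  qed
  ultimately show ?thesis
    using smooth_reflect[OF C(1)] by (intro testfI) auto
qed

lemma conv_integrable:
  assumes "l2 f" "\<rho> \<in> testf \<Omega>"
  shows "integrable lborel (\<lambda>y. f y * \<rho> (x - y))"
  using assms by (intro l2_mult_integrable l2_testf[OF testf_reflect])

lemma l2_indicator:
  assumes "compact C"
  shows "l2 (indicator C)"
proof -
  have "integrable lborel (indicat_real C)"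
    using assms emeasure_compact_finite by (intro integrable_real_indicator) (auto intro: borel_compact)
  then show ?thesis
    by (intro l2_bound[of "indicator C"]) (use assms in \<open>auto simp: indicator_def intro: borel_compact\<close>)
qed

text \<open>One constant serves both for the increments and for the differential, so the first-order
  Taylor remainder is at most twice that constant times the norm of h.\<close>

lemma testf_lipschitz:
  assumes "\<rho> \<in> testf \<Omega>"
  shows "\<exists>B>0. (\<forall>x y. \<bar>\<rho> y - \<rho> x\<bar> \<le> B * norm (y - x)) \<and>
    (\<forall>x h. \<bar>frechet_derivative \<rho> (at x) h\<bar> \<le> B * norm h)"
proof -
  have "\<exists>B. \<forall>x. \<bar>pdiff b \<rho> x\<bar> \<le> B" if "b \<in> Basis" for b
    using testf_bounded[OF testf_pdiff[OF assms that]] by metis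
  then obtain B where B: "\<And>b x. b \<in> Basis \<Longrightarrow> \<bar>pdiff b \<rho> x\<bar> \<le> B b"
    by metis
  define B' where "B' = 1 + (\<Sum>b\<in>Basis. \<bar>B b\<bar>)"
  have B'_pos: "0 < B'"
    unfolding B'_def by (rule add_pos_nonneg) (auto intro: sum_nonneg)
  have d: "\<rho> differentiable (at x)" for x
    using assms by (intro smooth_differentiable testf_smooth)
  have D: "\<bar>frechet_derivative \<rho> (at x) h\<bar> \<le> B' * norm h" for x h
  proof -
    have "\<bar>frechet_derivative \<rho> (at x) h\<bar> \<le> (\<Sum>b\<in>Basis. \<bar>(h \<bullet> b) * pdiff b \<rho> x\<bar>)"
      unfolding frechet_derivative_sum_pdiff[OF d] by simp
    also have "\<dots> \<le> (\<Sum>b\<in>Basis. norm h * \<bar>B b\<bar>)"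
      unfolding abs_mult
      by (intro sum_mono mult_mono) (use B Basis_le_norm in \<open>auto intro: order_trans[OF _ abs_ge_self]\<close>)
    also have "\<dots> = (\<Sum>b\<in>Basis. \<bar>B b\<bar>) * norm h"
      by (simp add: sum_distrib_left mult.commute)
    also have "\<dots> \<le> B' * norm h"
      unfolding B'_def by (intro mult_right_mono) auto
    finally show ?thesis .
  qed
  have "norm (\<rho> y - \<rho> x) \<le> B' * norm (y - x)" for x y
  proof (rule differentiable_bound[of UNIV \<rho> "\<lambda>x. frechet_derivative \<rho> (at x)"])
    show "onorm (frechet_derivative \<rho> (at z)) \<le> B'" for z
      using D by (intro onorm_le) simp
  qed (use d frechet_derivative_works in auto)
  with B'_pos D show ?thesis
    by (intro exI[of _ B']) simp
qed

text \<open>Differentiation under the integral by dominated convergence. The Taylor remainder of the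
  kernel, divided by the norm of h, is uniformly bounded and vanishes off a fixed compact set for
  small h, so the majorant is a multiple of |f| on that set; square integrability makes this
  integrable.\<close>

lemma conv_has_derivative:
  assumes f: "l2 f" and \<rho>: "\<rho> \<in> testf UNIV"
  shows "(conv f \<rho> has_derivative (\<lambda>h. \<Sum>b\<in>Basis. (h \<bullet> b) * conv f (pdiff b \<rho>) x)) (at x)"
proof -
  obtain C where C: "compact C" "supp_in C \<rho>" "closed C"
    using \<rho> by (rule testfE)
  obtain B where "0 < B" and B': "\<forall>x y. \<bar>\<rho> y - \<rho> x\<bar> \<le> B * norm (y - x)"
    "\<forall>x h. \<bar>frechet_derivative \<rho> (at x) h\<bar> \<le> B * norm h"
    using testf_lipschitz[OF \<rho>] by blast
  then have B: "0 < B" "\<And>x y. \<bar>\<rho> y - \<rho> x\<bar> \<le> B * norm (y - x)"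
    "\<And>x h. \<bar>frechet_derivative \<rho> (at x) h\<bar> \<le> B * norm h"
    by blast+
  define D where "D = {c + s |c s. c \<in> C \<and> s \<in> cball 0 1}"
  have D: "compact D"
    unfolding D_def by (rule compact_neighbourhood[OF C(1)])
  \<comment> \<open>The reflected neighbourhood: y lies in E as soon as x - y lies in D. It confines
    the integration variable.\<close>
  define E where "E = (\<lambda>c. x - c) ` D"
  have E: "compact E"
    unfolding E_def using D by (intro compact_continuous_image continuous_intros)
  have EI: "y \<in> E" if "x - y \<in> D" for y
  proof -
    have "x - (x - y) \<in> E"
      unfolding E_def using that by (rule imageI)
    then show ?thesis by simp
  qed
  have DI: "c + s \<in> D" if "c \<in> C" "norm s \<le> 1" for c s
    using that by (auto simp: D_def)
  have d: "(\<rho> has_derivative frechet_derivative \<rho> (at z)) (at z)" for z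
    using smooth_differentiable[OF testf_smooth[OF \<rho>]] by (simp add: frechet_derivative_works)
  have [measurable]: "f \<in> borel_measurable borel" "\<rho> \<in> borel_measurable borel"
    using f \<rho> by (auto intro: l2_measurable smooth_measurable testf_smooth)
  have ic: "integrable lborel (\<lambda>y. f y * \<rho> (x - y))" for x
    using f \<rho> by (rule conv_integrable)
  have ip: "integrable lborel (\<lambda>y. f y * pdiff b \<rho> (x - y))" if "b \<in> Basis" for b
    using f testf_pdiff[OF \<rho> that] by (rule conv_integrable)
  define R where "R z h = \<rho> (z + h) - \<rho> z - frechet_derivative \<rho> (at z) h" for z h
  have Rb: "\<bar>R z h\<bar> \<le> 2 * B * norm h" for z h
    unfolding R_def using B(2)[of "z + h" z] B(3)[of z h] by simp
  have R0: "R z h = 0" if "z \<notin> D" "norm h \<le> 1" for z h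
  proof -
    have "z \<notin> C" "z + h \<notin> C"
      using that DI[of z 0] DI[of "z + h" "- h"] by auto
    moreover have "frechet_derivative \<rho> (at z) h = 0"
    proof -
      have "pdiff b \<rho> z = 0" for b
        using supp_in_pdiff[OF C(2,3)] \<open>z \<notin> C\<close> by (simp add: supp_in_def)
      then show ?thesis
        by (subst frechet_derivative_sum_pdiff) (use d in \<open>auto simp: differentiable_def\<close>)
    qed
    ultimately show ?thesis
      using C(2) by (simp add: R_def supp_in_def)
  qed
  have fd: "frechet_derivative \<rho> (at z) h = (\<Sum>b\<in>Basis. (h \<bullet> b) * pdiff b \<rho> z)" for z h
    by (subst frechet_derivative_sum_pdiff) (use d in \<open>auto simp: differentiable_def\<close>)
  have iD: "integrable lborel (\<lambda>y. f y * frechet_derivative \<rho> (at (x - y)) h)" for h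
  proof -
    have "integrable lborel (\<lambda>y. \<Sum>b\<in>Basis. (h \<bullet> b) * (f y * pdiff b \<rho> (x - y)))"
      using ip by (intro Bochner_Integration.integrable_sum integrable_mult_right)
    then show ?thesis
      by (simp add: fd sum_distrib_left mult_ac)
  qed
  have Deq: "(\<Sum>b\<in>Basis. (h \<bullet> b) * conv f (pdiff b \<rho>) x)
      = (\<integral>y. f y * frechet_derivative \<rho> (at (x - y)) h \<partial>lborel)" for h
  proof -
    have "(\<integral>y. f y * frechet_derivative \<rho> (at (x - y)) h \<partial>lborel)
        = (\<integral>y. (\<Sum>b\<in>Basis. (h \<bullet> b) * (f y * pdiff b \<rho> (x - y))) \<partial>lborel)"
      by (simp add: fd sum_distrib_left mult_ac)
    also have "\<dots> = (\<Sum>b\<in>Basis. \<integral>y. (h \<bullet> b) * (f y * pdiff b \<rho> (x - y)) \<partial>lborel)"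
      using ip by (intro Bochner_Integration.integral_sum integrable_mult_right)
    finally show ?thesis
      by (simp add: conv_def)
  qed
  have e: "x - y + h = x + h - y" for y h
    by simp
  have iR: "integrable lborel (\<lambda>y. f y * R (x - y) h)" for h
    unfolding R_def e right_diff_distrib using ic iD by (intro Bochner_Integration.integrable_diff)
  have Req: "conv f \<rho> (x + h) - conv f \<rho> x - (\<Sum>b\<in>Basis. (h \<bullet> b) * conv f (pdiff b \<rho>) x)
      = (\<integral>y. f y * R (x - y) h \<partial>lborel)" for h
    unfolding Deq unfolding conv_def R_def e right_diff_distrib
    using ic iD by simp
  have lim: "(\<lambda>n. norm (conv f \<rho> (x + X n) - conv f \<rho> x - (\<Sum>b\<in>Basis. (X n \<bullet> b) * conv f (pdiff b \<rho>) x))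
      / norm (X n)) \<longlonglongrightarrow> 0"
    if X: "\<And>n. X n \<noteq> 0" "X \<longlonglongrightarrow> 0" for X
  proof -
    have "\<forall>\<^sub>F n in sequentially. norm (X n) < 1"
      using order_tendstoD(2)[OF tendsto_norm[OF X(2)], of 1] by simp
    \<comment> \<open>The remainder is confined to E only for increments of norm at most 1, so the
      sequence is shifted by N before dominated convergence is applied.\<close>
    then obtain N where N: "\<And>n. N \<le> n \<Longrightarrow> norm (X n) < 1"
      by (auto simp: eventually_sequentially)
    have "(\<lambda>n. \<integral>y. f y * R (x - y) (X (n + N)) / norm (X (n + N)) \<partial>lborel)
        \<longlonglongrightarrow> (\<integral>y. 0 \<partial>(lborel :: 'a measure))"
    proof (rule integral_dominated_convergence[where w="\<lambda>y. 2 * B * (\<bar>f y\<bar> * indicator E y)"])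
      have "l2 (\<lambda>y. \<bar>f y\<bar>)"
        using f by (auto simp: l2_def)
      then show "integrable lborel (\<lambda>y. 2 * B * (\<bar>f y\<bar> * indicator E y))"
        by (intro integrable_mult_right l2_mult_integrable l2_indicator E)
      show "AE y in lborel. (\<lambda>n. f y * R (x - y) (X (n + N)) / norm (X (n + N))) \<longlonglongrightarrow> 0"
      proof (rule AE_I2)
        fix y
        have "((\<lambda>h. norm (R (x - y) h) / norm h) \<longlongrightarrow> 0) (at 0)"
          using d[of "x - y"] by (simp add: has_derivative_at R_def)
        then have "(\<lambda>n. norm (R (x - y) (X (n + N))) / norm (X (n + N))) \<longlonglongrightarrow> 0"
          by (rule filterlim_compose)
             (use X LIMSEQ_ignore_initial_segment[OF X(2)] in \<open>auto simp: filterlim_at\<close>)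
        then have "(\<lambda>n. R (x - y) (X (n + N)) / norm (X (n + N))) \<longlonglongrightarrow> 0"
          by (subst tendsto_norm_zero_iff[symmetric]) simp
        from tendsto_mult_right[OF this, of "f y"]
        show "(\<lambda>n. f y * R (x - y) (X (n + N)) / norm (X (n + N))) \<longlonglongrightarrow> 0"
          by (simp add: mult_ac)
      qed
      show "AE y in lborel. norm (f y * R (x - y) (X (n + N)) / norm (X (n + N)))
          \<le> 2 * B * (\<bar>f y\<bar> * indicator E y)" for n
      proof (rule AE_I2)
        fix y
        have 1: "\<bar>R (x - y) (X (n + N))\<bar> / norm (X (n + N)) \<le> 2 * B"
          using Rb[of "x - y" "X (n + N)"] X(1)[of "n + N"] by (simp add: divide_simps)
        show "norm (f y * R (x - y) (X (n + N)) / norm (X (n + N))) \<le> 2 * B * (\<bar>f y\<bar> * indicator E y)"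
        proof (cases "y \<in> E")
          case True
          with mult_left_mono[OF 1, of "\<bar>f y\<bar>"] show ?thesis
            by (simp add: abs_mult mult_ac)
        next
          case False
          then have "R (x - y) (X (n + N)) = 0"
            using EI[of y] N[of "n + N"] by (intro R0) auto
          then show ?thesis
            using False by simp
        qed
      qed
    qed (use iR in \<open>auto intro!: borel_measurable_divide borel_measurable_integrable\<close>)
    then have "(\<lambda>n. (\<integral>y. f y * R (x - y) (X (n + N)) \<partial>lborel) / norm (X (n + N))) \<longlonglongrightarrow> 0"
      by simp
    then have "(\<lambda>n. (\<integral>y. f y * R (x - y) (X n) \<partial>lborel) / norm (X n)) \<longlonglongrightarrow> 0"
      by (rule LIMSEQ_offset)
    from tendsto_norm_zero[OF this] show ?thesis
      unfolding Req by simp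
  qed
  have "bounded_linear (\<lambda>h. \<Sum>b\<in>Basis. (h \<bullet> b) * conv f (pdiff b \<rho>) x)"
    by (intro bounded_linear_sum bounded_linear_mult_const bounded_linear_inner_left)
  moreover have "((\<lambda>h. norm (conv f \<rho> (x + h) - conv f \<rho> x - (\<Sum>b\<in>Basis. (h \<bullet> b) * conv f (pdiff b \<rho>) x))
      / norm h) \<longlongrightarrow> 0) (at 0)"
    unfolding tendsto_at_iff_sequentially using lim by (auto simp: comp_def)
  ultimately show ?thesis
    by (simp add: has_derivative_at)
qed

lemma pdiff_conv:
  assumes "l2 f" "\<rho> \<in> testf UNIV" "b \<in> Basis"
  shows "pdiff b (conv f \<rho>) = conv f (pdiff b \<rho>)"
proof
  fix x
  have "pdiff b (conv f \<rho>) x = (\<Sum>c\<in>Basis. (b \<bullet> c) * conv f (pdiff c \<rho>) x)"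
    by (rule pdiff_eq[OF conv_has_derivative[OF assms(1,2)]])
  also have "\<dots> = (\<Sum>c\<in>Basis. if c = b then conv f (pdiff c \<rho>) x else 0)"
    using assms(3) by (intro sum.cong) (auto simp: inner_Basis)
  finally show "pdiff b (conv f \<rho>) x = conv f (pdiff b \<rho>) x"
    using assms(3) by simp
qed

lemma smooth_conv:
  assumes "l2 f" "\<rho> \<in> testf UNIV"
  shows "smooth (conv f \<rho>)"
proof -
  have d: "conv f \<rho> differentiable_on UNIV" if "\<rho> \<in> testf UNIV" for \<rho>
    using conv_has_derivative[OF assms(1) that] unfolding differentiable_on_def differentiable_def by blast
  have "Ck k (conv f \<rho>)" if "\<rho> \<in> testf UNIV" for k \<rho>
    using that
  proof (induction k arbitrary: \<rho>)
    case 0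
    then show ?case
      using differentiable_imp_continuous_on[OF d] by simp
  next
    case (Suc k)
    then show ?case
      using d by (simp add: pdiff_conv[OF assms(1)] testf_pdiff)
  qed
  with assms(2) show ?thesis
    by (simp add: smooth_def)
qed

lemma lap_conv:
  assumes "l2 f" "\<rho> \<in> testf UNIV"
  shows "lap (conv f \<rho>) = conv f (lap \<rho>)"
proof
  fix x
  have "lap (conv f \<rho>) x = (\<Sum>b\<in>Basis. conv f (pdiff b (pdiff b \<rho>)) x)"
    unfolding lap_def using assms by (intro sum.cong) (simp_all add: pdiff_conv testf_pdiff)
  also have "\<dots> = (\<integral>y. (\<Sum>b\<in>Basis. f y * pdiff b (pdiff b \<rho>) (x - y)) \<partial>lborel)"
    unfolding conv_def using assms
    by (intro Bochner_Integration.integral_sum[symmetric] conv_integrable[of _ _ UNIV]) (auto intro: testf_pdiff)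
  finally show "lap (conv f \<rho>) x = conv f (lap \<rho>) x"
    by (simp add: conv_def lap_def sum_distrib_left)
qed

lemma pdiff_reflect:
  assumes "\<And>z. f differentiable (at z)"
  shows "pdiff b (\<lambda>y. f (x - y)) = (\<lambda>y. - pdiff b f (x - y))"
  using pdiff_affine[of f "-1" _ x b] assms by auto

lemma lap_reflect:
  assumes "smooth f"
  shows "lap (\<lambda>y. f (x - y)) = (\<lambda>y. lap f (x - y))"
proof -
  have "pdiff b (pdiff b (\<lambda>y. f (x - y))) = (\<lambda>y. pdiff b (pdiff b f) (x - y))" if "b \<in> Basis" for b
  proof -
    have "pdiff b (\<lambda>y. - pdiff b f (x - y)) y = - (- pdiff b (pdiff b f) (x - y))" for y
      using pdiff_compose_linear[of uminus "\<lambda>y. pdiff b f (x - y)" y b]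
        smooth_differentiable[OF smooth_reflect[OF smooth_pdiff[OF assms that]]]
        pdiff_reflect[of "pdiff b f" b x] smooth_differentiable[OF smooth_pdiff[OF assms that]]
      by (simp add: bounded_linear_minus bounded_linear_ident)
    then show ?thesis
      using pdiff_reflect[OF smooth_differentiable[OF assms], of b x] by auto
  qed
  then show ?thesis
    by (simp add: lap_def)
qed

text \<open>The reflected kernel y -> \<rho>(x - y) is itself an admissible test function, so the
  weak equation becomes a pointwise one at every x.\<close>

lemma lap_conv_weak:
  assumes "l2 u" "\<rho> \<in> testf UNIV"
    and weak: "\<And>\<phi>. \<phi> \<in> testf UNIV \<Longrightarrow> (\<integral>x. u x * lap \<phi> x \<partial>lborel) = (\<integral>x. f x * \<phi> x \<partial>lborel)"
  shows "lap (conv u \<rho>) = conv f \<rho>"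
proof
  fix x
  show "lap (conv u \<rho>) x = conv f \<rho> x"
    using weak[OF testf_reflect[OF assms(2)], of x] lap_conv[OF assms(1,2)]
      lap_reflect[OF testf_smooth[OF assms(2)]]
    by (simp add: conv_def)
qed

lemma supp_in_conv:
  assumes "supp_in C f" "supp_in (cball 0 r) \<rho>"
  shows "supp_in {c + s |c s. c \<in> C \<and> s \<in> cball 0 r} (conv f \<rho>)"
  unfolding supp_in_def
proof (intro allI impI)
  fix x assume x: "x \<notin> {c + s |c s. c \<in> C \<and> s \<in> cball 0 r}"
  have "f y * \<rho> (x - y) = 0" for y
  proof (rule ccontr)
    assume "f y * \<rho> (x - y) \<noteq> 0"
    then have "y \<in> C" "x - y \<in> cball 0 r"
      using assms unfolding supp_in_def by force+
    moreover have "x = y + (x - y)"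
      by simp
    ultimately show False
      using x by blast
  qed
  then have "(\<lambda>y. f y * \<rho> (x - y)) = (\<lambda>y. 0)"
    by (rule ext)
  then show "conv f \<rho> x = 0"
    unfolding conv_def by (simp only: integral_zero)
qed

section \<open>Young's inequality\<close>

text \<open>Cauchy-Schwarz after splitting k into two square roots, then Tonelli. The values of f
  are in \<open>ennreal\<close> so that the bound also applies to Bessel potentials before their
  finiteness is known.\<close>

lemma young_nn:
  fixes k :: "'a::euclidean_space \<Rightarrow> real"
  assumes [measurable]: "f \<in> borel_measurable borel" "k \<in> borel_measurable borel"
    and nn: "\<And>x. 0 \<le> k x"
  shows "(\<integral>\<^sup>+x. (\<integral>\<^sup>+y. f y * ennreal (k (x - y)) \<partial>lborel)\<^sup>2 \<partial>lborel)
      \<le> (\<integral>\<^sup>+x. ennreal (k x) \<partial>lborel)\<^sup>2 * (\<integral>\<^sup>+x. (f x)\<^sup>2 \<partial>lborel)"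
proof -
  let ?I = "\<integral>\<^sup>+x. ennreal (k x) \<partial>lborel"
  have sq: "ennreal (sqrt t) * ennreal (sqrt t) = ennreal t" if "0 \<le> t" for t
    using that by (simp flip: ennreal_mult)
  have pt: "(\<integral>\<^sup>+y. f y * ennreal (k (x - y)) \<partial>lborel)\<^sup>2
      \<le> (\<integral>\<^sup>+y. (f y)\<^sup>2 * ennreal (k (x - y)) \<partial>lborel) * ?I" for x
  proof -
    have "(\<integral>\<^sup>+y. f y * ennreal (k (x - y)) \<partial>lborel)
        = (\<integral>\<^sup>+y. (f y * ennreal (sqrt (k (x - y)))) * ennreal (sqrt (k (x - y))) \<partial>lborel)"
      using nn by (simp add: mult.assoc sq)
    then have "(\<integral>\<^sup>+y. f y * ennreal (k (x - y)) \<partial>lborel)\<^sup>2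
        \<le> (\<integral>\<^sup>+y. (f y * ennreal (sqrt (k (x - y))))\<^sup>2 \<partial>lborel)
          * (\<integral>\<^sup>+y. (ennreal (sqrt (k (x - y))))\<^sup>2 \<partial>lborel)"
      by (simp add: Cauchy_Schwarz_nn_integral)
    also have "\<dots> = (\<integral>\<^sup>+y. (f y)\<^sup>2 * ennreal (k (x - y)) \<partial>lborel) * (\<integral>\<^sup>+y. ennreal (k (x - y)) \<partial>lborel)"
      using nn by (simp add: power_mult_distrib power2_eq_square[of "ennreal (sqrt _)"] sq)
    also have "(\<integral>\<^sup>+y. ennreal (k (x - y)) \<partial>lborel) = ?I"
      by (rule nn_integral_reflect) measurable
    finally show ?thesis .
  qed
  have "(\<integral>\<^sup>+x. (\<integral>\<^sup>+y. f y * ennreal (k (x - y)) \<partial>lborel)\<^sup>2 \<partial>lborel)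
      \<le> (\<integral>\<^sup>+x. (\<integral>\<^sup>+y. (f y)\<^sup>2 * ennreal (k (x - y)) \<partial>lborel) * ?I \<partial>lborel)"
    by (intro nn_integral_mono pt)
  also have "\<dots> = (\<integral>\<^sup>+x. (\<integral>\<^sup>+y. (f y)\<^sup>2 * ennreal (k (x - y)) \<partial>lborel) \<partial>lborel) * ?I"
    by (rule nn_integral_multc) measurable
  also have "(\<integral>\<^sup>+x. (\<integral>\<^sup>+y. (f y)\<^sup>2 * ennreal (k (x - y)) \<partial>lborel) \<partial>lborel)
      = (\<integral>\<^sup>+y. (\<integral>\<^sup>+x. (f y)\<^sup>2 * ennreal (k (x - y)) \<partial>lborel) \<partial>lborel)"
    by (rule lborel_pair.Fubini') measurable
  also have "\<dots> = (\<integral>\<^sup>+y. (f y)\<^sup>2 * ?I \<partial>lborel)"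
    using nn_integral_translate[of "\<lambda>x. ennreal (k x)" "- y" for y]
    by (simp add: nn_integral_cmult)
  also have "\<dots> = (\<integral>\<^sup>+y. (f y)\<^sup>2 \<partial>lborel) * ?I"
    by (rule nn_integral_multc) measurable
  finally show ?thesis
    by (simp add: power2_eq_square mult_ac)
qed

lemma young:
  fixes k :: "'a::euclidean_space \<Rightarrow> real"
  assumes f: "l2 f" and k: "integrable lborel k" "\<And>x. 0 \<le> k x"
  shows "l2 (conv f k)" "nsq (conv f k) \<le> (\<integral>x. k x \<partial>lborel)\<^sup>2 * nsq f"
proof -
  have [measurable]: "f \<in> borel_measurable borel" "k \<in> borel_measurable borel"
    using f k by auto
  have "ennreal \<bar>conv f k x\<bar> \<le> (\<integral>\<^sup>+y. ennreal \<bar>f y\<bar> * ennreal (k (x - y)) \<partial>lborel)" for x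
  proof (cases "integrable lborel (\<lambda>y. f y * k (x - y))")
    case True
    then have "ennreal (norm (conv f k x)) \<le> (\<integral>\<^sup>+y. ennreal (norm (f y * k (x - y))) \<partial>lborel)"
      unfolding conv_def by (rule integral_norm_bound_ennreal)
    then show ?thesis
      using k(2) by (simp add: abs_mult ennreal_mult)
  next
    \<comment> \<open>Where the integrand is not integrable the Bochner integral has the default
      value 0, which satisfies the bound.\<close>
    case False
    then show ?thesis
      by (simp add: conv_def not_integrable_integral_eq)
  qed
  then have "(\<integral>\<^sup>+x. (ennreal \<bar>conv f k x\<bar>)\<^sup>2 \<partial>lborel)
      \<le> (\<integral>\<^sup>+x. (\<integral>\<^sup>+y. ennreal \<bar>f y\<bar> * ennreal (k (x - y)) \<partial>lborel)\<^sup>2 \<partial>lborel)"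
    by (intro nn_integral_mono power_mono) auto
  also have "\<dots> \<le> (\<integral>\<^sup>+x. ennreal (k x) \<partial>lborel)\<^sup>2 * (\<integral>\<^sup>+x. (ennreal \<bar>f x\<bar>)\<^sup>2 \<partial>lborel)"
    using k(2) by (intro young_nn) measurable
  also have "(\<integral>\<^sup>+x. ennreal (k x) \<partial>lborel) = ennreal (\<integral>x. k x \<partial>lborel)"
    using k by (intro nn_integral_eq_integral) auto
  also have "(\<integral>\<^sup>+x. (ennreal \<bar>f x\<bar>)\<^sup>2 \<partial>lborel) = ennreal (nsq f)"
    using f by (simp add: ennreal_power nsq_def l2_def nn_integral_eq_integral)
  finally have b: "(\<integral>\<^sup>+x. ennreal ((conv f k x)\<^sup>2) \<partial>lborel) \<le> ennreal ((\<integral>x. k x \<partial>lborel)\<^sup>2 * nsq f)"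
    using k by (simp add: ennreal_power ennreal_mult)
  have "integrable lborel (\<lambda>x. (conv f k x)\<^sup>2)"
    unfolding integrable_iff_bounded using b le_less_trans[OF b] by simp
  then show l: "l2 (conv f k)"
    by (simp add: l2_def)
  then have "ennreal (nsq (conv f k)) \<le> ennreal ((\<integral>x. k x \<partial>lborel)\<^sup>2 * nsq f)"
    using b by (simp add: nsq_def l2_def nn_integral_eq_integral)
  then show "nsq (conv f k) \<le> (\<integral>x. k x \<partial>lborel)\<^sup>2 * nsq f"
    by (simp add: ennreal_le_iff)
qed

section \<open>Mollification and density of test functions\<close>

text \<open>The standard bump exp(-1/(r^2 - |x|^2)) on the ball of radius r, zero elsewhere.\<close>

definition bump :: "real \<Rightarrow> 'a::euclidean_space \<Rightarrow> real" where
  "bump r x = flat 0 (r\<^sup>2 - x \<bullet> x)"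

lemma bump_nonneg: "0 \<le> bump r x"
  by (simp add: bump_def flat_nonneg)

lemma bump_pos: "norm x < r \<Longrightarrow> 0 < bump r x"
  using power_strict_mono[of "norm x" r 2] by (simp add: bump_def flat_def dot_square_norm)

lemma smooth_bump: "smooth (bump r)"
proof -
  have "smooth (\<lambda>x::'a. r\<^sup>2 - x \<bullet> x)"
    by (intro smooth_diff smooth_const smooth_inner_self)
  from smooth_compose[OF smooth_flat this] show ?thesis
    by (simp add: bump_def[abs_def])
qed

lemma supp_in_bump: "0 \<le> r \<Longrightarrow> supp_in (cball 0 r) (bump r)"
  by (auto simp: supp_in_def bump_def flat_def dot_square_norm abs_le_square_iff[symmetric] not_le
      dest: less_imp_le)

lemma testf_bump: "0 \<le> r \<Longrightarrow> bump r \<in> testf UNIV"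
  by (rule testfI[OF smooth_bump compact_cball _ supp_in_bump]) auto

lemma integral_bump_pos:
  assumes "0 < r"
  shows "0 < (\<integral>x. bump r (x :: 'a::euclidean_space) \<partial>lborel)"
proof -
  have "open (ball 0 r :: 'a set)" "ball 0 r \<noteq> ({} :: 'a set)"
    using assms by auto
  then have "\<not> negligible (ball 0 r :: 'a set)"
    by (rule open_not_negligible)
  then have "(ball 0 r :: 'a set) \<notin> null_sets lebesgue"
    unfolding negligible_iff_null_sets .
  then have "(ball 0 r :: 'a set) \<notin> null_sets lborel"
    using null_sets_completion_iff[of "ball 0 r :: 'a set" lborel] by simp
  then have nn: "emeasure lborel (ball 0 r :: 'a set) \<noteq> 0"
    by (auto simp: null_sets_def)
  have int: "integrable lborel (bump r :: 'a \<Rightarrow> real)"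
    using assms by (intro testf_integrable[OF testf_bump]) simp
  have "(\<integral>x. bump r (x :: 'a) \<partial>lborel) \<noteq> 0"
  proof
    assume "(\<integral>x. bump r (x :: 'a) \<partial>lborel) = 0"
    then have "AE x in lborel. bump r (x :: 'a) = 0"
      using integral_nonneg_eq_0_iff_AE[OF int] by (simp add: bump_nonneg)
    then have "AE x in lborel. x \<notin> (ball 0 r :: 'a set)"
      by eventually_elim (use bump_pos in fastforce)
    then have "emeasure lborel (ball 0 r :: 'a set) = 0"
      by (subst (asm) AE_iff_measurable[of "ball 0 r"]) auto
    with nn show False ..
  qed
  moreover have "0 \<le> (\<integral>x. bump r (x :: 'a) \<partial>lborel)"
    by (simp add: bump_nonneg)
  ultimately show ?thesis
    by linarith
qed

text \<open>The standard mollifier. Each radius is normalised on its own instead of dilating one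
  kernel.\<close>

definition moll :: "real \<Rightarrow> 'a::euclidean_space \<Rightarrow> real" where
  "moll r x = bump r x / (\<integral>y. bump r (y :: 'a) \<partial>lborel)"

lemma moll:
  assumes "0 < r"
  shows "(moll r :: 'a::euclidean_space \<Rightarrow> real) \<in> testf UNIV" "0 \<le> moll r (x :: 'a)"
    "supp_in (cball 0 r) (moll r :: 'a \<Rightarrow> real)"
    "integrable lborel (moll r :: 'a \<Rightarrow> real)" "(\<integral>x. moll r (x :: 'a) \<partial>lborel) = 1"
proof -
  show *: "(moll r :: 'a \<Rightarrow> real) \<in> testf UNIV"
    using testf_mult[OF testf_bump[of r] smooth_const, of "1 / (\<integral>y. bump r (y :: 'a) \<partial>lborel)"] assms
    by (simp add: moll_def[abs_def])
  show "integrable lborel (moll r :: 'a \<Rightarrow> real)"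
    using * by (rule testf_integrable)
  show "0 \<le> moll r (x :: 'a)"
    using assms integral_bump_pos[of r, where 'a='a] by (simp add: moll_def bump_nonneg)
  show "supp_in (cball 0 r) (moll r :: 'a \<Rightarrow> real)"
    using supp_in_bump[of r, where 'a='a] assms by (simp add: supp_in_def moll_def)
  show "(\<integral>x. moll r (x :: 'a) \<partial>lborel) = 1"
    using integral_bump_pos[OF assms, where 'a='a] by (simp add: moll_def less_imp_neq[symmetric])
qed

lemma conv_moll_l2:
  assumes "l2 f" "0 < r"
  shows "l2 (conv f (moll r))" "nsq (conv f (moll r)) \<le> nsq f"
  using young[OF assms(1) moll(4,2)[OF assms(2)]] by (simp_all add: moll(5)[OF assms(2)])

lemma l2_continuous:
  fixes f :: "'a::euclidean_space \<Rightarrow> real"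
  assumes "continuous_on UNIV f" "compact C" "supp_in C f"
  shows "l2 f"
proof -
  have "integrable lborel (\<lambda>x. (f x)\<^sup>2)"
    using assms by (intro compact_support_integrable[of _ C] continuous_intros) (auto simp: supp_in_def)
  then show ?thesis
    using assms(1) by (simp add: l2_def borel_measurable_continuous_onI)
qed

text \<open>A mollified value is an average with weights of total mass one over the r-ball about x.
  The case e = 0 is included and gives exact equality where f is constant on that ball.\<close>

lemma conv_moll_close:
  assumes f: "l2 f" and r: "0 < r" and e: "\<And>y. norm (y - x) \<le> r \<Longrightarrow> \<bar>f y - a\<bar> \<le> e"
  shows "\<bar>conv f (moll r) x - a\<bar> \<le> e"
proof -
  note m = moll[OF r, where 'a='a]
  have i1: "integrable lborel (\<lambda>y. f y * moll r (x - y))"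
    using f m(1) by (rule conv_integrable)
  have i2: "integrable lborel (\<lambda>y. moll r (x - y))"
    using m(4) by (subst integrable_reflect) auto
  have I2: "(\<integral>y. moll r (x - y) \<partial>lborel) = 1"
    using m(4,5) by (subst integral_reflect) auto
  have "conv f (moll r) x - a = (\<integral>y. (f y - a) * moll r (x - y) \<partial>lborel)"
    using i1 i2 I2 by (simp add: conv_def left_diff_distrib)
  also have "\<bar>\<dots>\<bar> \<le> (\<integral>y. e * moll r (x - y) \<partial>lborel)"
  proof (rule order_trans[OF integral_abs_bound], rule integral_mono)
    have "integrable lborel (\<lambda>y. (f y - a) * moll r (x - y))"
      using i1 i2 by (simp add: left_diff_distrib)
    then show "integrable lborel (\<lambda>y. \<bar>(f y - a) * moll r (x - y)\<bar>)"
      by (rule integrable_abs)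
    show "\<bar>(f y - a) * moll r (x - y)\<bar> \<le> e * moll r (x - y)" for y
    proof (cases "x - y \<in> cball 0 r")
      case True
      then have "norm (y - x) \<le> r"
        by (simp add: norm_minus_commute)
      then show ?thesis
        using m(2)[of "x - y"] e by (simp add: abs_mult mult_right_mono)
    next
      case False
      then show ?thesis
        using m(3) by (simp add: supp_in_def)
    qed
  qed (use i2 in auto)
  finally show ?thesis
    using I2 by simp
qed

lemma conv_moll_uniform:
  fixes f :: "'a::euclidean_space \<Rightarrow> real"
  assumes f: "continuous_on UNIV f" "compact C" "supp_in C f" and "0 < e"
  obtains d where "0 < d" "\<And>r x. 0 < r \<Longrightarrow> r < d \<Longrightarrow> \<bar>conv f (moll r) x - f x\<bar> \<le> e"
proof -
  define D where "D = {c + s |c s. c \<in> C \<and> s \<in> cball 0 (1::real)}"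
  have "compact D"
    unfolding D_def by (rule compact_neighbourhood[OF f(2)])
  then have "uniformly_continuous_on D f"
    by (intro compact_uniformly_continuous continuous_on_subset[OF f(1)]) auto
  then obtain d where d: "0 < d" "\<And>x y. x \<in> D \<Longrightarrow> y \<in> D \<Longrightarrow> dist y x < d \<Longrightarrow> dist (f y) (f x) < e"
    using \<open>0 < e\<close> unfolding uniformly_continuous_on_def by metis
  have DI: "c + s \<in> D" if "c \<in> C" "norm s \<le> 1" for c s
    using that by (auto simp: D_def)
  have close: "\<bar>f y - f x\<bar> \<le> e" if "norm (y - x) \<le> r" "r < min d 1" for x y r
  proof (cases "x \<in> C \<or> y \<in> C")
    case True
    then have "x \<in> D" "y \<in> D"
      using DI[of x 0] DI[of x "y - x"] DI[of y 0] DI[of y "x - y"] that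
      by (auto simp: norm_minus_commute)
    then show ?thesis
      using d(2)[of x y] that by (auto simp: dist_norm)
  next
    case False
    then show ?thesis
      using f(3) \<open>0 < e\<close> by (auto simp: supp_in_def)
  qed
  show ?thesis
  proof (rule that[of "min d 1"])
    show "0 < min d 1"
      using d(1) by simp
    fix r x assume "0 < r" "r < min d 1"
    then show "\<bar>conv f (moll r) x - f x\<bar> \<le> e"
      by (intro conv_moll_close l2_continuous[OF f] close[of _ _ r])
  qed
qed

section \<open>Approximation by test functions, almost everywhere and in square norm\<close>

lemma continuous_approx:
  fixes g :: "'a::euclidean_space \<Rightarrow> real"
  assumes g: "continuous_on UNIV g" "compact C" "supp_in C g" and e: "0 < e" "0 < d"
  obtains \<phi> where "smooth \<phi>" "supp_in {c + s |c s. c \<in> C \<and> s \<in> cball 0 d} \<phi>"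
    "\<And>x. \<bar>\<phi> x - g x\<bar> \<le> e"
proof -
  obtain d' where d': "0 < d'" "\<And>r x. 0 < r \<Longrightarrow> r < d' \<Longrightarrow> \<bar>conv g (moll r) x - g x\<bar> \<le> e"
    using conv_moll_uniform[OF g e(1)] by blast
  define r where "r = min (d'/2) d"
  have r: "0 < r" "r < d'" "r \<le> d"
    using d'(1) e by (auto simp: r_def)
  show ?thesis
  proof (rule that)
    show "smooth (conv g (moll r))"
      using r(1) by (intro smooth_conv l2_continuous[OF g] moll)
    show "supp_in {c + s |c s. c \<in> C \<and> s \<in> cball 0 d} (conv g (moll r))"
      by (rule supp_in_mono[OF supp_in_conv[OF g(3) moll(3)[OF r(1)]]]) (use r in force)
    show "\<bar>conv g (moll r) x - g x\<bar> \<le> e" for x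
      using d'(2) r by blast
  qed
qed

text \<open>A measurable function is an almost-everywhere limit of continuous functions. These are
  truncated to [-M, M], multiplied by a cutoff that equals 1 on C, and mollified with uniform error
  1/(n + 1); the extra 1 in the bound pays for that error. The common compact support and common
  bound are what dominated convergence needs later.\<close>

lemma bounded_ae_approx:
  fixes f :: "'a::euclidean_space \<Rightarrow> real"
  assumes f: "f \<in> borel_measurable borel" "\<And>x. \<bar>f x\<bar> \<le> M" and C: "compact C" "supp_in C f"
    and \<Omega>: "C \<subseteq> \<Omega>" "open \<Omega>"
  shows "\<exists>D \<phi>. compact D \<and> (\<forall>n::nat. \<phi> n \<in> testf \<Omega>) \<and> (\<forall>n. supp_in D (\<phi> n)) \<and>
    (\<forall>n x. \<bar>\<phi> n x\<bar> \<le> M + 1) \<and> (AE x in lborel. (\<lambda>n. \<phi> n x) \<longlonglongrightarrow> f x)"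
proof (cases "C = {}")
  \<comment> \<open>The distance to the empty set is 0 by convention, so the distance cutoff used
    below would not have compact support.\<close>
  case True
  then have "f = (\<lambda>x. 0)"
    using C by (auto simp: supp_in_def)
  moreover have "0 \<le> M"
    using f(2)[of 0] by simp
  moreover have "(\<lambda>x. 0) \<in> testf \<Omega>"
    by (rule testfI[of _ "{}"]) (auto simp: supp_in_def)
  ultimately show ?thesis
    by (intro exI[of _ "{}"] exI[of _ "\<lambda>n x. 0"]) (auto simp: supp_in_def)
next
  case False
  have M: "0 \<le> M"
    using f(2)[of 0] by simp
  obtain d where d: "0 < d" "(\<Union>x\<in>C. cball x d) \<subseteq> \<Omega>"
    using compact_subset_open_imp_cball_epsilon_subset[OF C(1) \<Omega>(2,1)] .
  \<comment> \<open>Half of the room d goes to the support of the cutoff and the other half to the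
    mollification.\<close>
  define E where "E = {x. infdist x C \<le> d/2}"
  have E: "compact E"
    unfolding E_def using False C d by (intro compact_infdist_le) auto
  define D where "D = {c + s |c s. c \<in> E \<and> s \<in> cball 0 (d/2)}"
  have D: "compact D"
    unfolding D_def by (rule compact_neighbourhood[OF E])
  have D\<Omega>: "D \<subseteq> \<Omega>"
  proof
    fix x assume "x \<in> D"
    then obtain e s where es: "x = e + s" "infdist e C \<le> d/2" "norm s \<le> d/2"
      by (auto simp: D_def E_def)
    obtain c where c: "c \<in> C" "infdist e C = dist e c"
      using infdist_attains_inf[OF compact_imp_closed[OF C(1)] False] by blast
    have "dist c x \<le> dist c e + dist e x"
      by (rule dist_triangle)
    then have "dist c x \<le> d"
      using es c by (simp add: dist_norm norm_minus_commute)
    then have "x \<in> cball c d"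
      by simp
    with c(1) d(2) show "x \<in> \<Omega>"
      by blast
  qed
  have "f \<in> borel_measurable lebesgue"
    using f(1) by (simp add: measurable_completion)
  then have "f measurable_on UNIV"
    by (rule lebesgue_measurable_imp_measurable_on) auto
  then obtain N g where N: "negligible N" and g: "\<And>n::nat. continuous_on UNIV (g n)"
    "\<And>x. x \<notin> N \<Longrightarrow> (\<lambda>n. g n x) \<longlonglongrightarrow> f x"
    unfolding measurable_on_def by auto
  define \<eta> where "\<eta> x = max 0 (1 - infdist x C / (d/2))" for x
  have \<eta>: "continuous_on UNIV \<eta>" "\<And>x. 0 \<le> \<eta> x" "\<And>x. \<eta> x \<le> 1" "\<And>x. x \<in> C \<Longrightarrow> \<eta> x = 1" "supp_in E \<eta>"
    using d(1) unfolding \<eta>_def E_def supp_in_def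
    by (auto intro!: continuous_intros simp: infdist_nonneg field_simps)
  define h where "h n x = \<eta> x * max (- M) (min M (g n x))" for n x
  have h: "continuous_on UNIV (h n)" "supp_in E (h n)" "\<bar>h n x\<bar> \<le> M" for n x
  proof -
    show "continuous_on UNIV (h n)"
      unfolding h_def by (intro continuous_intros \<eta> g)
    show "supp_in E (h n)"
      using \<eta>(5) by (simp add: h_def supp_in_def)
    have "\<bar>\<eta> x\<bar> * \<bar>max (- M) (min M (g n x))\<bar> \<le> 1 * M"
      using \<eta>(2,3)[of x] M by (intro mult_mono) auto
    then show "\<bar>h n x\<bar> \<le> M"
      by (simp add: h_def abs_mult)
  qed
  have hlim: "(\<lambda>n. h n x) \<longlonglongrightarrow> f x" if "x \<notin> N" for x
  proof -
    have "(\<lambda>n. h n x) \<longlonglongrightarrow> \<eta> x * max (- M) (min M (f x))"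
      unfolding h_def by (intro tendsto_intros g(2) that)
    moreover have "\<eta> x * max (- M) (min M (f x)) = f x"
    proof (cases "x \<in> C")
      case True
      then show ?thesis
        using \<eta>(4) f(2)[of x] by auto
    next
      case False
      then have "f x = 0"
        using C(2) by (simp add: supp_in_def)
      with M show ?thesis
        by simp
    qed
    ultimately show ?thesis
      by simp
  qed
  have "\<exists>\<phi>. smooth \<phi> \<and> supp_in D \<phi> \<and> (\<forall>x. \<bar>\<phi> x - h n x\<bar> \<le> inverse (real (Suc n)))" for n
  proof -
    obtain \<phi> where "smooth \<phi>" "supp_in {c + s |c s. c \<in> E \<and> s \<in> cball 0 (d/2)} \<phi>"
      "\<And>x. \<bar>\<phi> x - h n x\<bar> \<le> inverse (real (Suc n))"
      by (rule continuous_approx[OF h(1) E h(2), of "inverse (real (Suc n))" "d/2" n]) (use d in auto)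
    then show ?thesis
      unfolding D_def by blast
  qed
  then obtain \<phi> where \<phi>: "\<And>n. smooth (\<phi> n)" "\<And>n. supp_in D (\<phi> n)"
    "\<And>n x. \<bar>\<phi> n x - h n x\<bar> \<le> inverse (real (Suc n))"
    by metis
  show ?thesis
  proof (intro exI conjI allI)
    show "compact D"
      by (rule D)
    show "\<phi> n \<in> testf \<Omega>" for n
      by (rule testfI[OF \<phi>(1) D D\<Omega> \<phi>(2)])
    show "supp_in D (\<phi> n)" for n
      by (rule \<phi>(2))
    show "\<bar>\<phi> n x\<bar> \<le> M + 1" for n x
    proof -
      have "inverse (real (Suc n)) \<le> 1"
        by (simp add: divide_simps)
      then show ?thesis
        using \<phi>(3)[of n x] h(3)[of n x] by linarith
    qed
    have "AE x in lebesgue. x \<notin> N"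
      using N AE_not_in by (simp add: negligible_iff_null_sets)
    then have "AE x in lborel. x \<notin> N"
      by (rule AE_completion_iff[THEN iffD1])
    then show "AE x in lborel. (\<lambda>n. \<phi> n x) \<longlonglongrightarrow> f x"
    proof eventually_elim
      case (elim x)
      have "(\<lambda>n. \<phi> n x - h n x) \<longlonglongrightarrow> 0"
        by (rule Lim_null_comparison[OF _ LIMSEQ_inverse_real_of_nat]) (use \<phi>(3) in auto)
      from tendsto_add[OF this hlim[OF elim]] show ?case
        by simp
    qed
  qed
qed

text \<open>Ideally one tests with sgn F on a ball, which yields the integral of |F| there. Bounded
  test functions converging to it almost everywhere exist, and 2|F| dominates the products.\<close>

lemma fundamental_lemma:
  fixes F :: "'a::euclidean_space \<Rightarrow> real"
  assumes F: "integrable lborel F" and 0: "\<And>\<phi>. \<phi> \<in> testf UNIV \<Longrightarrow> (\<integral>x. F x * \<phi> x \<partial>lborel) = 0"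
  shows "AE x in lborel. F x = 0"
proof -
  have [measurable]: "F \<in> borel_measurable borel"
    using F by auto
  have "AE x in lborel. x \<in> cball 0 (real m) \<longrightarrow> F x = 0" for m
  proof -
    define s where "s x = sgn (F x) * indicator (cball 0 (real m)) x" for x
    have s: "s \<in> borel_measurable borel" "\<And>x. \<bar>s x\<bar> \<le> 1" "supp_in (cball 0 (real m)) s"
      unfolding s_def by (auto simp: supp_in_def indicator_def sgn_if)
    obtain D \<phi> where \<phi>': "\<forall>n. \<phi> n \<in> testf UNIV" "\<forall>n x. \<bar>\<phi> n x\<bar> \<le> 1 + 1"
      and \<phi>3: "AE x in lborel. (\<lambda>n. \<phi> n x) \<longlonglongrightarrow> s x"
      using bounded_ae_approx[OF s(1,2) compact_cball s(3) subset_UNIV open_UNIV] by blast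
    note \<phi> = \<phi>'(1)[rule_format] \<phi>'(2)[rule_format] \<phi>3
    have "(\<lambda>n. \<integral>x. F x * \<phi> n x \<partial>lborel) \<longlonglongrightarrow> (\<integral>x. F x * s x \<partial>lborel)"
    proof (rule integral_dominated_convergence[where w="\<lambda>x. 2 * \<bar>F x\<bar>"])
      show "AE x in lborel. (\<lambda>n. F x * \<phi> n x) \<longlonglongrightarrow> F x * s x"
        using \<phi>(3) by eventually_elim (intro tendsto_intros)
      show "AE x in lborel. norm (F x * \<phi> n x) \<le> 2 * \<bar>F x\<bar>" for n
        using mult_left_mono[OF \<phi>(2)[of n]] by (auto simp: abs_mult mult.commute)
      show "(\<lambda>x. F x * \<phi> n x) \<in> borel_measurable lborel" for n
        using smooth_measurable[OF testf_smooth[OF \<phi>(1)]] by simp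
    qed (use F s in auto)
    then have "(\<integral>x. F x * s x \<partial>lborel) = 0"
      using 0[OF \<phi>(1)] by (simp add: LIMSEQ_const_iff)
    moreover have "F x * s x = \<bar>F x\<bar> * indicator (cball 0 (real m)) x" for x
      by (simp add: s_def abs_sgn mult.assoc[symmetric] mult.commute)
    moreover have "integrable lborel (\<lambda>x. \<bar>F x\<bar> * indicator (cball 0 (real m)) x)"
      using F by (intro integrable_mult_indicator[where f="\<lambda>x. \<bar>F x\<bar>", unfolded real_scaleR_def mult.commute[of "indicator _ _"]]) auto
    ultimately have "AE x in lborel. \<bar>F x\<bar> * indicator (cball 0 (real m)) x = 0"
      by (subst integral_nonneg_eq_0_iff_AE[symmetric]) auto
    then show ?thesis
      by eventually_elim (auto simp: indicator_def)
  qed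
  then have "AE x in lborel. \<forall>m. x \<in> cball 0 (real m) \<longrightarrow> F x = 0"
    by (subst AE_all_countable) blast
  then show ?thesis
  proof eventually_elim
    case (elim x)
    obtain m where "norm x \<le> real m"
      using real_arch_simple by blast
    with elim show ?case
      by auto
  qed
qed

text \<open>Cutting off both the values and the domain gives bounded functions with compact support
  inside \<Omega> and an error dominated by |f|. Test functions inside \<Omega> then approximate the
  cut-off function in square norm, because supports and bounds are uniform.\<close>

lemma l2_density:
  fixes f :: "'a::euclidean_space \<Rightarrow> real"
  assumes f: "l2 f" "supp_in \<Omega> f" and \<Omega>: "open \<Omega>" and "0 < \<delta>"
  obtains \<phi> where "\<phi> \<in> testf \<Omega>" "nsq (\<lambda>x. \<phi> x - f x) < \<delta>"
proof -
  have [measurable]: "f \<in> borel_measurable borel"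
    using f(1) by (rule l2_measurable)
  \<comment> \<open>A compact exhaustion of \<Omega>: bounded, and at distance at least 1/(n + 1)
    from the complement. The second condition is vacuous when \<Omega> is the whole space.\<close>
  define C where "C n = cball 0 (real n) \<inter> {x. \<forall>y\<in>-\<Omega>. inverse (real (Suc n)) \<le> dist x y}" for n
  have C: "compact (C n)" for n
  proof -
    have "closed (\<Inter>y\<in>-\<Omega>. {x. inverse (real (Suc n)) \<le> dist x y})"
      by (intro closed_INT ballI closed_Collect_le continuous_intros)
    moreover have "C n = cball 0 (real n) \<inter> (\<Inter>y\<in>-\<Omega>. {x. inverse (real (Suc n)) \<le> dist x y})"
      by (auto simp: C_def)
    ultimately show ?thesis
      by (simp add: compact_Int_closed)
  qed
  have C\<Omega>: "C n \<subseteq> \<Omega>" for n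
  proof
    fix x assume x: "x \<in> C n"
    show "x \<in> \<Omega>"
    proof (rule ccontr)
      assume "x \<notin> \<Omega>"
      with x have "inverse (real (Suc n)) \<le> dist x x"
        unfolding C_def by blast
      then show False
        by (simp add: divide_simps)
    qed
  qed
  have ev: "\<forall>\<^sub>F n in sequentially. x \<in> C n" if "x \<in> \<Omega>" for x
  proof -
    obtain e where e: "0 < e" "ball x e \<subseteq> \<Omega>"
      by (rule openE[OF \<Omega> \<open>x \<in> \<Omega>\<close>])
    obtain n1 where n1: "norm x \<le> real n1"
      using real_arch_simple by blast
    obtain n2 where n2: "inverse (real (Suc n2)) < e"
      using reals_Archimedean[OF e(1)] by blast
    have "x \<in> C n" if n: "max n1 n2 \<le> n" for n
    proof -
      have i: "inverse (real (Suc n)) \<le> inverse (real (Suc n2))"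
        using n by (intro le_imp_inverse_le) auto
      have "inverse (real (Suc n)) \<le> dist x y" if "y \<in> - \<Omega>" for y
      proof -
        have "y \<notin> ball x e"
          using that e(2) by blast
        then have "e \<le> dist x y"
          by simp
        with i n2 show ?thesis
          by linarith
      qed
      moreover have "norm x \<le> real n"
        using n1 n by linarith
      ultimately show ?thesis
        by (simp add: C_def)
    qed
    then show ?thesis
      by (rule eventually_sequentiallyI[of "max n1 n2"])
  qed
  define g where "g n x = (if \<bar>f x\<bar> \<le> real n \<and> x \<in> C n then f x else 0)" for n x
  have [measurable]: "C n \<in> sets borel" for n
    using C by (rule borel_compact)
  have gm[measurable]: "g n \<in> borel_measurable borel" for n
    unfolding g_def by measurable
  have g: "\<bar>g n x\<bar> \<le> real n" "supp_in (C n) (g n)" "\<bar>g n x\<bar> \<le> \<bar>f x\<bar>" "\<bar>g n x - f x\<bar> \<le> \<bar>f x\<bar>" for n x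
    by (auto simp: g_def supp_in_def)
  have gl2: "l2 (g n)" for n
    using g(3) f(1) by (intro l2_bound[where w="\<lambda>x. (f x)\<^sup>2"]) (auto simp: l2_def abs_le_square_iff)
  have "(\<lambda>n. nsq (\<lambda>x. g n x - f x)) \<longlonglongrightarrow> 0"
  proof (rule nsq_tendsto_dominated[OF gm f(1), where w="\<lambda>x. \<bar>f x\<bar>"])
    show "l2 (\<lambda>x. \<bar>f x\<bar>)"
      using f(1) by (auto simp: l2_def)
    show "AE x in lborel. (\<lambda>n. g n x) \<longlonglongrightarrow> f x"
    proof (rule AE_I2)
      fix x
      show "(\<lambda>n. g n x) \<longlonglongrightarrow> f x"
      proof (cases "x \<in> \<Omega>")
        case True
        obtain m where m: "\<bar>f x\<bar> \<le> real m"
          using real_arch_simple by blast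
        have "\<forall>\<^sub>F n in sequentially. g n x = f x"
          using ev[OF True] eventually_ge_at_top[of m]
          by eventually_elim (use m in \<open>auto simp: g_def\<close>)
        then show ?thesis
          by (rule tendsto_eventually)
      next
        case False
        then have "f x = 0"
          using f(2) by (simp add: supp_in_def)
        then have "g n x = f x" for n
          by (simp add: g_def)
        then show ?thesis
          by simp
      qed
    qed
  qed (use g(4) in simp)
  then have "\<forall>\<^sub>F n in sequentially. nsq (\<lambda>x. g n x - f x) < \<delta> / 4"
    using \<open>0 < \<delta>\<close> by (intro order_tendstoD) auto
  then obtain n where n: "nsq (\<lambda>x. g n x - f x) < \<delta> / 4"
    using eventually_happens'[OF sequentially_bot] by blast
  obtain D \<phi> where \<phi>': "compact D" "\<forall>m. \<phi> m \<in> testf \<Omega>" "\<forall>m. supp_in D (\<phi> m)"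
    "\<forall>m x. \<bar>\<phi> m x\<bar> \<le> real n + 1" and \<phi>5: "AE x in lborel. (\<lambda>m. \<phi> m x) \<longlonglongrightarrow> g n x"
    using bounded_ae_approx[OF gm g(1) C g(2) C\<Omega> \<Omega>, of n] by blast
  note \<phi> = \<phi>'(1) \<phi>'(2)[rule_format] \<phi>'(3)[rule_format] \<phi>'(4)[rule_format] \<phi>5
  have "(\<lambda>m. nsq (\<lambda>x. \<phi> m x - g n x)) \<longlonglongrightarrow> 0"
  proof (rule nsq_tendsto_dominated[OF _ gl2 _ \<phi>(5), where w="\<lambda>x. (2 * real n + 1) * indicator (D \<union> C n) x"])
    show "\<phi> m \<in> borel_measurable borel" for m
      using \<phi>(2) by (intro smooth_measurable testf_smooth)
    show "l2 (\<lambda>x. (2 * real n + 1) * indicator (D \<union> C n) x)"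
      using \<phi>(1) C by (intro l2_cmult l2_indicator compact_Un)
    show "AE x in lborel. \<bar>\<phi> m x - g n x\<bar> \<le> (2 * real n + 1) * indicator (D \<union> C n) x" for m
    proof (rule AE_I2)
      fix x
      show "\<bar>\<phi> m x - g n x\<bar> \<le> (2 * real n + 1) * indicator (D \<union> C n) x"
      proof (cases "x \<in> D \<union> C n")
        case True
        then show ?thesis
          using \<phi>(4)[of m x] g(1)[of n x] by simp
      next
        case False
        then show ?thesis
          using \<phi>(3)[of m] g(2)[of n] by (simp add: supp_in_def)
      qed
    qed
  qed
  then have "\<forall>\<^sub>F m in sequentially. nsq (\<lambda>x. \<phi> m x - g n x) < \<delta> / 4"
    using \<open>0 < \<delta>\<close> by (intro order_tendstoD) auto
  then obtain m where m: "nsq (\<lambda>x. \<phi> m x - g n x) < \<delta> / 4"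
    using eventually_happens'[OF sequentially_bot] by blast
  have "nsq (\<lambda>x. (\<phi> m x - g n x) + (g n x - f x)) \<le> 2 * nsq (\<lambda>x. \<phi> m x - g n x) + 2 * nsq (\<lambda>x. g n x - f x)"
    by (intro nsq_add_le l2_diff gl2 f(1) l2_testf[OF \<phi>(2)])
  then have "nsq (\<lambda>x. \<phi> m x - f x) < \<delta>"
    using m n by simp
  then show ?thesis
    by (rule that[OF \<phi>(2)])
qed

section \<open>Mollifiers as an approximate identity in square norm\<close>

lemma conv_diff:
  assumes "l2 f" "l2 g" "\<rho> \<in> testf UNIV"
  shows "conv (\<lambda>x. f x - g x) \<rho> = (\<lambda>x. conv f \<rho> x - conv g \<rho> x)"
  using conv_integrable[OF assms(1,3)] conv_integrable[OF assms(2,3)]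
  by (auto simp: conv_def left_diff_distrib)

text \<open>Mollification does not increase the square norm, so it suffices to know the convergence
  on a dense class. For test functions it is uniform with supports in one compact set.\<close>

lemma conv_moll_l2_tendsto:
  fixes f :: "'a::euclidean_space \<Rightarrow> real"
  assumes f: "l2 f" and "0 < \<delta>"
  obtains d where "0 < d" "\<And>r. 0 < r \<Longrightarrow> r < d \<Longrightarrow> nsq (\<lambda>x. conv f (moll r) x - f x) < \<delta>"
proof -
  \<comment> \<open>The three errors enter with weights 2, 4 and 4, and 10/12 is less than
    1.\<close>
  obtain \<phi> where \<phi>: "\<phi> \<in> testf UNIV" "nsq (\<lambda>x. \<phi> x - f x) < \<delta> / 12"
    using l2_density[OF f _ open_UNIV, of "\<delta> / 12"] \<open>0 < \<delta>\<close> by (auto simp: supp_in_def)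
  obtain C where C: "smooth \<phi>" "compact C" "supp_in C \<phi>"
    using \<phi>(1) by (rule testfE)
  define D where "D = {c + s |c s. c \<in> C \<and> s \<in> cball 0 (1::real)}"
  have D: "compact D"
    unfolding D_def by (rule compact_neighbourhood[OF C(2)])
  have ind: "l2 (indicator D :: 'a \<Rightarrow> real)"
    by (rule l2_indicator[OF D])
  \<comment> \<open>A uniform error e on D costs e^2 times the measure of D in the squared norm. The
    summand 1 in the denominator keeps e well defined when D is null.\<close>
  define e where "e = sqrt (\<delta> / (12 * (1 + nsq (indicator D :: 'a \<Rightarrow> real))))"
  have pos: "0 < 1 + nsq (indicator D :: 'a \<Rightarrow> real)"
    by (simp add: add_pos_nonneg)
  then have e: "0 < e" "e\<^sup>2 * (1 + nsq (indicator D :: 'a \<Rightarrow> real)) = \<delta> / 12"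
    using \<open>0 < \<delta>\<close> by (auto simp: e_def field_simps)
  obtain d where d: "0 < d" "\<And>r x. 0 < r \<Longrightarrow> r < d \<Longrightarrow> \<bar>conv \<phi> (moll r) x - \<phi> x\<bar> \<le> e"
    using conv_moll_uniform[OF smooth_continuous[OF C(1)] C(2,3) e(1)] by blast
  show ?thesis
  proof (rule that[of "min d 1"])
    fix r assume r: "0 < r" "r < min d 1"
    note l\<phi> = l2_testf[OF \<phi>(1)]
    note m = moll(1)[OF r(1), where 'a='a]
    have "\<bar>conv \<phi> (moll r) x - \<phi> x\<bar> \<le> \<bar>e * indicator D x\<bar>" for x
    proof (cases "x \<in> D")
      case True
      then show ?thesis
        using d(2)[of r x] r e(1) by simp
    next
      case False
      have "supp_in D (conv \<phi> (moll r))"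
        unfolding D_def
        by (rule supp_in_mono[OF supp_in_conv[OF C(3) moll(3)[OF r(1)]]]) (use r in force)
      moreover have "x \<notin> C"
        using False by (force simp: D_def)
      ultimately show ?thesis
        using False C(3) by (simp add: supp_in_def)
    qed
    then have "nsq (\<lambda>x. conv \<phi> (moll r) x - \<phi> x) \<le> nsq (\<lambda>x. e * indicator D x)"
      using l\<phi> m by (intro nsq_mono l2_cmult ind l2_measurable l2_diff conv_moll_l2 r)
    also have "\<dots> \<le> e\<^sup>2 * (1 + nsq (indicator D :: 'a \<Rightarrow> real))"
      unfolding nsq_cmult by (intro mult_left_mono) auto
    also have "\<dots> = \<delta> / 12"
      by (rule e(2))
    finally have 1: "nsq (\<lambda>x. conv \<phi> (moll r) x - \<phi> x) \<le> \<delta> / 12" .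
    have "conv (\<lambda>x. f x - \<phi> x) (moll r) = (\<lambda>x. conv f (moll r) x - conv \<phi> (moll r) x)"
      by (rule conv_diff[OF f l\<phi> m])
    then have 2: "nsq (\<lambda>x. conv f (moll r) x - conv \<phi> (moll r) x) < \<delta> / 12"
      using conv_moll_l2(2)[OF l2_diff[OF f l\<phi>] r(1)] \<phi>(2) nsq_diff_commute[of f \<phi>] by simp
    have "nsq (\<lambda>x. (conv f (moll r) x - conv \<phi> (moll r) x) + ((conv \<phi> (moll r) x - \<phi> x) + (\<phi> x - f x)))
        \<le> 2 * nsq (\<lambda>x. conv f (moll r) x - conv \<phi> (moll r) x)
          + 2 * nsq (\<lambda>x. (conv \<phi> (moll r) x - \<phi> x) + (\<phi> x - f x))"
      by (intro nsq_add_le l2_add l2_diff conv_moll_l2 f l\<phi> r)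
    moreover have "nsq (\<lambda>x. (conv \<phi> (moll r) x - \<phi> x) + (\<phi> x - f x))
        \<le> 2 * nsq (\<lambda>x. conv \<phi> (moll r) x - \<phi> x) + 2 * nsq (\<lambda>x. \<phi> x - f x)"
      by (intro nsq_add_le l2_diff conv_moll_l2 f l\<phi> r)
    ultimately have "nsq (\<lambda>x. (conv f (moll r) x - conv \<phi> (moll r) x) + ((conv \<phi> (moll r) x - \<phi> x) + (\<phi> x - f x))) < \<delta>"
      using 1 2 \<phi>(2) \<open>0 < \<delta>\<close> by linarith
    then show "nsq (\<lambda>x. conv f (moll r) x - f x) < \<delta>"
      by simp
  qed (use d in auto)
qed

section \<open>Gaussians and uniqueness of the Fourier transform\<close>

lemma integral_lborel_prod:
  fixes h :: "'a::euclidean_space \<Rightarrow> real \<Rightarrow> 'c::{real_normed_field,banach,second_countable_topology}"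
  assumes int: "\<And>b. b \<in> Basis \<Longrightarrow> integrable lborel (h b)"
  shows "integrable lborel (\<lambda>x::'a. \<Prod>b\<in>Basis. h b (x \<bullet> b))"
    and "(\<integral>x. (\<Prod>b\<in>Basis. h b (x \<bullet> b)) \<partial>(lborel :: 'a measure)) = (\<Prod>b\<in>Basis. \<integral>t. h b t \<partial>lborel)"
proof -
  interpret product_sigma_finite "\<lambda>_::'a. lborel :: real measure"
    by standard
  have m: "(\<lambda>x::'a. \<Prod>b\<in>Basis. h b (x \<bullet> b)) \<in> borel_measurable borel"
  proof (rule borel_measurable_prod)
    fix b :: 'a assume "b \<in> Basis"
    then have [measurable]: "h b \<in> borel_measurable borel"
      using int by auto
    show "(\<lambda>x. h b (x \<bullet> b)) \<in> borel_measurable borel"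
      by measurable
  qed
  have eq: "(\<Prod>b\<in>Basis. h b ((\<Sum>i\<in>Basis. f i *\<^sub>R i) \<bullet> b)) = (\<Prod>b\<in>Basis. h b (f b))" for f
    by (intro prod.cong) auto
  show "integrable lborel (\<lambda>x::'a. \<Prod>b\<in>Basis. h b (x \<bullet> b))"
    unfolding lborel_eq[where 'a='a]
    by (subst integrable_distr_eq) (use m int in \<open>auto simp: eq intro!: product_integrable_prod\<close>)
  show "(\<integral>x. (\<Prod>b\<in>Basis. h b (x \<bullet> b)) \<partial>(lborel :: 'a measure)) = (\<Prod>b\<in>Basis. \<integral>t. h b t \<partial>lborel)"
    unfolding lborel_eq[where 'a='a]
    by (subst integral_distr) (use m int in \<open>auto simp: eq intro!: product_integral_prod\<close>)
qed

lemma integrable_cis_mult: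
  assumes "integrable M f" "g \<in> borel_measurable M"
  shows "integrable M (\<lambda>x. cis (g x) * complex_of_real (f x))"
proof (rule Bochner_Integration.integrable_bound[OF assms(1)])
  have [measurable]: "f \<in> borel_measurable M"
    using assms(1) by auto
  have [measurable]: "g \<in> borel_measurable M"
    by fact
  have "(\<lambda>x. cis (g x)) \<in> borel_measurable M"
    unfolding cis_conv_exp by measurable
  then show "(\<lambda>x. cis (g x) * complex_of_real (f x)) \<in> borel_measurable M"
    by measurable
qed (simp add: norm_mult)

text \<open>Rescaling reduces the integral to the characteristic function of the standard normal
  distribution.\<close>

lemma normal_density_fourier:
  assumes "0 < \<sigma>"
  shows "(\<integral>x. cis (- (t * x)) * complex_of_real (normal_density 0 \<sigma> x) \<partial>lborel)
    = complex_of_real (exp (- (\<sigma>\<^sup>2 * t\<^sup>2 / 2)))"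
proof -
  have std: "normal_density 0 \<sigma> (\<sigma> * x) = std_normal_density x / \<sigma>" for x
    using assms by (simp add: normal_density_def real_sqrt_mult power_mult_distrib)
  have "(\<integral>x. cis (- (t * x)) * complex_of_real (normal_density 0 \<sigma> x) \<partial>lborel)
      = \<bar>\<sigma>\<bar> *\<^sub>R (\<integral>x. cis (- (t * (0 + \<sigma> * x))) * complex_of_real (normal_density 0 \<sigma> (0 + \<sigma> * x)) \<partial>lborel)"
    using assms by (intro lborel_integral_real_affine) auto
  also have "\<dots> = (\<integral>x. std_normal_density x *\<^sub>R iexp ((- t * \<sigma>) * x) \<partial>lborel)"
    unfolding integral_scaleR_right[symmetric]
  proof (intro Bochner_Integration.integral_cong refl)
    fix x
    have "complex_of_real (normal_density 0 \<sigma> (0 + \<sigma> * x)) = complex_of_real (std_normal_density x) / complex_of_real \<sigma>"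
      by (simp add: std)
    then show "\<bar>\<sigma>\<bar> *\<^sub>R (cis (- (t * (0 + \<sigma> * x))) * complex_of_real (normal_density 0 \<sigma> (0 + \<sigma> * x)))
        = std_normal_density x *\<^sub>R iexp ((- t * \<sigma>) * x)"
      using assms by (simp only:) (simp add: cis_conv_exp scaleR_conv_of_real mult_ac)
  qed
  also have "\<dots> = char std_normal_distribution (- t * \<sigma>)"
    unfolding char_def by (subst integral_density) (auto simp: normal_density_nonneg)
  finally show ?thesis
    by (simp add: char_std_normal_distribution power_mult_distrib mult.commute)
qed

text \<open>The heat kernel at time s: a product of centred normal densities of variance 2 s, with
  transform exp(-s |\<xi>|^2).\<close>

definition gauss :: "real \<Rightarrow> 'a::euclidean_space \<Rightarrow> real" where
  "gauss s x = (1 / sqrt (4 * pi * s)) ^ DIM('a) * exp (- (x \<bullet> x) / (4 * s))"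

lemma gauss_nonneg: "0 < s \<Longrightarrow> 0 \<le> gauss s x"
  by (simp add: gauss_def)

lemma gauss_measurable [measurable (raw)]:
  assumes [measurable]: "f \<in> borel_measurable M" "g \<in> borel_measurable M"
  shows "(\<lambda>x. gauss (f x) (g x)) \<in> borel_measurable M"
  unfolding gauss_def by measurable

lemma gauss_prod:
  fixes x :: "'a::euclidean_space"
  assumes "0 < s"
  shows "gauss s x = (\<Prod>b\<in>Basis. normal_density 0 (sqrt (2 * s)) (x \<bullet> b))"
proof -
  have nd: "normal_density 0 (sqrt (2 * s)) t = 1 / sqrt (4 * pi * s) * exp (- (t\<^sup>2 / (4 * s)))" for t
    using assms by (simp add: normal_density_def mult_ac)
  have "(\<Prod>b\<in>Basis. normal_density 0 (sqrt (2 * s)) (x \<bullet> b))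
      = (\<Prod>b\<in>(Basis :: 'a set). 1 / sqrt (4 * pi * s)) * (\<Prod>b\<in>Basis. exp (- ((x \<bullet> b)\<^sup>2 / (4 * s))))"
    unfolding nd by (simp only: prod.distrib)
  also have "(\<Prod>b\<in>Basis. exp (- ((x \<bullet> b)\<^sup>2 / (4 * s)))) = exp (\<Sum>b\<in>Basis. - ((x \<bullet> b)\<^sup>2 / (4 * s)))"
    by (simp add: exp_sum)
  also have "(\<Sum>b\<in>Basis. - ((x \<bullet> b)\<^sup>2 / (4 * s))) = - (x \<bullet> x) / (4 * s)"
    by (simp add: euclidean_inner[of x x] power2_eq_square sum_negf sum_divide_distrib)
  finally show ?thesis
    by (simp add: gauss_def)
qed

lemma gauss_fourier:
  fixes \<xi> :: "'a::euclidean_space"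
  assumes "0 < s"
  shows "integrable lborel (gauss s :: 'a \<Rightarrow> real)"
    and "(\<integral>x. cis (- (\<xi> \<bullet> x)) * complex_of_real (gauss s x) \<partial>lborel) = complex_of_real (exp (- (s * (\<xi> \<bullet> \<xi>))))"
proof -
  have \<sigma>: "0 < sqrt (2 * s)"
    using assms by simp
  show "integrable lborel (gauss s :: 'a \<Rightarrow> real)"
    using integral_lborel_prod(1)[where 'a='a and h="\<lambda>_. normal_density 0 (sqrt (2 * s))"]
      integrable_normal_density[OF \<sigma>] by (simp add: gauss_prod[OF assms, abs_def])
  have c: "cis (- (\<xi> \<bullet> x)) * complex_of_real (gauss s x)
      = (\<Prod>b\<in>Basis. cis (- ((\<xi> \<bullet> b) * (x \<bullet> b))) * complex_of_real (normal_density 0 (sqrt (2 * s)) (x \<bullet> b)))"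
    for x :: 'a
  proof -
    have "\<i> * complex_of_real (- (\<xi> \<bullet> x)) = (\<Sum>b\<in>Basis. \<i> * complex_of_real (- ((\<xi> \<bullet> b) * (x \<bullet> b))))"
      by (simp add: euclidean_inner[of \<xi> x] sum_distrib_left sum_negf)
    then have "cis (- (\<xi> \<bullet> x)) = (\<Prod>b\<in>Basis. cis (- ((\<xi> \<bullet> b) * (x \<bullet> b))))"
      unfolding cis_conv_exp by (simp only: exp_sum[OF finite_Basis])
    then show ?thesis
      by (simp add: gauss_prod[OF assms] prod.distrib)
  qed
  have "(\<integral>x. cis (- (\<xi> \<bullet> x)) * complex_of_real (gauss s x) \<partial>lborel)
      = (\<Prod>b\<in>Basis. complex_of_real (exp (- ((sqrt (2 * s))\<^sup>2 * (\<xi> \<bullet> b)\<^sup>2 / 2))))"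
    unfolding c
    by (subst integral_lborel_prod(2)[where h="\<lambda>b t. cis (- ((\<xi> \<bullet> b) * t))
          * complex_of_real (normal_density 0 (sqrt (2 * s)) t)"])
       (simp_all add: normal_density_fourier[OF \<sigma>] integrable_cis_mult integrable_normal_density[OF \<sigma>])
  also have "\<dots> = complex_of_real (exp (\<Sum>b\<in>Basis. - (s * (\<xi> \<bullet> b)\<^sup>2)))"
    using assms by (simp add: exp_sum)
  also have "(\<Sum>b\<in>Basis. - (s * (\<xi> \<bullet> b)\<^sup>2)) = - (s * (\<xi> \<bullet> \<xi>))"
    by (simp add: euclidean_inner[of \<xi> \<xi>] power2_eq_square sum_negf sum_distrib_left)
  finally show "(\<integral>x. cis (- (\<xi> \<bullet> x)) * complex_of_real (gauss s x) \<partial>lborel)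
      = complex_of_real (exp (- (s * (\<xi> \<bullet> \<xi>))))" .
qed

lemma integral_gauss:
  assumes "0 < s"
  shows "(\<integral>x. gauss s (x :: 'a::euclidean_space) \<partial>lborel) = 1"
proof -
  have "(\<integral>x. complex_of_real (gauss s (x :: 'a)) \<partial>lborel) = 1"
    using gauss_fourier(2)[OF assms, of "0 :: 'a"] by simp
  then show ?thesis
    by (metis integral_complex_of_real of_real_eq_1_iff)
qed

text \<open>The substitution x = y + c w with c the square root of the time turns the integral into
  an average of \<phi>(y + c w) against a fixed Gaussian. Times that are squares make this root
  explicit.\<close>

lemma gauss_approx_identity:
  fixes \<phi> :: "'a::euclidean_space \<Rightarrow> real"
  assumes \<phi>: "\<phi> \<in> testf UNIV"
  shows "(\<lambda>n. \<integral>x. gauss ((inverse (real (Suc n)))\<^sup>2) (x - y) * \<phi> x \<partial>lborel) \<longlonglongrightarrow> \<phi> y"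
proof -
  define c where "c n = inverse (real (Suc n))" for n
  have c: "0 < c n" for n
    by (simp add: c_def)
  have c0: "c \<longlonglongrightarrow> 0"
    unfolding c_def by (rule LIMSEQ_inverse_real_of_nat)
  have [measurable]: "\<phi> \<in> borel_measurable borel"
    using \<phi> by (intro smooth_measurable testf_smooth)
  obtain B where B: "0 < B" "\<And>x. \<bar>\<phi> x\<bar> \<le> B"
    using testf_bounded[OF \<phi>] by blast
  \<comment> \<open>The Jacobian of the dilation cancels the normalising factor of the heat
    kernel.\<close>
  have sc: "\<bar>c n\<bar> ^ DIM('a) * gauss ((c n)\<^sup>2) (c n *\<^sub>R w) = gauss 1 w" for n and w :: 'a
  proof -
    have "c n * (1 / sqrt (4 * pi * (c n)\<^sup>2)) = 1 / sqrt (4 * pi)"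
      using c[of n] by (simp add: real_sqrt_mult)
    moreover have "(c n *\<^sub>R w) \<bullet> (c n *\<^sub>R w) / (4 * (c n)\<^sup>2) = w \<bullet> w / 4"
      using c[of n] by (simp add: power2_eq_square)
    ultimately show ?thesis
      using c[of n] by (simp add: gauss_def power_mult_distrib[symmetric] mult.assoc[symmetric]
          del: power_mult_distrib power_one_over)
  qed
  have eq: "(\<integral>x. gauss ((c n)\<^sup>2) (x - y) * \<phi> x \<partial>lborel) = (\<integral>w. gauss 1 w * \<phi> (y + c n *\<^sub>R w) \<partial>lborel)" for n
  proof -
    have "(\<integral>x. gauss ((c n)\<^sup>2) (x - y) * \<phi> x \<partial>lborel)
        = (\<integral>x. gauss ((c n)\<^sup>2) (x - y) * \<phi> x \<partial>density (distr lborel borel (\<lambda>x. y + c n *\<^sub>R x)) (\<lambda>_. \<bar>c n\<bar> ^ DIM('a)))"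
      by (subst lborel_affine[of "c n" y, symmetric]) (use c[of n] in auto)
    also have "\<dots> = (\<integral>x. \<bar>c n\<bar> ^ DIM('a) *\<^sub>R (gauss ((c n)\<^sup>2) (x - y) * \<phi> x) \<partial>distr lborel borel (\<lambda>x. y + c n *\<^sub>R x))"
      by (subst integral_density) auto
    also have "\<dots> = (\<integral>w. \<bar>c n\<bar> ^ DIM('a) *\<^sub>R (gauss ((c n)\<^sup>2) (y + c n *\<^sub>R w - y) * \<phi> (y + c n *\<^sub>R w)) \<partial>lborel)"
      by (subst integral_distr) auto
    also have "\<dots> = (\<integral>w. gauss 1 w * \<phi> (y + c n *\<^sub>R w) \<partial>lborel)"
      using sc by (simp add: mult.assoc[symmetric])
    finally show ?thesis .
  qed
  have "(\<lambda>n. \<integral>w. gauss 1 w * \<phi> (y + c n *\<^sub>R w) \<partial>lborel) \<longlonglongrightarrow> (\<integral>w. gauss 1 (w :: 'a) * \<phi> y \<partial>lborel)"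
  proof (rule integral_dominated_convergence[where w="\<lambda>w :: 'a. B * gauss 1 w"])
    show "AE w in lborel. (\<lambda>n. gauss 1 w * \<phi> (y + c n *\<^sub>R w)) \<longlonglongrightarrow> gauss 1 w * \<phi> y"
    proof (rule AE_I2)
      fix w :: 'a
      have "(\<lambda>n. y + c n *\<^sub>R w) \<longlonglongrightarrow> y + 0 *\<^sub>R w"
        by (intro tendsto_intros c0)
      then have "(\<lambda>n. \<phi> (y + c n *\<^sub>R w)) \<longlonglongrightarrow> \<phi> y"
        using continuous_on_tendsto_compose[OF smooth_continuous[OF testf_smooth[OF \<phi>], of UNIV]]
        by simp
      then show "(\<lambda>n. gauss 1 w * \<phi> (y + c n *\<^sub>R w)) \<longlonglongrightarrow> gauss 1 w * \<phi> y"
        by (intro tendsto_intros)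
    qed
    show "AE w in lborel. norm (gauss 1 w * \<phi> (y + c n *\<^sub>R w)) \<le> B * gauss 1 w" for n
    proof (rule AE_I2)
      fix w :: 'a
      have "\<bar>gauss 1 w\<bar> * \<bar>\<phi> (y + c n *\<^sub>R w)\<bar> \<le> gauss 1 w * B"
        by (rule mult_mono) (auto simp: B(2) gauss_nonneg)
      then show "norm (gauss 1 w * \<phi> (y + c n *\<^sub>R w)) \<le> B * gauss 1 w"
        by (simp add: abs_mult mult.commute)
    qed
    show "integrable lborel (\<lambda>w::'a. B * gauss 1 w)"
      by (intro integrable_mult_right gauss_fourier(1)) simp
  qed auto
  then show ?thesis
    unfolding c_def[symmetric] eq by (simp add: integral_gauss)
qed

section \<open>Injectivity of the Fourier transform on integrable functions\<close>

lemma integrable_product_lborel: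
  fixes f :: "'a::euclidean_space \<Rightarrow> real" and g :: "'b::euclidean_space \<Rightarrow> real"
  assumes "integrable lborel f" "integrable lborel g"
  shows "integrable (lborel \<Otimes>\<^sub>M lborel) (\<lambda>(x, y). f x * g y)"
proof -
  have [measurable]: "f \<in> borel_measurable borel" "g \<in> borel_measurable borel"
    using assms by auto
  show ?thesis
    by (rule lborel_pair.Fubini_integrable)
       (use assms in \<open>auto simp: abs_mult intro!: integrable_mult_left\<close>)
qed

text \<open>Gauss summation. A Gaussian is itself a Fourier transform, so by Fubini the convolution
  of F with a Gaussian is an integral against the transform of F and vanishes. Letting the width
  tend to 0 against a test function leaves the integral of F times that function, and the
  fundamental lemma applies.\<close>

lemma fourier_unique:
  fixes F :: "'a::euclidean_space \<Rightarrow> real"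
  assumes F: "integrable lborel F"
    and 0: "\<And>\<xi>. (\<integral>x. cis (- (\<xi> \<bullet> x)) * complex_of_real (F x) \<partial>lborel) = 0"
  shows "AE x in lborel. F x = 0"
proof (rule fundamental_lemma[OF F])
  have [measurable]: "F \<in> borel_measurable borel"
    using F by auto
  have g0: "(\<integral>y. F y * gauss s (x - y) \<partial>lborel) = 0" if s: "0 < s" for s and x :: 'a
  proof -
    define K where "K = (1 / sqrt (4 * pi * s)) ^ DIM('a)"
    \<comment> \<open>At time 1/(4 s) the transform at z is exp(-|z|^2/(4 s)), which is
      \<open>gauss s z\<close> up to the constant K.\<close>
    define g :: "'a \<Rightarrow> real" where "g = gauss (1 / (4 * s))"
    have s': "0 < 1 / (4 * s)"
      using s by simp
    have [measurable]: "g \<in> borel_measurable borel"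
      unfolding g_def by measurable
    have ig: "integrable lborel g"
      unfolding g_def using s' by (rule gauss_fourier)
    let ?h = "\<lambda>y \<xi>. cis (- ((x - y) \<bullet> \<xi>)) * complex_of_real (F y * g \<xi>)"
    have gs: "complex_of_real (gauss s z) = K * (\<integral>\<xi>. cis (- (z \<bullet> \<xi>)) * complex_of_real (g \<xi>) \<partial>lborel)" for z
      unfolding g_def gauss_fourier(2)[OF s'] by (simp add: gauss_def K_def)
    have int: "integrable (lborel \<Otimes>\<^sub>M lborel) (case_prod ?h)"
      using integrable_cis_mult[OF integrable_product_lborel[OF F ig], of "\<lambda>(y, \<xi>). - ((x - y) \<bullet> \<xi>)"]
      by (simp add: case_prod_beta')
    have inner: "(\<integral>y. ?h y \<xi> \<partial>lborel) = 0" for \<xi>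
    proof -
      have "?h y \<xi> = (cis (- (x \<bullet> \<xi>)) * complex_of_real (g \<xi>)) * (cis (- ((- \<xi>) \<bullet> y)) * complex_of_real (F y))" for y
      proof -
        have "cis (- ((x - y) \<bullet> \<xi>)) = cis (- (x \<bullet> \<xi>)) * cis (- ((- \<xi>) \<bullet> y))"
        proof -
          have "- ((x - y) \<bullet> \<xi>) = - (x \<bullet> \<xi>) + - ((- \<xi>) \<bullet> y)"
            by (simp add: inner_diff_left inner_commute[of \<xi> y])
          then show ?thesis
            by (simp only: cis_mult)
        qed
        then show ?thesis
          by (simp add: mult_ac)
      qed
      then have "(\<integral>y. ?h y \<xi> \<partial>lborel)
          = (cis (- (x \<bullet> \<xi>)) * complex_of_real (g \<xi>)) * (\<integral>y. cis (- ((- \<xi>) \<bullet> y)) * complex_of_real (F y) \<partial>lborel)"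
        by (simp only: integral_mult_right_zero)
      then show ?thesis
        by (simp only: 0 mult_zero_right)
    qed
    have "complex_of_real (\<integral>y. F y * gauss s (x - y) \<partial>lborel)
        = (\<integral>y. complex_of_real (F y) * complex_of_real (gauss s (x - y)) \<partial>lborel)"
      by (simp add: integral_complex_of_real[symmetric])
    also have "\<dots> = (\<integral>y. K * (\<integral>\<xi>. ?h y \<xi> \<partial>lborel) \<partial>lborel)"
    proof (intro Bochner_Integration.integral_cong refl)
      fix y
      have "(\<integral>\<xi>. ?h y \<xi> \<partial>lborel) = (\<integral>\<xi>. complex_of_real (F y) * (cis (- ((x - y) \<bullet> \<xi>)) * complex_of_real (g \<xi>)) \<partial>lborel)"
        by (intro Bochner_Integration.integral_cong) (auto simp: mult_ac)
      also have "\<dots> = complex_of_real (F y) * (\<integral>\<xi>. cis (- ((x - y) \<bullet> \<xi>)) * complex_of_real (g \<xi>) \<partial>lborel)"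
        by (rule integral_mult_right_zero)
      finally show "complex_of_real (F y) * complex_of_real (gauss s (x - y)) = K * (\<integral>\<xi>. ?h y \<xi> \<partial>lborel)"
        by (simp add: gs mult_ac)
    qed
    also have "\<dots> = K * (\<integral>y. (\<integral>\<xi>. ?h y \<xi> \<partial>lborel) \<partial>lborel)"
      by (rule integral_mult_right_zero)
    also have "(\<integral>y. (\<integral>\<xi>. ?h y \<xi> \<partial>lborel) \<partial>lborel) = (\<integral>\<xi>. (\<integral>y. ?h y \<xi> \<partial>lborel) \<partial>lborel)"
      by (rule lborel_pair.Fubini_integral[OF int, symmetric])
    also have "\<dots> = 0"
      by (simp only: inner integral_zero)
    finally have "complex_of_real (\<integral>y. F y * gauss s (x - y) \<partial>lborel) = 0"
      by (simp only: mult_zero_right)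
    then show ?thesis
      by (simp only: of_real_eq_0_iff)
  qed
  fix \<phi> :: "'a \<Rightarrow> real" assume \<phi>: "\<phi> \<in> testf UNIV"
  have [measurable]: "\<phi> \<in> borel_measurable borel"
    using \<phi> by (intro smooth_measurable testf_smooth)
  obtain B where B: "0 < B" "\<And>x. \<bar>\<phi> x\<bar> \<le> B"
    using testf_bounded[OF \<phi>] by blast
  define t where "t n = (inverse (real (Suc n)))\<^sup>2" for n
  have t: "0 < t n" for n
    by (simp add: t_def)
  have shift: "integrable lborel (\<lambda>x. gauss (t n) (x - y))" "(\<integral>x. gauss (t n) (x - y) \<partial>lborel) = 1" for n and y :: 'a
  proof -
    have e: "gauss (t n) (x - y) = gauss (t n) (y - x)" for x
      by (simp add: gauss_def inner_diff_left inner_diff_right inner_commute)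
    show "integrable lborel (\<lambda>x. gauss (t n) (x - y))"
      unfolding e by (subst integrable_reflect) (auto intro: gauss_fourier t)
    show "(\<integral>x. gauss (t n) (x - y) \<partial>lborel) = 1"
      unfolding e by (subst integral_reflect) (auto simp: integral_gauss t)
  qed
  have "(\<integral>y. F y * (\<integral>x. gauss (t n) (x - y) * \<phi> x \<partial>lborel) \<partial>lborel) = 0" for n
  proof -
    let ?f = "\<lambda>y x. F y * (gauss (t n) (x - y) * \<phi> x)"
    have int: "integrable (lborel \<Otimes>\<^sub>M lborel) (case_prod ?f)"
    proof (rule Bochner_Integration.integrable_bound)
      show "integrable (lborel \<Otimes>\<^sub>M lborel) (\<lambda>(y, x). B * (F y * gauss (t n) (x - y)))"
      proof (rule lborel_pair.Fubini_integrable)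
        show "integrable lborel (\<lambda>y. \<integral>x. norm (case (y, x) of (y, x) \<Rightarrow> B * (F y * gauss (t n) (x - y))) \<partial>lborel)"
          using F shift by (simp add: abs_mult abs_of_nonneg[OF gauss_nonneg[OF t]])
        show "AE y in lborel. integrable lborel (\<lambda>x. case (y, x) of (y, x) \<Rightarrow> B * (F y * gauss (t n) (x - y)))"
          using shift by simp
      qed measurable
      show "AE z in lborel \<Otimes>\<^sub>M lborel. norm (case_prod ?f z) \<le> norm (case z of (y, x) \<Rightarrow> B * (F y * gauss (t n) (x - y)))"
      proof (rule AE_I2)
        fix z :: "'a \<times> 'a"
        obtain y x where z: "z = (y, x)"
          by (cases z)
        have "\<bar>F y\<bar> * \<bar>gauss (t n) (x - y)\<bar> * \<bar>\<phi> x\<bar> \<le> \<bar>F y\<bar> * \<bar>gauss (t n) (x - y)\<bar> * \<bar>B\<bar>"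
          using B by (intro mult_left_mono) (auto intro: order_trans[OF _ abs_ge_self])
        then show "norm (case_prod ?f z) \<le> norm (case z of (y, x) \<Rightarrow> B * (F y * gauss (t n) (x - y)))"
          by (simp add: z abs_mult mult_ac)
      qed
    qed measurable
    have inner: "(\<integral>y. ?f y x \<partial>lborel) = 0" for x
      using g0[OF t, of n x] by (simp add: mult.assoc[symmetric])
    have "(\<integral>y. F y * (\<integral>x. gauss (t n) (x - y) * \<phi> x \<partial>lborel) \<partial>lborel) = (\<integral>y. (\<integral>x. ?f y x \<partial>lborel) \<partial>lborel)"
      by simp
    also have "\<dots> = (\<integral>x. (\<integral>y. ?f y x \<partial>lborel) \<partial>lborel)"
      by (rule lborel_pair.Fubini_integral[OF int, symmetric])
    also have "\<dots> = 0"
      by (simp only: inner integral_zero)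
    finally show ?thesis .
  qed
  moreover have "(\<lambda>n. \<integral>y. F y * (\<integral>x. gauss (t n) (x - y) * \<phi> x \<partial>lborel) \<partial>lborel) \<longlonglongrightarrow> (\<integral>y. F y * \<phi> y \<partial>lborel)"
  proof (rule integral_dominated_convergence[where w="\<lambda>y. B * \<bar>F y\<bar>"])
    show "AE y in lborel. (\<lambda>n. F y * (\<integral>x. gauss (t n) (x - y) * \<phi> x \<partial>lborel)) \<longlonglongrightarrow> F y * \<phi> y"
      unfolding t_def by (intro AE_I2 tendsto_intros gauss_approx_identity \<phi>)
    show "AE y in lborel. norm (F y * (\<integral>x. gauss (t n) (x - y) * \<phi> x \<partial>lborel)) \<le> B * \<bar>F y\<bar>" for n
    proof (rule AE_I2)
      fix y
      have "\<bar>\<integral>x. gauss (t n) (x - y) * \<phi> x \<partial>lborel\<bar> \<le> (\<integral>x. gauss (t n) (x - y) * B \<partial>lborel)"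
      proof (rule order_trans[OF integral_abs_bound], rule integral_mono')
        show "integrable lborel (\<lambda>x. gauss (t n) (x - y) * B)"
          using shift by simp
        show "\<bar>gauss (t n) (x - y) * \<phi> x\<bar> \<le> gauss (t n) (x - y) * B" for x
          using B gauss_nonneg[OF t, of n "x - y"] by (simp add: abs_mult mult_left_mono)
        show "0 \<le> gauss (t n) (x - y) * B" for x
          using B gauss_nonneg[OF t, of n "x - y"] by simp
      qed
      also have "\<dots> = B"
        using shift by simp
      finally show "norm (F y * (\<integral>x. gauss (t n) (x - y) * \<phi> x \<partial>lborel)) \<le> B * \<bar>F y\<bar>"
        by (simp add: abs_mult mult.commute[of B] mult_left_mono)
    qed
  qed (use F in auto)
  ultimately show "(\<integral>y. F y * \<phi> y \<partial>lborel) = 0"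
    by (simp add: LIMSEQ_const_iff)
qed

section \<open>The Bessel kernel\<close>

text \<open>Extended by zero so that the subordination integral runs over the whole line and the
  values of \<open>gauss s\<close> for s \<le> 0, which carry no meaning, are suppressed.\<close>

definition expd :: "real \<Rightarrow> real" where
  "expd s = (if 0 < s then exp (- s) else 0)"

lemma expd_measurable [measurable]: "expd \<in> borel_measurable borel"
  unfolding expd_def by measurable

text \<open>The integrand is the density of the exponential law of rate 1 + c divided by that rate,
  so its integral is the total mass 1 divided by 1 + c.\<close>

lemma integral_expd:
  assumes "0 \<le> c"
  shows "integrable lborel (\<lambda>s. expd s * exp (- (s * c)))" "(\<integral>s. expd s * exp (- (s * c)) \<partial>lborel) = 1 / (1 + c)"
proof -
  have c: "0 < 1 + c"
    using assms by simp
  interpret prob_space "density lborel (exponential_density (1 + c))"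
    by (rule prob_space_exponential_density[OF c])
  have nn: "(\<integral>\<^sup>+s. ennreal (exponential_density (1 + c) s) \<partial>lborel) = 1"
    using emeasure_space_1 by (simp add: emeasure_density)
  have int: "integrable lborel (exponential_density (1 + c))"
    using nn c by (intro integrableI_nonneg) (auto simp: exponential_density_nonneg)
  then have one: "(\<integral>s. exponential_density (1 + c) s \<partial>lborel) = 1"
    using nn c by (subst (asm) nn_integral_eq_integral) (auto simp: exponential_density_nonneg)
  have ae: "AE s in lborel. exponential_density (1 + c) s / (1 + c) = expd s * exp (- (s * c))"
  proof -
    \<comment> \<open>At s = 0 the exponential density is positive while \<open>expd\<close> is 0,
      hence equality only almost everywhere.\<close>
    have "AE s in lborel. s \<noteq> (0::real)"
      by (rule AE_lborel_singleton)
    then show ?thesis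
    proof eventually_elim
      case (elim s)
      have "exp (- s) * exp (- (s * c)) = exp (- s * (1 + c))"
        by (simp add: exp_add[symmetric] algebra_simps)
      then show ?case
        using c elim by (auto simp: exponential_density_def expd_def)
    qed
  qed
  show "integrable lborel (\<lambda>s. expd s * exp (- (s * c)))"
    by (rule integrable_cong_AE_imp[OF _ _ ae]) (use int in auto)
  have "(\<integral>s. expd s * exp (- (s * c)) \<partial>lborel) = (\<integral>s. exponential_density (1 + c) s / (1 + c) \<partial>lborel)"
    by (rule integral_cong_AE) (use ae in \<open>auto elim: eventually_mono\<close>)
  then show "(\<integral>s. expd s * exp (- (s * c)) \<partial>lborel) = 1 / (1 + c)"
    using one by simp
qed

text \<open>The subordination formula for the kernel of the resolvent of -\<Delta> at -1: an
  exponential average of heat kernels. From dimension two on the integral diverges at the origin,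
  where the Bochner integral takes the value 0; the divergence set is null by
  \<open>besselG_AE\<close>.\<close>

definition besselG :: "'a::euclidean_space \<Rightarrow> real" where
  "besselG x = (\<integral>s. expd s * gauss s x \<partial>lborel)"

lemma besselG_measurable [measurable]: "besselG \<in> borel_measurable borel"
  unfolding besselG_def[abs_def] by measurable

lemma expd_gauss_nonneg: "0 \<le> expd s * gauss s x"
  by (cases "0 < s") (auto simp: expd_def gauss_nonneg)

lemma besselG_nonneg: "0 \<le> besselG x"
  unfolding besselG_def by (simp add: expd_gauss_nonneg)

lemma besselG_minus: "besselG (- x) = besselG x"
  by (simp add: besselG_def gauss_def)

lemma expd_gauss_integrable:
  "integrable (lborel \<Otimes>\<^sub>M lborel) (\<lambda>(s, x). expd s * gauss s (x :: 'a::euclidean_space))"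
proof (rule lborel_pair.Fubini_integrable)
  have "(\<integral>x. norm (case (s, x) of (s, x) \<Rightarrow> expd s * gauss s (x :: 'a)) \<partial>lborel) = expd s" for s
  proof -
    have "(\<integral>x. norm (case (s, x) of (s, x) \<Rightarrow> expd s * gauss s (x :: 'a)) \<partial>lborel) = (\<integral>x. expd s * gauss s (x :: 'a) \<partial>lborel)"
      by (simp only: prod.case real_norm_def abs_of_nonneg[OF expd_gauss_nonneg])
    then show ?thesis
      by (cases "0 < s") (auto simp: integral_gauss expd_def)
  qed
  then show "integrable lborel (\<lambda>s. \<integral>x. norm (case (s, x) of (s, x) \<Rightarrow> expd s * gauss s (x :: 'a)) \<partial>lborel)"
    using integral_expd(1)[of 0] by simp
  have "integrable lborel (\<lambda>x. expd s * gauss s (x :: 'a))" for s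
    by (cases "0 < s") (auto simp: expd_def gauss_fourier)
  then show "AE s in lborel. integrable lborel (\<lambda>x. case (s, x) of (s, x) \<Rightarrow> expd s * gauss s (x :: 'a))"
    by simp
qed measurable

lemma besselG_integrable: "integrable lborel (besselG :: 'a::euclidean_space \<Rightarrow> real)"
  and besselG_AE: "AE x in lborel. integrable lborel (\<lambda>s. expd s * gauss s (x :: 'a))"
  using lborel_pair.integrable_snd[OF expd_gauss_integrable[where 'a='a]]
    lborel_pair.AE_integrable_snd[OF expd_gauss_integrable[where 'a='a]]
  unfolding besselG_def[abs_def] by auto

lemma besselG_fourier:
  fixes \<xi> :: "'a::euclidean_space"
  shows "(\<integral>x. cis (- (\<xi> \<bullet> x)) * complex_of_real (besselG x) \<partial>lborel) = complex_of_real (1 / (1 + \<xi> \<bullet> \<xi>))"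
proof -
  let ?h = "\<lambda>s x. cis (- (\<xi> \<bullet> x)) * complex_of_real (expd s * gauss s x)"
  have int: "integrable (lborel \<Otimes>\<^sub>M lborel) (case_prod ?h)"
    using integrable_cis_mult[OF expd_gauss_integrable, of "\<lambda>(s, x). - (\<xi> \<bullet> x)"]
    by (simp add: case_prod_beta')
  have inner: "(\<integral>x. ?h s x \<partial>lborel) = complex_of_real (expd s * exp (- (s * (\<xi> \<bullet> \<xi>))))" for s
  proof (cases "0 < s")
    case True
    have "(\<integral>x. ?h s x \<partial>lborel) = (\<integral>x. complex_of_real (expd s) * (cis (- (\<xi> \<bullet> x)) * complex_of_real (gauss s x)) \<partial>lborel)"
      by (intro Bochner_Integration.integral_cong) (auto simp: mult_ac)
    also have "\<dots> = complex_of_real (expd s) * (\<integral>x. cis (- (\<xi> \<bullet> x)) * complex_of_real (gauss s x) \<partial>lborel)"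
      by (rule integral_mult_right_zero)
    finally show ?thesis
      by (simp add: gauss_fourier(2)[OF True])
  qed (simp add: expd_def)
  have "(\<integral>x. cis (- (\<xi> \<bullet> x)) * complex_of_real (besselG x) \<partial>lborel) = (\<integral>x. (\<integral>s. ?h s x \<partial>lborel) \<partial>lborel)"
    unfolding besselG_def integral_complex_of_real[symmetric] integral_mult_right_zero[symmetric] ..
  also have "\<dots> = (\<integral>s. (\<integral>x. ?h s x \<partial>lborel) \<partial>lborel)"
    by (rule lborel_pair.Fubini_integral[OF int])
  also have "\<dots> = complex_of_real (\<integral>s. expd s * exp (- (s * (\<xi> \<bullet> \<xi>))) \<partial>lborel)"
    unfolding inner by (rule integral_complex_of_real)
  finally show ?thesis
    by (simp only: integral_expd(2) inner_ge_zero)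
qed

lemma integral_besselG: "(\<integral>x. besselG (x :: 'a::euclidean_space) \<partial>lborel) = 1"
proof -
  have "(\<integral>x. complex_of_real (besselG (x :: 'a)) \<partial>lborel) = 1"
    using besselG_fourier[of "0 :: 'a"] by simp
  then show ?thesis
    by (metis integral_complex_of_real of_real_eq_1_iff)
qed

text \<open>\<open>bessel_kernel\<close> is an arbitrary choice among functions with the prescribed
  transform. The heat kernel average meets that specification, so the chosen function meets it too,
  and injectivity of the transform identifies the two up to a null set. Measurability of the choice
  comes with its integrability.\<close>

lemma bessel_kernel_2:
  "AE x in lborel. bessel_kernel 2 x = besselG (x :: 'a::euclidean_space)"
  and bessel_kernel_2_measurable: "bessel_kernel 2 \<in> borel_measurable (borel :: 'a measure)"
proof -
  let ?c = "(2 * pi) powr (- real DIM('a) / 2)"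
  let ?P = "\<lambda>g :: 'a \<Rightarrow> real. integrable lborel g \<and> (\<forall>\<xi>. fourier (\<lambda>x. complex_of_real (g x)) \<xi> =
           complex_of_real (?c * (1 + (norm \<xi>)\<^sup>2) powr (- 2 / 2)))"
  have c: "?c \<noteq> 0"
    by simp
  have pw: "(1 + (norm \<xi>)\<^sup>2) powr (- 2 / 2) = 1 / (1 + \<xi> \<bullet> \<xi>)" for \<xi> :: 'a
    by (simp add: powr_minus_divide power2_norm_eq_inner add_nonneg_nonneg)
  have eq: "?c *\<^sub>R z = complex_of_real (?c * t) \<longleftrightarrow> z = complex_of_real t" for z t
    using c by (simp add: scaleR_conv_of_real)
  \<comment> \<open>Cancelling the nonzero factor \<open>?c\<close> on both sides restates the
    specification for the unnormalised transform.\<close>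
  have P: "?P g \<longleftrightarrow> integrable lborel g \<and>
      (\<forall>\<xi>. (\<integral>x. cis (- (\<xi> \<bullet> x)) * complex_of_real (g x) \<partial>lborel) = complex_of_real (1 / (1 + \<xi> \<bullet> \<xi>)))" for g
    unfolding pw fourier_def eq ..
  have "?P besselG"
    unfolding P using besselG_integrable besselG_fourier by blast
  then have "?P (SOME g. ?P g)"
    by (rule someI[of ?P])
  then have "?P (bessel_kernel 2)"
    unfolding bessel_kernel_def .
  then have k: "integrable lborel (bessel_kernel 2 :: 'a \<Rightarrow> real)"
    "\<And>\<xi>::'a. (\<integral>x. cis (- (\<xi> \<bullet> x)) * complex_of_real (bessel_kernel 2 x) \<partial>lborel) = complex_of_real (1 / (1 + \<xi> \<bullet> \<xi>))"
    unfolding P by blast+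
  then show "bessel_kernel 2 \<in> borel_measurable (borel :: 'a measure)"
    by auto
  have "AE x in lborel. bessel_kernel 2 x - besselG (x :: 'a) = 0"
  proof (rule fourier_unique)
    show "integrable lborel (\<lambda>x. bessel_kernel 2 x - besselG (x :: 'a))"
      using k(1) besselG_integrable by (rule Bochner_Integration.integrable_diff)
    show "(\<integral>x. cis (- (\<xi> \<bullet> x)) * complex_of_real (bessel_kernel 2 x - besselG x) \<partial>lborel) = 0" for \<xi> :: 'a
      using integrable_cis_mult[OF k(1), of "\<lambda>x. - (\<xi> \<bullet> x)"]
        integrable_cis_mult[OF besselG_integrable, of "\<lambda>x. - (\<xi> \<bullet> x)"]
      by (simp add: right_diff_distrib k(2) besselG_fourier)
  qed
  then show "AE x in lborel. bessel_kernel 2 x = besselG (x :: 'a)"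
    by eventually_elim simp
qed

section \<open>Pointwise representation and lower semicontinuity of potentials\<close>

lemma AE_reflect:
  assumes "AE x in lborel. P x"
  shows "AE y in lborel. P (x - y :: 'a::euclidean_space)"
proof (rule AE_distrD[where f="\<lambda>y. x - y" and M'=borel and P=P])
  show "(\<lambda>y. x - y) \<in> lborel \<rightarrow>\<^sub>M borel"
    by simp
  show "AE x in distr lborel borel (\<lambda>y. x - y). P x"
    unfolding lborel_distr_reflect by (rule assms)
qed

text \<open>Both identities hold at every x: the exceptional null set of kernels is carried to a
  null set of y by y -> x - y. The double integral is the form in which the integrand depends
  continuously on x.\<close>

lemma bessel_potential_2:
  fixes f :: "'a::euclidean_space \<Rightarrow> real"
  assumes [measurable]: "f \<in> borel_measurable borel" and f: "\<And>x. 0 \<le> f x"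
  shows "bessel_potential 2 f x = (\<integral>\<^sup>+y. ennreal (besselG (x - y) * f y) \<partial>lborel)"
    and "bessel_potential 2 f x = (\<integral>\<^sup>+y. (\<integral>\<^sup>+s. ennreal (expd s * gauss s (x - y) * f y) \<partial>lborel) \<partial>lborel)"
proof -
  show 1: "bessel_potential 2 f x = (\<integral>\<^sup>+y. ennreal (besselG (x - y) * f y) \<partial>lborel)"
    unfolding bessel_potential_def
    using AE_reflect[OF bessel_kernel_2, of x] by (intro nn_integral_cong_AE) (auto elim!: eventually_mono)
  have "AE y in lborel. ennreal (besselG (x - y) * f y) = (\<integral>\<^sup>+s. ennreal (expd s * gauss s (x - y) * f y) \<partial>lborel)"
    using AE_reflect[OF besselG_AE, of x]
  proof eventually_elim
    case (elim y)
    then have "(\<integral>\<^sup>+s. ennreal (expd s * gauss s (x - y) * f y) \<partial>lborel)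
        = ennreal (\<integral>s. expd s * gauss s (x - y) * f y \<partial>lborel)"
      using mult_nonneg_nonneg[OF expd_gauss_nonneg f] by (intro nn_integral_eq_integral integrable_mult_left) auto
    then show ?case
      by (simp add: besselG_def)
  qed
  then show "bessel_potential 2 f x = (\<integral>\<^sup>+y. (\<integral>\<^sup>+s. ennreal (expd s * gauss s (x - y) * f y) \<partial>lborel) \<partial>lborel)"
    unfolding 1 by (rule nn_integral_cong_AE)
qed

text \<open>Fatou's lemma in the variables (y, s): the integrand is nonnegative, continuous in x for
  s > 0, and identically zero for s \<le> 0.\<close>

lemma bessel_potential_2_lsc:
  fixes f :: "'a::euclidean_space \<Rightarrow> real"
  assumes [measurable]: "f \<in> borel_measurable borel" and f: "\<And>x. 0 \<le> f x"
    and X: "X \<longlonglongrightarrow> x"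
  shows "bessel_potential 2 f x \<le> liminf (\<lambda>n. bessel_potential 2 f (X n))"
proof -
  let ?g = "\<lambda>z (y, s). ennreal (expd s * gauss s (z - y) * f y)"
  have pot: "bessel_potential 2 f z = (\<integral>\<^sup>+p. ?g z p \<partial>(lborel \<Otimes>\<^sub>M lborel))" for z
    unfolding bessel_potential_2(2)[OF assms(1) f]
    by (subst lborel.nn_integral_fst[symmetric]) auto
  have lim: "(\<lambda>n. ?g (X n) p) \<longlonglongrightarrow> ?g x p" for p
  proof -
    obtain y s where p: "p = (y, s)"
      by (cases p)
    have "(\<lambda>n. expd s * gauss s (X n - y) * f y) \<longlonglongrightarrow> expd s * gauss s (x - y) * f y"
    proof (cases "0 < s")
      case True
      then show ?thesis
        unfolding gauss_def by (intro tendsto_intros X) auto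
    qed (simp add: expd_def)
    then show ?thesis
      unfolding p by (auto intro: tendsto_ennrealI)
  qed
  have "(\<integral>\<^sup>+p. ?g x p \<partial>(lborel \<Otimes>\<^sub>M lborel)) = (\<integral>\<^sup>+p. liminf (\<lambda>n. ?g (X n) p) \<partial>(lborel \<Otimes>\<^sub>M lborel))"
    by (intro nn_integral_cong lim_imp_Liminf[symmetric] lim) simp
  also have "\<dots> \<le> liminf (\<lambda>n. \<integral>\<^sup>+p. ?g (X n) p \<partial>(lborel \<Otimes>\<^sub>M lborel))"
    by (rule nn_integral_liminf) measurable
  finally show ?thesis
    by (simp add: pot)
qed

section \<open>Bessel potentials\<close>

lemma pdiff_cos_inner: "pdiff b (\<lambda>x. cos (\<xi> \<bullet> x)) = (\<lambda>x. - (\<xi> \<bullet> b) * sin (\<xi> \<bullet> x))"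
proof
  fix x
  have "((\<lambda>x. cos (\<xi> \<bullet> x)) has_derivative (\<lambda>h. - (\<xi> \<bullet> h) * sin (\<xi> \<bullet> x))) (at x)"
    by (auto intro!: derivative_eq_intros)
  from pdiff_eq[OF this] show "pdiff b (\<lambda>x. cos (\<xi> \<bullet> x)) x = - (\<xi> \<bullet> b) * sin (\<xi> \<bullet> x)" .
qed

lemma pdiff_sin_inner: "pdiff b (\<lambda>x. sin (\<xi> \<bullet> x)) = (\<lambda>x. (\<xi> \<bullet> b) * cos (\<xi> \<bullet> x))"
proof
  fix x
  have "((\<lambda>x. sin (\<xi> \<bullet> x)) has_derivative (\<lambda>h. (\<xi> \<bullet> h) * cos (\<xi> \<bullet> x))) (at x)"
    by (auto intro!: derivative_eq_intros)
  from pdiff_eq[OF this] show "pdiff b (\<lambda>x. sin (\<xi> \<bullet> x)) x = (\<xi> \<bullet> b) * cos (\<xi> \<bullet> x)" .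
qed

lemma smooth_cos_sin_inner:
  "smooth (\<lambda>x :: 'a::euclidean_space. cos (\<xi> \<bullet> x))" "smooth (\<lambda>x :: 'a. sin (\<xi> \<bullet> x))"
proof -
  have d: "(\<lambda>x. cos (\<xi> \<bullet> x)) differentiable_on UNIV" "(\<lambda>x. sin (\<xi> \<bullet> x)) differentiable_on UNIV"
    unfolding differentiable_on_def differentiable_def by (auto intro!: exI derivative_eq_intros)
  have "Ck k (\<lambda>x :: 'a. cos (\<xi> \<bullet> x)) \<and> Ck k (\<lambda>x :: 'a. sin (\<xi> \<bullet> x))" for k
  proof (induction k)
    case 0
    then show ?case
      by (auto intro!: continuous_intros)
  next
    case (Suc k)
    have "Ck k (\<lambda>x. - (\<xi> \<bullet> b) * sin (\<xi> \<bullet> x))" "Ck k (\<lambda>x. (\<xi> \<bullet> b) * cos (\<xi> \<bullet> x))" for b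
      by (intro Ck_mult Ck_const conjunct1[OF Suc] conjunct2[OF Suc])+
    with d show ?case
      by (simp add: pdiff_cos_inner pdiff_sin_inner)
  qed
  then show "smooth (\<lambda>x :: 'a. cos (\<xi> \<bullet> x))" "smooth (\<lambda>x :: 'a. sin (\<xi> \<bullet> x))"
    by (auto simp: smooth_def)
qed

lemma lap_cos_sin_inner:
  fixes \<xi> :: "'a::euclidean_space"
  shows "lap (\<lambda>x. cos (\<xi> \<bullet> x)) = (\<lambda>x. - (\<xi> \<bullet> \<xi>) * cos (\<xi> \<bullet> x))"
    "lap (\<lambda>x. sin (\<xi> \<bullet> x)) = (\<lambda>x. - (\<xi> \<bullet> \<xi>) * sin (\<xi> \<bullet> x))"
proof -
  have cm: "pdiff b (\<lambda>x. c * f x) = (\<lambda>x. c * pdiff b f x)" if "smooth f" for b c and f :: "'a \<Rightarrow> real"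
    using pdiff_compose_linear[OF bounded_linear_mult_right smooth_differentiable[OF that]] by blast
  show "lap (\<lambda>x. cos (\<xi> \<bullet> x)) = (\<lambda>x. - (\<xi> \<bullet> \<xi>) * cos (\<xi> \<bullet> x))"
    unfolding lap_def pdiff_cos_inner cm[OF smooth_cos_sin_inner(2)] pdiff_sin_inner
    by (simp add: euclidean_inner[of \<xi> \<xi>] sum_distrib_right sum_negf mult.assoc)
  show "lap (\<lambda>x. sin (\<xi> \<bullet> x)) = (\<lambda>x. - (\<xi> \<bullet> \<xi>) * sin (\<xi> \<bullet> x))"
    unfolding lap_def pdiff_sin_inner cm[OF smooth_cos_sin_inner(1)] pdiff_cos_inner
    by (simp add: euclidean_inner[of \<xi> \<xi>] sum_distrib_right sum_negf mult.assoc)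
qed

text \<open>Green's formula is available for real functions, so the exponential is split into cosine
  and sine, both eigenfunctions of the Laplacian with eigenvalue -|\<xi>|^2. Neither has compact
  support, but \<phi> has.\<close>

lemma fourier_lap:
  fixes \<phi> :: "'a::euclidean_space \<Rightarrow> real"
  assumes \<phi>: "\<phi> \<in> testf UNIV"
  shows "(\<integral>x. cis (- (\<xi> \<bullet> x)) * complex_of_real (lap \<phi> x) \<partial>lborel)
    = - complex_of_real (\<xi> \<bullet> \<xi>) * (\<integral>x. cis (- (\<xi> \<bullet> x)) * complex_of_real (\<phi> x) \<partial>lborel)"
proof -
  have split: "(\<integral>x. cis (- (\<xi> \<bullet> x)) * complex_of_real (f x) \<partial>lborel)
      = Complex (\<integral>x. f x * cos (\<xi> \<bullet> x) \<partial>lborel) (- (\<integral>x. f x * sin (\<xi> \<bullet> x) \<partial>lborel))"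
    if f: "f \<in> testf UNIV" for f
  proof -
    have "integrable lborel (\<lambda>x. cis (- (\<xi> \<bullet> x)) * complex_of_real (f x))"
      by (rule integrable_cis_mult[OF testf_integrable[OF f]]) measurable
    then show ?thesis
      by (intro complex_eqI) (simp_all add: integral_Re[symmetric] integral_Im[symmetric] mult.commute
          del: integral_Re integral_Im)
  qed
  have "(\<integral>x. lap \<phi> x * cos (\<xi> \<bullet> x) \<partial>lborel) = - (\<xi> \<bullet> \<xi>) * (\<integral>x. \<phi> x * cos (\<xi> \<bullet> x) \<partial>lborel)"
    unfolding integral_lap_commute(2)[OF \<phi> smooth_cos_sin_inner(1), symmetric] lap_cos_sin_inner
    by (simp only: mult.left_commute[of "\<phi> _"] integral_mult_right_zero)
  moreover have "(\<integral>x. lap \<phi> x * sin (\<xi> \<bullet> x) \<partial>lborel) = - (\<xi> \<bullet> \<xi>) * (\<integral>x. \<phi> x * sin (\<xi> \<bullet> x) \<partial>lborel)"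
    unfolding integral_lap_commute(2)[OF \<phi> smooth_cos_sin_inner(2), symmetric] lap_cos_sin_inner
    by (simp only: mult.left_commute[of "\<phi> _"] integral_mult_right_zero)
  ultimately show ?thesis
    unfolding split[OF \<phi>] split[OF testf_lap[OF \<phi>]] by (simp add: complex_eq_iff)
qed

lemma conv_integrable_pair:
  fixes f k :: "'a::euclidean_space \<Rightarrow> real"
  assumes f: "integrable lborel f" and k: "integrable lborel k"
  shows "integrable (lborel \<Otimes>\<^sub>M lborel) (\<lambda>(y, x). f y * k (x - y))"
proof -
  have [measurable]: "f \<in> borel_measurable borel" "k \<in> borel_measurable borel"
    using f k by auto
  have k': "integrable lborel (\<lambda>x. k (x - y))" "(\<integral>x. \<bar>k (x - y)\<bar> \<partial>lborel) = (\<integral>x. \<bar>k x\<bar> \<partial>lborel)" for y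
  proof -
    have "integrable (distr lborel borel ((+) (- y))) k"
      using k by (simp add: lborel_distr_plus)
    then show "integrable lborel (\<lambda>x. k (x - y))"
      by (simp add: integrable_distr_eq)
    show "(\<integral>x. \<bar>k (x - y)\<bar> \<partial>lborel) = (\<integral>x. \<bar>k x\<bar> \<partial>lborel)"
      using integral_translate[of "\<lambda>x. \<bar>k x\<bar>" "- y"] by simp
  qed
  show ?thesis
  proof (rule lborel_pair.Fubini_integrable)
    show "integrable lborel (\<lambda>y. \<integral>x. norm (case (y, x) of (y, x) \<Rightarrow> f y * k (x - y)) \<partial>lborel)"
      using f k' by (simp add: abs_mult)
    show "AE y in lborel. integrable lborel (\<lambda>x. case (y, x) of (y, x) \<Rightarrow> f y * k (x - y))"
      using k' by simp
  qed measurable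
qed

lemma fourier_conv:
  fixes f k :: "'a::euclidean_space \<Rightarrow> real"
  assumes f: "integrable lborel f" and k: "integrable lborel k"
  shows "integrable lborel (conv f k)"
    and "(\<integral>x. cis (- (\<xi> \<bullet> x)) * complex_of_real (conv f k x) \<partial>lborel)
      = (\<integral>y. cis (- (\<xi> \<bullet> y)) * complex_of_real (f y) \<partial>lborel) * (\<integral>x. cis (- (\<xi> \<bullet> x)) * complex_of_real (k x) \<partial>lborel)"
proof -
  have [measurable]: "f \<in> borel_measurable borel" "k \<in> borel_measurable borel"
    using f k by auto
  note pair = conv_integrable_pair[OF f k]
  show "integrable lborel (conv f k)"
    using lborel_pair.integrable_snd[OF pair] by (simp add: conv_def)
  let ?h = "\<lambda>y x. cis (- (\<xi> \<bullet> x)) * complex_of_real (f y * k (x - y))"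
  have int: "integrable (lborel \<Otimes>\<^sub>M lborel) (case_prod ?h)"
    using integrable_cis_mult[OF pair, of "\<lambda>(y, x). - (\<xi> \<bullet> x)"] by (simp add: case_prod_beta')
  have inner: "(\<integral>x. ?h y x \<partial>lborel)
      = (cis (- (\<xi> \<bullet> y)) * complex_of_real (f y)) * (\<integral>x. cis (- (\<xi> \<bullet> x)) * complex_of_real (k x) \<partial>lborel)" for y
  proof -
    have "?h y x = (cis (- (\<xi> \<bullet> y)) * complex_of_real (f y))
        * (cis (- (\<xi> \<bullet> (x - y))) * complex_of_real (k (x - y)))" for x
    proof -
      have "- (\<xi> \<bullet> x) = - (\<xi> \<bullet> y) + - (\<xi> \<bullet> (x - y))"
        by (simp add: inner_diff_right)
      then have "cis (- (\<xi> \<bullet> x)) = cis (- (\<xi> \<bullet> y)) * cis (- (\<xi> \<bullet> (x - y)))"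
        by (simp only: cis_mult)
      then show ?thesis
        by (simp only: of_real_mult mult_ac)
    qed
    then have "(\<integral>x. ?h y x \<partial>lborel) = (\<integral>x. (cis (- (\<xi> \<bullet> y)) * complex_of_real (f y))
        * (cis (- (\<xi> \<bullet> (x - y))) * complex_of_real (k (x - y))) \<partial>lborel)"
      by (rule Bochner_Integration.integral_cong[OF refl])
    also have "\<dots> = (cis (- (\<xi> \<bullet> y)) * complex_of_real (f y))
        * (\<integral>x. cis (- (\<xi> \<bullet> (- y + x))) * complex_of_real (k (- y + x)) \<partial>lborel)"
      by (simp only: integral_mult_right_zero) simp
    also have "(\<integral>x. cis (- (\<xi> \<bullet> (- y + x))) * complex_of_real (k (- y + x)) \<partial>lborel)
        = (\<integral>x. cis (- (\<xi> \<bullet> x)) * complex_of_real (k x) \<partial>lborel)"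
    proof (rule integral_translate[of "\<lambda>x. cis (- (\<xi> \<bullet> x)) * complex_of_real (k x)"])
      show "(\<lambda>x. cis (- (\<xi> \<bullet> x)) * complex_of_real (k x)) \<in> borel_measurable borel"
        unfolding cis_conv_exp by measurable
    qed
    finally show ?thesis .
  qed
  have "(\<integral>x. cis (- (\<xi> \<bullet> x)) * complex_of_real (conv f k x) \<partial>lborel) = (\<integral>x. (\<integral>y. ?h y x \<partial>lborel) \<partial>lborel)"
    unfolding conv_def integral_complex_of_real[symmetric] integral_mult_right_zero[symmetric] ..
  also have "\<dots> = (\<integral>y. (\<integral>x. ?h y x \<partial>lborel) \<partial>lborel)"
    by (rule lborel_pair.Fubini_integral[OF int])
  finally show "(\<integral>x. cis (- (\<xi> \<bullet> x)) * complex_of_real (conv f k x) \<partial>lborel)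
      = (\<integral>y. cis (- (\<xi> \<bullet> y)) * complex_of_real (f y) \<partial>lborel) * (\<integral>x. cis (- (\<xi> \<bullet> x)) * complex_of_real (k x) \<partial>lborel)"
    by (simp only: inner integral_mult_left_zero)
qed

lemma testf_diff: "\<phi> \<in> testf \<Omega> \<Longrightarrow> \<psi> \<in> testf \<Omega> \<Longrightarrow> (\<lambda>x. \<phi> x - \<psi> x) \<in> testf \<Omega>"
  using testf_add[of \<phi> \<Omega> "\<lambda>x. \<psi> x * (- 1)"] testf_mult[of \<psi> \<Omega> "\<lambda>_. - 1"] by simp

text \<open>On the Fourier side 1 - \<Delta> multiplies by 1 + |\<xi>|^2 and the kernel divides by
  it, so both sides have the same transform.\<close>

lemma conv_besselG_inverse:
  fixes \<phi> :: "'a::euclidean_space \<Rightarrow> real"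
  assumes \<phi>: "\<phi> \<in> testf UNIV"
  shows "AE x in lborel. conv (\<lambda>y. \<phi> y - lap \<phi> y) besselG x = \<phi> x"
proof -
  have \<psi>: "integrable lborel (\<lambda>y. \<phi> y - lap \<phi> y)"
    by (intro testf_integrable[of _ UNIV] testf_diff testf_lap \<phi>)
  note i = testf_integrable[OF \<phi>] testf_integrable[OF testf_lap[OF \<phi>]]
  have "AE x in lborel. conv (\<lambda>y. \<phi> y - lap \<phi> y) besselG x - \<phi> x = 0"
  proof (rule fourier_unique)
    show "integrable lborel (\<lambda>x. conv (\<lambda>y. \<phi> y - lap \<phi> y) besselG x - \<phi> x)"
      by (intro Bochner_Integration.integrable_diff fourier_conv \<psi> besselG_integrable i)
    fix \<xi> :: 'a
    let ?F = "\<lambda>f. \<integral>x. cis (- (\<xi> \<bullet> x)) * complex_of_real (f x) \<partial>lborel"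
    have d: "?F (\<lambda>x. f x - g x) = ?F f - ?F g" if "integrable lborel f" "integrable lborel g" for f g
      using integrable_cis_mult[OF that(1), of "\<lambda>x. - (\<xi> \<bullet> x)"] integrable_cis_mult[OF that(2), of "\<lambda>x. - (\<xi> \<bullet> x)"]
      by (simp add: right_diff_distrib)
    have nz: "complex_of_real (1 + \<xi> \<bullet> \<xi>) \<noteq> 0"
      by (metis add_pos_nonneg inner_ge_zero less_irrefl of_real_eq_0_iff zero_less_one)
    have "?F (\<lambda>x. conv (\<lambda>y. \<phi> y - lap \<phi> y) besselG x - \<phi> x) = ?F (conv (\<lambda>y. \<phi> y - lap \<phi> y) besselG) - ?F \<phi>"
      by (rule d[OF fourier_conv(1)[OF \<psi> besselG_integrable] i(1)])
    also have "?F (conv (\<lambda>y. \<phi> y - lap \<phi> y) besselG) = (?F \<phi> - ?F (lap \<phi>)) * complex_of_real (1 / (1 + \<xi> \<bullet> \<xi>))"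
      unfolding fourier_conv(2)[OF \<psi> besselG_integrable] besselG_fourier d[OF i] ..
    also have "?F (lap \<phi>) = - complex_of_real (\<xi> \<bullet> \<xi>) * ?F \<phi>"
      by (rule fourier_lap[OF \<phi>])
    also have "(?F \<phi> - - complex_of_real (\<xi> \<bullet> \<xi>) * ?F \<phi>) * complex_of_real (1 / (1 + \<xi> \<bullet> \<xi>)) - ?F \<phi> = 0"
      using nz by (simp add: field_simps)
    finally show "?F (\<lambda>x. conv (\<lambda>y. \<phi> y - lap \<phi> y) besselG x - \<phi> x) = 0" .
  qed
  then show ?thesis
    by eventually_elim simp
qed

text \<open>The equation \<Delta>u = u - f in the sense of distributions, for u the potential of f.
  As the kernel is even, Fubini moves the convolution from f to \<phi> - \<Delta>\<phi>, where the
  inversion formula returns \<phi>.\<close>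

lemma bessel_weak:
  fixes f :: "'a::euclidean_space \<Rightarrow> real"
  assumes f: "l2 f" and \<phi>: "\<phi> \<in> testf UNIV"
  shows "(\<integral>x. conv f besselG x * lap \<phi> x \<partial>lborel) = (\<integral>x. (conv f besselG x - f x) * \<phi> x \<partial>lborel)"
proof -
  have [measurable]: "f \<in> borel_measurable borel"
    using f by (rule l2_measurable)
  have [measurable]: "\<phi> \<in> borel_measurable borel"
    using \<phi> by (intro smooth_measurable testf_smooth)
  define \<psi> where "\<psi> y = \<phi> y - lap \<phi> y" for y
  have \<psi>: "\<psi> \<in> testf UNIV"
    unfolding \<psi>_def[abs_def] by (intro testf_diff testf_lap \<phi>)
  then have [measurable]: "\<psi> \<in> borel_measurable borel"
    by (intro smooth_measurable testf_smooth)
  have a\<psi>: "l2 (\<lambda>x. \<bar>\<psi> x\<bar>)" "integrable lborel (\<lambda>x. \<bar>\<psi> x\<bar>)"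
    using l2_testf[OF \<psi>] testf_integrable[OF \<psi>] by (auto simp: l2_def)
  have c\<psi>: "l2 (conv (\<lambda>x. \<bar>\<psi> x\<bar>) besselG)"
    by (rule young(1)[OF a\<psi>(1) besselG_integrable besselG_nonneg])
  have sym: "besselG (x - y) = besselG (y - x)" for x y :: 'a
    using besselG_minus[of "y - x"] by simp
  have iG: "AE y in lborel. integrable lborel (\<lambda>x. \<bar>\<psi> x\<bar> * besselG (y - x))"
    using lborel_pair.AE_integrable_snd[OF conv_integrable_pair[OF a\<psi>(2) besselG_integrable]] by simp
  \<comment> \<open>Absolute integrability: |f| and the potential of |\<psi>| are both square
    integrable, the latter by Young's inequality.\<close>
  have int: "integrable (lborel \<Otimes>\<^sub>M lborel) (\<lambda>(y, x). f y * (besselG (x - y) * \<psi> x))"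
  proof (rule lborel_pair.Fubini_integrable)
    have "(\<integral>x. norm (case (y, x) of (y, x) \<Rightarrow> f y * (besselG (x - y) * \<psi> x)) \<partial>lborel)
        = \<bar>f y\<bar> * conv (\<lambda>x. \<bar>\<psi> x\<bar>) besselG y" for y
      by (simp add: abs_mult abs_of_nonneg[OF besselG_nonneg] conv_def sym[of _ y] mult.commute)
    moreover have "l2 (\<lambda>x. \<bar>f x\<bar>)"
      using f by (auto simp: l2_def)
    ultimately show "integrable lborel (\<lambda>y. \<integral>x. norm (case (y, x) of (y, x) \<Rightarrow> f y * (besselG (x - y) * \<psi> x)) \<partial>lborel)"
      using l2_mult_integrable[OF _ c\<psi>] by simp
    show "AE y in lborel. integrable lborel (\<lambda>x. case (y, x) of (y, x) \<Rightarrow> f y * (besselG (x - y) * \<psi> x))"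
      using iG
    proof eventually_elim
      case (elim y)
      have "integrable lborel (\<lambda>x. besselG (x - y) * \<psi> x)"
        by (rule Bochner_Integration.integrable_bound[OF elim])
           (auto simp: abs_mult abs_of_nonneg[OF besselG_nonneg] sym[of _ y] mult.commute)
      then show ?case
        by simp
    qed
  qed measurable
  have u: "l2 (conv f besselG)"
    by (rule young(1)[OF f besselG_integrable besselG_nonneg])
  have "(\<integral>x. conv f besselG x * \<psi> x \<partial>lborel) = (\<integral>x. (\<integral>y. f y * (besselG (x - y) * \<psi> x) \<partial>lborel) \<partial>lborel)"
    unfolding conv_def integral_mult_left_zero[symmetric] mult.assoc ..
  also have "\<dots> = (\<integral>y. (\<integral>x. f y * (besselG (x - y) * \<psi> x) \<partial>lborel) \<partial>lborel)"
    by (rule lborel_pair.Fubini_integral[OF int])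
  also have "\<dots> = (\<integral>y. f y * conv \<psi> besselG y \<partial>lborel)"
    unfolding conv_def integral_mult_right_zero[symmetric] sym[of _ "y" for y] by (simp only: mult.commute[of "\<psi> _"] sym)
  also have "\<dots> = (\<integral>y. f y * \<phi> y \<partial>lborel)"
  proof (rule integral_cong_AE)
    show "AE y in lborel. f y * conv \<psi> besselG y = f y * \<phi> y"
      using conv_besselG_inverse[OF \<phi>] unfolding \<psi>_def[abs_def] by eventually_elim simp
  qed measurable
  finally have "(\<integral>x. conv f besselG x * \<psi> x \<partial>lborel) = (\<integral>y. f y * \<phi> y \<partial>lborel)" .
  then show ?thesis
    using l2_mult_integrable[OF u l2_testf[OF \<phi>]] l2_mult_integrable[OF u l2_testf[OF testf_lap[OF \<phi>]]]
      l2_mult_integrable[OF f l2_testf[OF \<phi>]]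
    by (simp add: \<psi>_def right_diff_distrib left_diff_distrib)
qed

section \<open>Local energy estimates\<close>

lemma lap_mult:
  fixes f g :: "'a::euclidean_space \<Rightarrow> real"
  assumes f: "smooth f" and g: "smooth g"
  shows "lap (\<lambda>x. f x * g x) x = f x * lap g x + 2 * (\<Sum>b\<in>Basis. pdiff b f x * pdiff b g x) + lap f x * g x"
proof -
  have "pdiff b (pdiff b (\<lambda>x. f x * g x)) x
      = pdiff b (pdiff b f) x * g x + 2 * (pdiff b f x * pdiff b g x) + f x * pdiff b (pdiff b g) x"
    if b: "b \<in> Basis" for b
  proof -
    have d: "pdiff b f differentiable (at x)" "pdiff b g differentiable (at x)" "f differentiable (at x)" "g differentiable (at x)" for x
      using f g b by (auto intro: smooth_differentiable smooth_pdiff)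
    have "pdiff b (\<lambda>x. f x * g x) = (\<lambda>x. pdiff b f x * g x + f x * pdiff b g x)"
      using pdiff_mult[OF d(3,4)] by blast
    then show ?thesis
      using d by (simp add: pdiff_add pdiff_mult differentiable_mult)
  qed
  then have "lap (\<lambda>x. f x * g x) x = (\<Sum>b\<in>Basis. pdiff b (pdiff b f) x * g x + 2 * (pdiff b f x * pdiff b g x) + f x * pdiff b (pdiff b g) x)"
    by (simp add: lap_def)
  then show ?thesis
    by (simp add: lap_def sum.distrib sum_distrib_left sum_distrib_right)
qed

text \<open>Green's formula tested with \<eta>^2 w. The cross term is split by AM-GM so that half of
  the localised energy is absorbed on the left. No integrability of the gradient of w is
  presupposed; the cutoff supplies it.\<close>

lemma caccioppoli:
  fixes \<eta> w :: "'a::euclidean_space \<Rightarrow> real"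
  assumes \<eta>: "\<eta> \<in> testf UNIV" and w: "smooth w" "l2 w" "l2 (lap w)"
    and e: "\<And>x. \<bar>\<eta> x\<bar> \<le> e" "\<And>b x. b \<in> Basis \<Longrightarrow> \<bar>pdiff b \<eta> x\<bar> \<le> e" and c: "c \<in> Basis"
  shows "nsq (\<lambda>x. \<eta> x * pdiff c w x) \<le> (1 + 4 * real DIM('a)) * e\<^sup>2 * (nsq w + nsq (lap w))"
proof -
  note s\<eta> = testf_smooth[OF \<eta>]
  have \<eta>2: "(\<lambda>x. \<eta> x * (\<eta> x * w x)) \<in> testf UNIV"
    by (intro testf_mult smooth_mult s\<eta> w \<eta>)
  have e2: "(\<eta> x)\<^sup>2 \<le> e\<^sup>2" "b \<in> Basis \<Longrightarrow> (pdiff b \<eta> x)\<^sup>2 \<le> e\<^sup>2" for x b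
    using e[of x] e(2)[of b x] by (auto simp: abs_le_square_iff[symmetric] intro: order_trans[OF _ abs_ge_self])
  have pd: "pdiff b (\<lambda>x. \<eta> x * (\<eta> x * w x)) x = 2 * \<eta> x * w x * pdiff b \<eta> x + (\<eta> x)\<^sup>2 * pdiff b w x" for b x
    using smooth_differentiable[OF s\<eta>] smooth_differentiable[OF w(1)]
    by (simp add: pdiff_mult differentiable_mult power2_eq_square algebra_simps)
  let ?E = "\<lambda>x. \<Sum>b\<in>Basis. (\<eta> x * pdiff b w x)\<^sup>2"
  let ?X = "\<lambda>x. (\<Sum>b\<in>Basis. 2 * (\<eta> x * pdiff b w x) * (w x * pdiff b \<eta> x))"
  have iE: "integrable lborel ?E"
    unfolding power2_eq_square
    by (intro Bochner_Integration.integrable_sum testf_integrable[of _ UNIV] testf_mult \<eta> s\<eta> smooth_mult smooth_pdiff w)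
  have iX: "integrable lborel ?X"
  proof (intro Bochner_Integration.integrable_sum)
    fix b :: 'a assume b: "b \<in> Basis"
    have "integrable lborel (\<lambda>x. 2 * ((\<eta> x * pdiff b w x) * (w x * pdiff b \<eta> x)))"
      by (intro integrable_mult_right testf_integrable[of _ UNIV] testf_mult \<eta> s\<eta> smooth_mult smooth_pdiff w b)
    then show "integrable lborel (\<lambda>x. 2 * (\<eta> x * pdiff b w x) * (w x * pdiff b \<eta> x))"
      by (simp add: mult.assoc)
  qed
  let ?L = "\<lambda>x. \<eta> x * (\<eta> x * w x) * lap w x"
  have iL: "integrable lborel ?L"
    by (intro testf_integrable[of _ UNIV] testf_mult[OF \<eta>2] smooth_lap w)
  have "(\<integral>x. ?L x \<partial>lborel) = - (\<integral>x. (\<Sum>b\<in>Basis. pdiff b (\<lambda>x. \<eta> x * (\<eta> x * w x)) x * pdiff b w x) \<partial>lborel)"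
    by (rule integral_lap_commute(1)[OF \<eta>2 w(1)])
  also have "(\<lambda>x. \<Sum>b\<in>Basis. pdiff b (\<lambda>x. \<eta> x * (\<eta> x * w x)) x * pdiff b w x) = (\<lambda>x. ?X x + ?E x)"
    unfolding pd sum.distrib[symmetric] by (intro ext sum.cong) (auto simp: power2_eq_square algebra_simps)
  finally have id: "(\<integral>x. ?E x \<partial>lborel) = - (\<integral>x. ?X x \<partial>lborel) - (\<integral>x. ?L x \<partial>lborel)"
    using iE iX by simp
  have i1: "integrable lborel (\<lambda>x. (w x)\<^sup>2)" "integrable lborel (\<lambda>x. (lap w x)\<^sup>2)"
    using w(2,3) by (auto simp: l2_def)
  \<comment> \<open>Each direction contributes 2 e^2 w^2. After absorbing half of the energy the
    total doubles, which gives the 4 DIM in the final constant.\<close>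
  have X: "- ?X x \<le> 1/2 * ?E x + 2 * real DIM('a) * e\<^sup>2 * (w x)\<^sup>2" for x
  proof -
    have am: "- (2 * p * q) \<le> 1/2 * p\<^sup>2 + 2 * q\<^sup>2" for p q :: real
      using zero_le_power2[of "p + 2 * q"] by (simp add: power2_eq_square algebra_simps)
    have "- ?X x \<le> (\<Sum>b\<in>Basis. 1/2 * (\<eta> x * pdiff b w x)\<^sup>2 + 2 * (e\<^sup>2 * (w x)\<^sup>2))"
      unfolding sum_negf[symmetric]
    proof (rule sum_mono)
      fix b :: 'a assume b: "b \<in> Basis"
      have "(w x * pdiff b \<eta> x)\<^sup>2 \<le> e\<^sup>2 * (w x)\<^sup>2"
        unfolding power_mult_distrib mult.commute[of "(w x)\<^sup>2"] using e2(2)[OF b] by (rule mult_right_mono) simp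
      with am[of "\<eta> x * pdiff b w x" "w x * pdiff b \<eta> x"]
      show "- (2 * (\<eta> x * pdiff b w x) * (w x * pdiff b \<eta> x)) \<le> 1/2 * (\<eta> x * pdiff b w x)\<^sup>2 + 2 * (e\<^sup>2 * (w x)\<^sup>2)"
        by linarith
    qed
    also have "\<dots> = 1/2 * ?E x + 2 * real DIM('a) * e\<^sup>2 * (w x)\<^sup>2"
      by (simp add: sum.distrib sum_distrib_left)
    finally show ?thesis .
  qed
  have L: "- ?L x \<le> 1/2 * e\<^sup>2 * (w x)\<^sup>2 + 1/2 * e\<^sup>2 * (lap w x)\<^sup>2" for x
  proof -
    have am: "- (p * q) \<le> 1/2 * (p\<^sup>2 + q\<^sup>2)" for p q :: real
      using zero_le_power2[of "p + q"] by (simp add: power2_eq_square algebra_simps)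
    have "- ?L x = (\<eta> x)\<^sup>2 * (- (w x * lap w x))"
      by (simp add: power2_eq_square mult_ac)
    also have "\<dots> \<le> (\<eta> x)\<^sup>2 * (1/2 * ((w x)\<^sup>2 + (lap w x)\<^sup>2))"
      by (intro mult_left_mono am) simp
    also have "\<dots> \<le> e\<^sup>2 * (1/2 * ((w x)\<^sup>2 + (lap w x)\<^sup>2))"
      by (intro mult_right_mono e2) simp
    finally show ?thesis
      by (simp add: algebra_simps)
  qed
  have "(\<integral>x. - ?X x \<partial>lborel) \<le> (\<integral>x. 1/2 * ?E x + 2 * real DIM('a) * e\<^sup>2 * (w x)\<^sup>2 \<partial>lborel)"
    using iX iE i1 X by (intro integral_mono) auto
  also have "\<dots> = 1/2 * (\<integral>x. ?E x \<partial>lborel) + 2 * real DIM('a) * e\<^sup>2 * nsq w"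
    using iE i1 by (simp add: nsq_def)
  finally have X': "- (\<integral>x. ?X x \<partial>lborel) \<le> 1/2 * (\<integral>x. ?E x \<partial>lborel) + 2 * real DIM('a) * e\<^sup>2 * nsq w"
    by simp
  have "(\<integral>x. - ?L x \<partial>lborel) \<le> (\<integral>x. 1/2 * e\<^sup>2 * (w x)\<^sup>2 + 1/2 * e\<^sup>2 * (lap w x)\<^sup>2 \<partial>lborel)"
    using iL i1 L by (intro integral_mono) auto
  also have "\<dots> = 1/2 * e\<^sup>2 * nsq w + 1/2 * e\<^sup>2 * nsq (lap w)"
    using i1 by (simp add: nsq_def)
  finally have L': "- (\<integral>x. ?L x \<partial>lborel) \<le> 1/2 * e\<^sup>2 * nsq w + 1/2 * e\<^sup>2 * nsq (lap w)"
    by simp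
  have p: "0 \<le> e\<^sup>2 * nsq w" "0 \<le> e\<^sup>2 * nsq (lap w)" "0 \<le> 4 * real DIM('a) * (e\<^sup>2 * nsq (lap w))"
    by (intro mult_nonneg_nonneg; simp)+
  have "(\<integral>x. ?E x \<partial>lborel) \<le> 4 * real DIM('a) * e\<^sup>2 * nsq w + e\<^sup>2 * nsq w + e\<^sup>2 * nsq (lap w)"
    using id X' L' by linarith
  also have "\<dots> \<le> (1 + 4 * real DIM('a)) * e\<^sup>2 * (nsq w + nsq (lap w))"
    using p by (simp add: algebra_simps)
  finally have E: "(\<integral>x. ?E x \<partial>lborel) \<le> (1 + 4 * real DIM('a)) * e\<^sup>2 * (nsq w + nsq (lap w))" .
  have "nsq (\<lambda>x. \<eta> x * pdiff c w x) \<le> (\<integral>x. ?E x \<partial>lborel)"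
    unfolding nsq_def
  proof (rule integral_mono[OF _ iE])
    show "integrable lborel (\<lambda>x. (\<eta> x * pdiff c w x)\<^sup>2)"
      unfolding power2_eq_square
      by (intro testf_integrable[of _ UNIV] testf_mult \<eta> s\<eta> smooth_mult smooth_pdiff w c)
    show "(\<eta> x * pdiff c w x)\<^sup>2 \<le> ?E x" for x
      using c by (intro member_le_sum[of c]) auto
  qed
  with E show ?thesis
    by linarith
qed

lemma l2_sum_bound:
  assumes "finite I" "\<And>i. i \<in> I \<Longrightarrow> l2 (f i)"
  shows "nsq (\<lambda>x. \<Sum>i\<in>I. f i x) \<le> card I * (\<Sum>i\<in>I. nsq (f i))"
proof -
  have "nsq (\<lambda>x. \<Sum>i\<in>I. f i x) \<le> (\<integral>x. (\<Sum>i\<in>I. (f i x)\<^sup>2) * card I \<partial>lborel)"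
    unfolding nsq_def
    using assms l2_sum[OF assms] sum_squared_le_sum_of_squares
    by (intro integral_mono) (auto simp: l2_def)
  also have "\<dots> = card I * (\<Sum>i\<in>I. nsq (f i))"
    using assms by (simp add: nsq_def l2_def Bochner_Integration.integral_sum)
  finally show ?thesis .
qed

text \<open>The commutator is 2 grad \<eta> . grad w + (\<Delta>\<eta>) w. The first part is
  estimated by the energy bound with the derivatives of \<eta> as cutoffs, so everything is
  quadratic in a bound on derivatives of \<eta> alone; this smallness is what dilated cutoffs
  exploit. The constant 10 arises as 2*4 + 2*1.\<close>

lemma lap_commutator:
  fixes \<eta> w :: "'a::euclidean_space \<Rightarrow> real"
  assumes \<eta>: "\<eta> \<in> testf UNIV" and w: "smooth w" "l2 w" "l2 (lap w)"
    and e: "\<And>b x. b \<in> Basis \<Longrightarrow> \<bar>pdiff b \<eta> x\<bar> \<le> e" "\<And>b c x. b \<in> Basis \<Longrightarrow> c \<in> Basis \<Longrightarrow> \<bar>pdiff c (pdiff b \<eta>) x\<bar> \<le> e"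
  shows "l2 (\<lambda>x. lap (\<lambda>y. \<eta> y * w y) x - \<eta> x * lap w x)"
    and "nsq (\<lambda>x. lap (\<lambda>y. \<eta> y * w y) x - \<eta> x * lap w x)
      \<le> (10 * (real DIM('a))\<^sup>2 * (1 + 4 * real DIM('a))) * e\<^sup>2 * (nsq w + nsq (lap w))"
proof -
  let ?n = "real DIM('a)" and ?S = "nsq w + nsq (lap w)"
  have eq: "lap (\<lambda>y. \<eta> y * w y) x - \<eta> x * lap w x
      = (\<Sum>b\<in>Basis. 2 * (pdiff b \<eta> x * pdiff b w x)) + lap \<eta> x * w x" for x
    using lap_mult[OF testf_smooth[OF \<eta>] w(1)] by (simp add: sum_distrib_left)
  have l1: "l2 (\<lambda>x. pdiff b \<eta> x * pdiff b w x)" if "b \<in> Basis" for b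
    by (rule l2_testf[of _ UNIV]) (intro testf_mult testf_pdiff smooth_pdiff \<eta> w that)
  have l2: "l2 (\<lambda>x. lap \<eta> x * w x)"
    by (rule l2_testf[of _ UNIV]) (intro testf_mult testf_lap \<eta> w)
  have l3: "l2 (\<lambda>x. \<Sum>b\<in>Basis. 2 * (pdiff b \<eta> x * pdiff b w x))"
    by (intro l2_sum l2_cmult l1) auto
  show "l2 (\<lambda>x. lap (\<lambda>y. \<eta> y * w y) x - \<eta> x * lap w x)"
    unfolding eq by (rule l2_add[OF l3 l2])
  have n1: "nsq (\<lambda>x. pdiff b \<eta> x * pdiff b w x) \<le> (1 + 4 * ?n) * e\<^sup>2 * ?S" if "b \<in> Basis" for b
    using e that by (intro caccioppoli testf_pdiff \<eta> w) auto
  have "nsq (\<lambda>x. \<Sum>b\<in>Basis. 2 * (pdiff b \<eta> x * pdiff b w x))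
      \<le> ?n * (\<Sum>b\<in>Basis. nsq (\<lambda>x. 2 * (pdiff b \<eta> x * pdiff b w x)))"
    by (intro l2_sum_bound l2_cmult l1) auto
  also have "\<dots> \<le> ?n * (\<Sum>b\<in>(Basis :: 'a set). 4 * ((1 + 4 * ?n) * e\<^sup>2 * ?S))"
    unfolding nsq_cmult using n1 by (intro mult_left_mono sum_mono) auto
  also have "\<dots> = 4 * ?n\<^sup>2 * (1 + 4 * ?n) * e\<^sup>2 * ?S"
    by (simp add: power2_eq_square)
  finally have A: "nsq (\<lambda>x. \<Sum>b\<in>Basis. 2 * (pdiff b \<eta> x * pdiff b w x)) \<le> 4 * ?n\<^sup>2 * (1 + 4 * ?n) * e\<^sup>2 * ?S" .
  have "\<bar>lap \<eta> x\<bar> \<le> ?n * e" for x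
  proof -
    have "\<bar>lap \<eta> x\<bar> \<le> (\<Sum>b\<in>Basis. \<bar>pdiff b (pdiff b \<eta>) x\<bar>)"
      unfolding lap_def by (rule sum_abs)
    also have "\<dots> \<le> (\<Sum>b\<in>(Basis :: 'a set). e)"
      using e by (intro sum_mono) auto
    finally show ?thesis
      by simp
  qed
  then have "nsq (\<lambda>x. lap \<eta> x * w x) \<le> (?n * e)\<^sup>2 * nsq w"
    by (intro nsq_mult_bounded w smooth_measurable smooth_lap testf_smooth[OF \<eta>])
  also have "\<dots> \<le> (?n * e)\<^sup>2 * ?S"
    by (intro mult_left_mono) auto
  also have "\<dots> \<le> ?n\<^sup>2 * (1 + 4 * ?n) * e\<^sup>2 * ?S"
  proof -
    have "(?n\<^sup>2 * e\<^sup>2 * ?S) * 1 \<le> (?n\<^sup>2 * e\<^sup>2 * ?S) * (1 + 4 * ?n)"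
      by (intro mult_left_mono mult_nonneg_nonneg add_nonneg_nonneg) auto
    then show ?thesis
      by (simp add: power_mult_distrib mult_ac)
  qed
  finally have B: "nsq (\<lambda>x. lap \<eta> x * w x) \<le> ?n\<^sup>2 * (1 + 4 * ?n) * e\<^sup>2 * ?S" .
  have "nsq (\<lambda>x. lap (\<lambda>y. \<eta> y * w y) x - \<eta> x * lap w x)
      \<le> 2 * nsq (\<lambda>x. \<Sum>b\<in>Basis. 2 * (pdiff b \<eta> x * pdiff b w x)) + 2 * nsq (\<lambda>x. lap \<eta> x * w x)"
    unfolding eq by (rule nsq_add_le[OF l3 l2])
  also have "\<dots> \<le> 10 * (?n\<^sup>2 * (1 + 4 * ?n) * e\<^sup>2 * ?S)"
    using A B by (simp add: mult.assoc)
  finally show "nsq (\<lambda>x. lap (\<lambda>y. \<eta> y * w y) x - \<eta> x * lap w x)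
      \<le> (10 * ?n\<^sup>2 * (1 + 4 * real DIM('a))) * e\<^sup>2 * ?S"
    by (simp add: mult.assoc)
qed

section \<open>Sets of capacity zero\<close>

lemma nn_integral_besselG: "(\<integral>\<^sup>+x. ennreal (besselG (x :: 'a::euclidean_space)) \<partial>lborel) = 1"
  using besselG_integrable besselG_nonneg integral_besselG[where 'a='a]
  by (subst nn_integral_eq_integral) auto

text \<open>Young's inequality for a kernel of mass one, used in extended form because finiteness of
  the potential is to be deduced from it.\<close>

lemma bessel_potential_sq:
  fixes f :: "'a::euclidean_space \<Rightarrow> real"
  assumes [measurable]: "f \<in> borel_measurable borel" and f: "\<And>x. 0 \<le> f x"
  shows "(\<integral>\<^sup>+x. (bessel_potential 2 f x)\<^sup>2 \<partial>lborel) \<le> (\<integral>\<^sup>+x. ennreal ((f x)\<^sup>2) \<partial>lborel)"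
proof -
  have "(\<integral>\<^sup>+x. (\<integral>\<^sup>+y. ennreal (f y) * ennreal (besselG (x - y)) \<partial>lborel)\<^sup>2 \<partial>lborel)
      \<le> (\<integral>\<^sup>+x. ennreal (besselG (x :: 'a)) \<partial>lborel)\<^sup>2 * (\<integral>\<^sup>+x. (ennreal (f x))\<^sup>2 \<partial>lborel)"
    by (rule young_nn) (auto simp: besselG_nonneg)
  moreover have "ennreal (besselG (x - y) * f y) = ennreal (f y) * ennreal (besselG (x - y))" for x y
    by (simp add: f besselG_nonneg ennreal_mult mult.commute)
  ultimately show ?thesis
    unfolding bessel_potential_2(1)[OF assms(1) f] nn_integral_besselG
    using f by (simp add: ennreal_power)
qed

lemma bessel_potential_measurable:
  fixes f :: "'a::euclidean_space \<Rightarrow> real"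
  assumes [measurable]: "f \<in> borel_measurable borel" and f: "\<And>x. 0 \<le> f x"
  shows "bessel_potential 2 f \<in> borel_measurable borel"
proof -
  have "bessel_potential 2 f = (\<lambda>x. \<integral>\<^sup>+y. ennreal (besselG (x - y) * f y) \<partial>lborel)"
    by (rule ext) (rule bessel_potential_2(1)[OF assms])
  then show ?thesis
    by simp
qed

text \<open>The square of the potential has finite integral, so the potential is finite almost
  everywhere; at such points the extended and the Bochner integral agree.\<close>

lemma bessel_potential_AE:
  fixes f :: "'a::euclidean_space \<Rightarrow> real"
  assumes f: "l2 f" "\<And>x. 0 \<le> f x"
  shows "AE x in lborel. bessel_potential 2 f x = ennreal (conv f besselG x)"
proof -
  have m[measurable]: "f \<in> borel_measurable borel"
    using f(1) by (rule l2_measurable)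
  note pm[measurable] = bessel_potential_measurable[OF m f(2)]
  have "(\<integral>\<^sup>+x. ennreal ((f x)\<^sup>2) \<partial>lborel) < \<infinity>"
    using f(1) by (simp add: l2_def nn_integral_eq_integral)
  then have "(\<integral>\<^sup>+x. (bessel_potential 2 f x)\<^sup>2 \<partial>lborel) \<noteq> \<infinity>"
    using bessel_potential_sq[OF m f(2)] by (metis le_less_trans less_irrefl)
  then have "AE x in lborel. (bessel_potential 2 f x)\<^sup>2 \<noteq> \<infinity>"
    by (intro nn_integral_PInf_AE) auto
  then show ?thesis
  proof eventually_elim
    case (elim x)
    have "conv f besselG x = enn2real (\<integral>\<^sup>+y. ennreal (f y * besselG (x - y)) \<partial>lborel)"
      unfolding conv_def using mult_nonneg_nonneg[OF f(2) besselG_nonneg] by (intro integral_eq_nn_integral) auto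
    then have "conv f besselG x = enn2real (bessel_potential 2 f x)"
      unfolding bessel_potential_2(1)[OF m f(2)] by (simp only: mult.commute)
    moreover have "bessel_potential 2 f x \<noteq> \<infinity>"
      using elim by (auto simp: ennreal_top_mult power2_eq_square)
    ultimately show ?case
      by (simp add: less_top)
  qed
qed

lemma capacity_zero_obtain:
  fixes K :: "'a::euclidean_space set"
  assumes "bessel_capacity2 2 K = 0" "0 < \<delta>"
  shows "\<exists>f. l2 f \<and> (\<forall>x. 0 \<le> f x) \<and> nsq f < \<delta> \<and> (\<forall>x\<in>K. 1 \<le> bessel_potential 2 f x)"
proof -
  have "bessel_capacity2 2 K < ennreal \<delta>"
    using assms by simp
  then obtain f where f: "f \<in> borel_measurable borel" "\<forall>x. 0 \<le> f x" "\<forall>x\<in>K. 1 \<le> bessel_potential 2 f x"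
    "(\<integral>\<^sup>+x. ennreal ((f x)\<^sup>2) \<partial>lborel) < ennreal \<delta>"
    unfolding bessel_capacity2_def Inf_less_iff by auto
  have int: "integrable lborel (\<lambda>x. (f x)\<^sup>2)"
    using f(1,4) by (intro integrableI_nonneg) (auto intro: less_trans)
  then have "l2 f"
    using f(1) by (simp add: l2_def)
  moreover have "nsq f < \<delta>"
    using f(4) int assms(2) by (simp add: nn_integral_eq_integral nsq_def ennreal_less_iff)
  ultimately show ?thesis
    using f by (intro exI[of _ f]) auto
qed

section \<open>A smooth function that is large near K and small in norm\<close>

lemma finite_uniform_bound:
  fixes F :: "('a \<Rightarrow> real) set"
  assumes "finite F" "\<And>f. f \<in> F \<Longrightarrow> \<exists>B. \<forall>x. \<bar>f x\<bar> \<le> B"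
  shows "\<exists>B>0. \<forall>f\<in>F. \<forall>x. \<bar>f x\<bar> \<le> B"
  using assms
proof (induction F rule: finite_induct)
  case empty
  then show ?case
    by (intro exI[of _ 1]) auto
next
  case (insert f F)
  obtain B where B: "0 < B" "\<forall>f\<in>F. \<forall>x. \<bar>f x\<bar> \<le> B"
    using insert by blast
  obtain B' where B': "\<forall>x. \<bar>f x\<bar> \<le> B'"
    using insert by blast
  show ?case
  proof (intro exI[of _ "max B B'"] conjI ballI allI)
    show "0 < max B B'"
      using B by simp
    fix g x assume "g \<in> insert f F"
    then show "\<bar>g x\<bar> \<le> max B B'"
      using B(2) B' by (auto intro: le_max_iff_disj[THEN iffD2])
  qed
qed

lemma testf_derivs_bounded:
  fixes \<eta> :: "'a::euclidean_space \<Rightarrow> real"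
  assumes \<eta>: "\<eta> \<in> testf \<Omega>"
  shows "\<exists>B>0. (\<forall>x. \<bar>\<eta> x\<bar> \<le> B) \<and> (\<forall>b\<in>Basis. \<forall>x. \<bar>pdiff b \<eta> x\<bar> \<le> B) \<and>
    (\<forall>b\<in>Basis. \<forall>c\<in>Basis. \<forall>x. \<bar>pdiff c (pdiff b \<eta>) x\<bar> \<le> B) \<and> (\<forall>x. \<bar>lap \<eta> x\<bar> \<le> B)"
proof -
  let ?F = "{\<eta>, lap \<eta>} \<union> (\<lambda>b. pdiff b \<eta>) ` Basis \<union> (\<lambda>(b, c). pdiff c (pdiff b \<eta>)) ` (Basis \<times> Basis)"
  have "\<exists>B>0. \<forall>f\<in>?F. \<forall>x. \<bar>f x\<bar> \<le> B"
  proof (rule finite_uniform_bound)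
    fix f assume "f \<in> ?F"
    then have "f \<in> testf \<Omega>"
      using \<eta> by (auto intro: testf_lap testf_pdiff)
    then show "\<exists>B. \<forall>x. \<bar>f x\<bar> \<le> B"
      using testf_bounded by blast
  qed auto
  then obtain B where B: "0 < B" "\<forall>f\<in>?F. \<forall>x. \<bar>f x\<bar> \<le> B"
    by blast
  then show ?thesis
    by (intro exI[of _ B]) auto
qed

text \<open>A one-sided averaging argument. The lower bound is assumed only almost everywhere, since
  the square-integrable representative agrees with the pointwise potential only up to a null
  set.\<close>

lemma conv_moll_lower:
  fixes u :: "'a::euclidean_space \<Rightarrow> real"
  assumes u: "l2 u" and r: "0 < r" and a: "AE y in lborel. norm (y - x) \<le> r \<longrightarrow> a \<le> u y"
  shows "a \<le> conv u (moll r) x"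
proof -
  note m = moll[OF r, where 'a='a]
  have i1: "integrable lborel (\<lambda>y. u y * moll r (x - y))"
    using u m(1) by (rule conv_integrable)
  have i2: "integrable lborel (\<lambda>y. moll r (x - y))"
    using m(4) by (subst integrable_reflect) auto
  have I2: "(\<integral>y. moll r (x - y) \<partial>lborel) = 1"
    using m(4,5) by (subst integral_reflect) auto
  have "(\<integral>y. a * moll r (x - y) \<partial>lborel) \<le> (\<integral>y. u y * moll r (x - y) \<partial>lborel)"
  proof (rule integral_mono_AE)
    show "AE y in lborel. a * moll r (x - y) \<le> u y * moll r (x - y)"
      using a
    proof eventually_elim
      case (elim y)
      show ?case
      proof (cases "x - y \<in> cball 0 r")
        case True
        then have "norm (y - x) \<le> r"
          by (simp add: norm_minus_commute)
        with elim show ?thesis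
          by (intro mult_right_mono m(2)) simp
      next
        case False
        then show ?thesis
          using m(3) by (simp add: supp_in_def)
      qed
    qed
  qed (use i1 i2 in auto)
  then show ?thesis
    using I2 by (simp add: conv_def)
qed

text \<open>K may be null, so a bound on K alone would be lost under mollification. Lower
  semicontinuity first turns it into a bound on an open set, at the price of lowering 1 to 1/2;
  averages at a scale below the distance from K to the boundary of that set keep it. The
  localisation equals 1 near K, and its cost depends on K alone.\<close>

lemma capacity_zero_cutoff:
  fixes K :: "'a::euclidean_space set"
  assumes K: "compact K" and cap: "bessel_capacity2 2 K = 0" and \<delta>: "0 < \<delta>"
  shows "\<exists>v V. v \<in> testf UNIV \<and> (\<forall>x. 0 \<le> v x) \<and> open V \<and> K \<subseteq> V \<and> (\<forall>x\<in>V. 1/2 \<le> v x) \<and>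
    nsq v < \<delta> \<and> nsq (lap v) < \<delta>"
proof -
  obtain R where R: "0 < R" "\<And>x. x \<in> K \<Longrightarrow> norm x \<le> R"
    using compact_imp_bounded[OF K] unfolding bounded_pos by blast
  \<comment> \<open>Mollifying with radius 1 leaves the indicator of the ball of radius R + 2 equal
    to 1 on the ball of radius R + 1, which contains the unit neighbourhood of K.\<close>
  define \<eta> :: "'a \<Rightarrow> real" where "\<eta> = conv (indicator (cball 0 (R + 2))) (moll 1)"
  have ind: "l2 (indicator (cball 0 (R + 2)) :: 'a \<Rightarrow> real)"
    by (rule l2_indicator) simp
  have \<eta>: "\<eta> \<in> testf UNIV"
  proof (rule testfI)
    show "smooth \<eta>"
      unfolding \<eta>_def by (intro smooth_conv ind moll) simp
    show "supp_in {c + s |c s. c \<in> cball 0 (R + 2) \<and> s \<in> cball 0 1} \<eta>"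
      unfolding \<eta>_def by (intro supp_in_conv moll) (auto simp: supp_in_def)
  qed (rule compact_neighbourhood[OF compact_cball], simp)
  have \<eta>0: "0 \<le> \<eta> x" for x
    unfolding \<eta>_def conv_def by (intro integral_nonneg_AE AE_I2 mult_nonneg_nonneg moll) auto
  have \<eta>1: "\<eta> x = 1" if "norm x \<le> R + 1" for x
  proof -
    have "\<bar>\<eta> x - 1\<bar> \<le> 0"
      unfolding \<eta>_def
    proof (rule conv_moll_close[OF ind])
      fix y assume "norm (y - x) \<le> 1"
      then have "norm y \<le> R + 2"
        using norm_triangle_sub[of y x] that by simp
      then show "\<bar>indicator (cball 0 (R + 2)) y - 1\<bar> \<le> (0 :: real)"
        by simp
    qed simp
    then show ?thesis by simp
  qed
  obtain B where B': "0 < B" "\<forall>x. \<bar>\<eta> x\<bar> \<le> B" "\<forall>b\<in>Basis. \<forall>x. \<bar>pdiff b \<eta> x\<bar> \<le> B"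
    "\<forall>b\<in>Basis. \<forall>c\<in>Basis. \<forall>x. \<bar>pdiff c (pdiff b \<eta>) x\<bar> \<le> B"
    using testf_derivs_bounded[OF \<eta>] by (elim exE conjE) (rule that)
  note B = B'(1) B'(2)[rule_format] B'(3)[rule_format] B'(4)[rule_format]
  define C where "C = 10 * (real DIM('a))\<^sup>2 * (1 + 4 * real DIM('a))"
  have C: "0 \<le> C"
    unfolding C_def by (intro mult_nonneg_nonneg add_nonneg_nonneg) auto
  \<comment> \<open>Fixed before f is chosen. It collects the loss of localisation: the commutator
    gives 2 C B^2 times 5 \<open>nsq f\<close>, the remaining term 2 B^2 times 4
    \<open>nsq f\<close>.\<close>
  define M where "M = 1 + B\<^sup>2 * (8 + 10 * C)"
  have M: "0 < M"
    unfolding M_def using C by (intro add_pos_nonneg mult_nonneg_nonneg) auto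
  obtain f where f': "l2 f" "\<forall>x. 0 \<le> f x" "nsq f < \<delta> / M" "\<forall>x\<in>K. 1 \<le> bessel_potential 2 f x"
    using capacity_zero_obtain[OF cap divide_pos_pos[OF \<delta> M]] by (elim exE conjE) (rule that)
  note f = f'(1) f'(2)[rule_format] f'(3) f'(4)[rule_format]
  have Mf: "M * nsq f < \<delta>"
    using f(3) M by (simp add: field_simps)
  note fm = l2_measurable[OF f(1)]
  define u where "u = conv f besselG"
  have u: "l2 u" "nsq u \<le> nsq f"
    using young[OF f(1) besselG_integrable besselG_nonneg] by (simp_all add: u_def integral_besselG)
  have u0: "0 \<le> u x" for x
    unfolding u_def conv_def by (intro integral_nonneg_AE AE_I2 mult_nonneg_nonneg f besselG_nonneg)
  have half: "(1/2 :: ennreal) = ennreal (1/2)"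
    by (metis ennreal_1 ennreal_divide_numeral zero_le_one)
  \<comment> \<open>Otherwise points converging to x with potential at most 1/2 would force 1 \<le>
    1/2 by lower semicontinuity.\<close>
  have "\<exists>d>0. \<forall>z\<in>ball x d. 1/2 < bessel_potential 2 f z" if x: "x \<in> K" for x
  proof (rule ccontr)
    assume "\<not> ?thesis"
    then have "\<forall>n. \<exists>z\<in>ball x (inverse (real (Suc n))). bessel_potential 2 f z \<le> 1/2"
      by (meson inverse_positive_iff_positive not_le of_nat_0_less_iff zero_less_Suc)
    then obtain z where z: "\<And>n. z n \<in> ball x (inverse (real (Suc n)))" "\<And>n. bessel_potential 2 f (z n) \<le> 1/2"
      by metis
    have "(\<lambda>n. z n - x) \<longlonglongrightarrow> 0"
      by (rule Lim_null_comparison[OF _ LIMSEQ_inverse_real_of_nat])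
         (use z(1) in \<open>auto simp: dist_norm norm_minus_commute intro!: always_eventually less_imp_le\<close>)
    then have "z \<longlonglongrightarrow> x"
      by (simp add: LIM_zero_iff)
    from bessel_potential_2_lsc[OF fm f(2) this]
    have "bessel_potential 2 f x \<le> liminf (\<lambda>n. bessel_potential 2 f (z n))" .
    also have "\<dots> \<le> liminf (\<lambda>n. 1/2 :: ennreal)"
      by (rule Liminf_mono) (simp add: z(2))
    also have "\<dots> = 1/2"
      by (rule Liminf_const) simp
    finally have "(1 :: ennreal) \<le> 1/2"
      using f(4)[OF x] by (rule order_trans[rotated])
    then have "ennreal 1 \<le> ennreal (1/2)"
      unfolding half ennreal_1 .
    then show False
      by (subst (asm) ennreal_le_iff) auto
  qed
  then obtain d where d: "\<And>x. x \<in> K \<Longrightarrow> 0 < d x" "\<And>x z. x \<in> K \<Longrightarrow> z \<in> ball x (d x) \<Longrightarrow> 1/2 < bessel_potential 2 f z"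
    by metis
  define U where "U = (\<Union>x\<in>K. ball x (d x))"
  have U: "open U" "K \<subseteq> U" "\<And>z. z \<in> U \<Longrightarrow> 1/2 < bessel_potential 2 f z"
    using d unfolding U_def by auto
  obtain \<epsilon> where \<epsilon>: "0 < \<epsilon>" "(\<Union>x\<in>K. cball x \<epsilon>) \<subseteq> U"
    using compact_subset_open_imp_cball_epsilon_subset[OF K U(1,2)] .
  \<comment> \<open>Points of V lie within r of K and the mollifier reaches r further, which
    together stay within \<epsilon>.\<close>
  define r where "r = \<epsilon> / 2"
  have r: "0 < r"
    using \<epsilon> by (simp add: r_def)
  \<comment> \<open>The radius is capped by 1 so that V stays inside the region where \<eta> equals
    1.\<close>
  define V where "V = (\<Union>x\<in>K. ball x (min r 1))"
  have V: "open V" "K \<subseteq> V"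
    unfolding V_def using r by auto
  define w where "w = conv u (moll r)"
  have w: "smooth w" "l2 w" "nsq w \<le> nsq f"
    unfolding w_def using u conv_moll_l2[OF u(1) r] smooth_conv[OF u(1) moll(1)[OF r]] by auto
  have w0: "0 \<le> w x" for x
    unfolding w_def conv_def by (intro integral_nonneg_AE AE_I2 mult_nonneg_nonneg u0 moll r)
  \<comment> \<open>The Laplacian of the potential is u - f, and the potential is no larger than f
    in norm because its kernel has mass one.\<close>
  have uf: "l2 (\<lambda>x. u x - f x)" "nsq (\<lambda>x. u x - f x) \<le> 4 * nsq f"
    using l2_diff[OF u(1) f(1)] nsq_diff_le[OF u(1) f(1)] u(2) by auto
  have lw: "lap w = conv (\<lambda>x. u x - f x) (moll r)"
    unfolding w_def by (rule lap_conv_weak[OF u(1) moll(1)[OF r]]) (unfold u_def, rule bessel_weak[OF f(1)])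
  have lapw: "l2 (lap w)" "nsq (lap w) \<le> 4 * nsq f"
    unfolding lw using conv_moll_l2[OF uf(1) r] uf(2) by auto
  have wV: "1/2 \<le> w z" if z: "z \<in> V" for z
    unfolding w_def
  proof (rule conv_moll_lower[OF u(1) r])
    obtain x where x: "x \<in> K" "dist x z < r"
      using z by (auto simp: V_def)
    show "AE y in lborel. norm (y - z) \<le> r \<longrightarrow> 1/2 \<le> u y"
      using bessel_potential_AE[OF f(1,2)]
    proof eventually_elim
      case (elim y)
      show ?case
      proof
        assume "norm (y - z) \<le> r"
        then have "dist x y \<le> \<epsilon>"
          using x(2) dist_triangle[of x y z] by (simp add: r_def dist_norm norm_minus_commute)
        then have "y \<in> cball x \<epsilon>"
          by simp
        then have "y \<in> U"
          using x(1) \<epsilon>(2) by blast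
        then have "ennreal (1/2) < ennreal (u y)"
          using U(3)[of y] unfolding half elim u_def by simp
        then show "1/2 \<le> u y"
          by (subst (asm) ennreal_less_iff) auto
      qed
    qed
  qed
  define v where "v x = \<eta> x * w x" for x
  show ?thesis
  proof (intro exI conjI ballI allI)
    show "v \<in> testf UNIV"
      unfolding v_def[abs_def] by (intro testf_mult \<eta> w)
    show "0 \<le> v x" for x
      using \<eta>0 w0 by (simp add: v_def)
    show "1/2 \<le> v x" if "x \<in> V" for x
    proof -
      obtain y where "y \<in> K" "dist y x < 1"
        using \<open>x \<in> V\<close> by (auto simp: V_def)
      then have "norm x \<le> R + 1"
        using R(2)[of y] norm_triangle_sub[of x y] by (simp add: dist_norm norm_minus_commute)
      with wV[OF that] show ?thesis
        by (simp add: v_def \<eta>1)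
    qed
    have \<eta>m: "\<eta> \<in> borel_measurable borel"
      by (rule smooth_measurable[OF testf_smooth[OF \<eta>]])
    have "nsq v \<le> B\<^sup>2 * nsq w"
      unfolding v_def[abs_def] by (intro nsq_mult_bounded w \<eta>m B)
    also have "\<dots> \<le> B\<^sup>2 * nsq f"
      using w(3) by (intro mult_left_mono) auto
    also have "\<dots> \<le> M * nsq f"
    proof (rule mult_right_mono)
      have "B\<^sup>2 * 1 \<le> B\<^sup>2 * (8 + 10 * C)"
        using C by (intro mult_left_mono) auto
      then show "B\<^sup>2 \<le> M"
        by (simp add: M_def)
    qed simp
    also note Mf
    finally show "nsq v < \<delta>" .
    have com: "l2 (\<lambda>x. lap v x - \<eta> x * lap w x)"
        "nsq (\<lambda>x. lap v x - \<eta> x * lap w x) \<le> C * B\<^sup>2 * (nsq w + nsq (lap w))"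
      unfolding v_def[abs_def] C_def
      by (rule lap_commutator[OF \<eta> w(1,2) lapw(1) B(3,4)]; assumption)+
    have \<eta>lw: "l2 (\<lambda>x. \<eta> x * lap w x)" "nsq (\<lambda>x. \<eta> x * lap w x) \<le> B\<^sup>2 * nsq (lap w)"
      using l2_mult_bounded[OF lapw(1) \<eta>m B(2)] nsq_mult_bounded[OF lapw(1) \<eta>m B(2)] by auto
    have "nsq (lap v) = nsq (\<lambda>x. (lap v x - \<eta> x * lap w x) + \<eta> x * lap w x)"
      by simp
    also have "\<dots> \<le> 2 * nsq (\<lambda>x. lap v x - \<eta> x * lap w x) + 2 * nsq (\<lambda>x. \<eta> x * lap w x)"
      by (rule nsq_add_le[OF com(1) \<eta>lw(1)])
    also have "\<dots> \<le> 2 * (C * B\<^sup>2 * (5 * nsq f)) + 2 * (B\<^sup>2 * (4 * nsq f))"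
    proof (intro add_mono mult_left_mono)
      have "C * B\<^sup>2 * (nsq w + nsq (lap w)) \<le> C * B\<^sup>2 * (5 * nsq f)"
        using w(3) lapw(2) C by (intro mult_left_mono) auto
      with com(2) show "nsq (\<lambda>x. lap v x - \<eta> x * lap w x) \<le> C * B\<^sup>2 * (5 * nsq f)"
        by linarith
      have "B\<^sup>2 * nsq (lap w) \<le> B\<^sup>2 * (4 * nsq f)"
        using lapw(2) by (intro mult_left_mono) auto
      with \<eta>lw(2) show "nsq (\<lambda>x. \<eta> x * lap w x) \<le> B\<^sup>2 * (4 * nsq f)"
        by linarith
    qed auto
    also have "\<dots> \<le> M * nsq f"
      by (simp add: M_def algebra_simps)
    also note Mf
    finally show "nsq (lap v) < \<delta>" .
  qed (use V in auto)
qed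

section \<open>Integral inequalities for test functions\<close>

lemma nsq_pdiff_le:
  assumes v: "v \<in> testf UNIV" and b: "b \<in> Basis"
  shows "nsq (pdiff b v) \<le> nsq v + nsq (lap v)"
proof -
  have i: "integrable lborel (\<lambda>x. (pdiff b v x)\<^sup>2)" if "b \<in> Basis" for b
    using l2_testf[OF testf_pdiff[OF v that]] by (simp add: l2_def)
  have "nsq (pdiff b v) \<le> (\<integral>x. (\<Sum>b\<in>Basis. (pdiff b v x)\<^sup>2) \<partial>lborel)"
    unfolding nsq_def using b
    by (intro integral_mono i Bochner_Integration.integrable_sum member_le_sum[of b _ "\<lambda>b. (pdiff b v _)\<^sup>2"]) auto
  also have "\<dots> = - (\<integral>x. v x * lap v x \<partial>lborel)"
    using integral_lap_commute(1)[OF v testf_smooth[OF v]] by (simp add: power2_eq_square)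
  also have "\<dots> = (\<integral>x. - (v x * lap v x) \<partial>lborel)"
    by simp
  also have "\<dots> \<le> (\<integral>x. (v x)\<^sup>2 + (lap v x)\<^sup>2 \<partial>lborel)"
  proof (rule integral_mono)
    have "- (p * q) \<le> p\<^sup>2 + q\<^sup>2" for p q :: real
    proof -
      have "0 \<le> (p + q)\<^sup>2"
        by simp
      then have "0 \<le> p\<^sup>2 + q\<^sup>2 + 2 * (p * q)"
        by (simp only: power2_sum mult.assoc)
      then show ?thesis
        using zero_le_power2[of p] zero_le_power2[of q] by linarith
    qed
    then show "- (v x * lap v x) \<le> (v x)\<^sup>2 + (lap v x)\<^sup>2" for x .
  qed (use l2_mult_integrable[OF l2_testf[OF v] l2_testf[OF testf_lap[OF v]]]
      l2_testf[OF v] l2_testf[OF testf_lap[OF v]] in \<open>auto simp: l2_def\<close>)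
  also have "\<dots> = nsq v + nsq (lap v)"
    using l2_testf[OF v] l2_testf[OF testf_lap[OF v]] by (simp add: nsq_def l2_def)
  finally show ?thesis .
qed

text \<open>Two integrations by parts turn the integral of the product of two pure second
  derivatives into that of a squared mixed one. Hence the squared norm of the Laplacian is the sum
  over all second derivatives, a sum of nonnegative terms.\<close>

lemma nsq_pdiff2_le:
  fixes v :: "'a::euclidean_space \<Rightarrow> real"
  assumes v: "v \<in> testf UNIV" and b: "b \<in> Basis"
  shows "nsq (pdiff b (pdiff b v)) \<le> nsq (lap v)"
proof -
  let ?D = "\<lambda>b c. pdiff b (pdiff c v)"
  have t: "?D b c \<in> testf UNIV" if "b \<in> Basis" "c \<in> Basis" for b c
    using v that by (intro testf_pdiff)
  have com: "?D b c = ?D c b" if "b \<in> Basis" "c \<in> Basis" for b c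
    using pdiff_commute[OF smooth_CkD[OF testf_smooth[OF v]] that] by blast
  have eq: "(\<integral>x. ?D b b x * ?D c c x \<partial>lborel) = (\<integral>x. (?D b c x)\<^sup>2 \<partial>lborel)" if b: "b \<in> Basis" and c: "c \<in> Basis" for b c
  proof -
    \<comment> \<open>Symmetry of second derivatives for \<open>pdiff b v\<close>, so third
      derivatives may be reordered between the two integrations by parts.\<close>
    have com3: "pdiff c (?D b b) = pdiff b (?D c b)"
      using pdiff_commute[OF smooth_CkD[OF testf_smooth[OF testf_pdiff[OF v b]]] c b] by blast
    have "(\<integral>x. ?D b b x * ?D c c x \<partial>lborel) = - (\<integral>x. pdiff c (?D b b) x * pdiff c v x \<partial>lborel)"
      using integration_by_parts[OF t[OF b b] testf_smooth[OF testf_pdiff[OF v c]] c] .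
    also have "\<dots> = - (\<integral>x. pdiff c v x * pdiff b (?D c b) x \<partial>lborel)"
      unfolding com3 by (simp only: mult.commute)
    also have "\<dots> = (\<integral>x. ?D b c x * ?D c b x \<partial>lborel)"
      using integration_by_parts[OF testf_pdiff[OF v c] testf_smooth[OF t[OF c b]] b] by simp
    finally show ?thesis
      unfolding com[OF c b] by (simp add: power2_eq_square)
  qed
  have i: "integrable lborel (\<lambda>x. ?D b b x * ?D c c x)" if "b \<in> Basis" "c \<in> Basis" for b c
    using that by (intro l2_mult_integrable l2_testf[OF t])
  have "nsq (lap v) = (\<integral>x. (\<Sum>b\<in>Basis. \<Sum>c\<in>Basis. ?D b b x * ?D c c x) \<partial>lborel)"
    unfolding nsq_def lap_def power2_eq_square sum_product ..
  also have "\<dots> = (\<Sum>b\<in>Basis. \<Sum>c\<in>Basis. \<integral>x. ?D b b x * ?D c c x \<partial>lborel)"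
    using i by (simp add: Bochner_Integration.integral_sum Bochner_Integration.integrable_sum)
  also have "\<dots> = (\<Sum>b\<in>Basis. \<Sum>c\<in>Basis. \<integral>x. (?D b c x)\<^sup>2 \<partial>lborel)"
    by (intro sum.cong refl eq)
  finally have L: "nsq (lap v) = (\<Sum>b\<in>Basis. \<Sum>c\<in>Basis. nsq (?D b c))"
    by (simp add: nsq_def)
  have "nsq (?D b b) \<le> (\<Sum>c\<in>Basis. nsq (?D b c))"
    using b by (intro member_le_sum) auto
  also have "\<dots> \<le> (\<Sum>b\<in>Basis. \<Sum>c\<in>Basis. nsq (?D b c))"
    using b by (intro member_le_sum[of b Basis "\<lambda>b. \<Sum>c\<in>Basis. nsq (?D b c)"]) (auto intro: sum_nonneg)
  finally show ?thesis
    by (simp add: L)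
qed

text \<open>Integrating \<open>\<partial>\<^sub>b ((\<partial>\<^sub>b v)\<^sup>3 / (1 + v))\<close> and absorbing by AM-GM; this controls the
  gradient-squared term of \<open>\<Delta> (P \<circ> v)\<close> in \<open>L\<^sup>2\<close>.\<close>

lemma nsq_gradient_squared_le:
  fixes v :: "'a::euclidean_space \<Rightarrow> real"
  assumes v: "v \<in> testf UNIV" "\<And>x. 0 \<le> v x" and b: "b \<in> Basis"
  shows "l2 (\<lambda>x. (pdiff b v x)\<^sup>2 / (1 + v x))" "nsq (\<lambda>x. (pdiff b v x)\<^sup>2 / (1 + v x)) \<le> 9 * nsq (lap v)"
proof -
  let ?p = "pdiff b v" and ?q = "pdiff b (pdiff b v)"
  define a where "a x = (?p x)\<^sup>2 / (1 + v x)" for x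
  have v1: "1 + v x \<noteq> 0" for x
    using v(2)[of x] by simp
  obtain C where C: "compact C" "supp_in C v" "closed C"
    using v(1) by (rule testfE)
  have sp: "supp_in C ?p"
    by (rule supp_in_pdiff[OF C(2,3)])
  have cont: "continuous_on UNIV v" "continuous_on UNIV ?p" "continuous_on UNIV ?q"
    using v(1) b by (auto intro!: smooth_continuous testf_smooth testf_pdiff)
  have ca: "continuous_on UNIV a"
    unfolding a_def by (intro continuous_intros cont) (use v1 in auto)
  have sa: "supp_in C a"
    using sp by (simp add: supp_in_def a_def)
  show l2a: "l2 (\<lambda>x. (?p x)\<^sup>2 / (1 + v x))"
    using l2_continuous[OF ca C(1) sa] by (simp add: a_def[abs_def])
  have l2q: "l2 ?q"
    using v(1) b by (intro l2_testf[of _ UNIV] testf_pdiff)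
  \<comment> \<open>Differentiating the cube yields 3 a times the second derivative, and
    differentiating the reciprocal yields -a^2. As F has compact support, the integral of the sum is
    zero.\<close>
  define F where "F x = (?p x) ^ 3 * inverse (1 + v x)" for x
  have dv: "v differentiable (at x)" "?p differentiable (at x)" for x
    using v(1) b by (auto intro!: smooth_differentiable testf_smooth testf_pdiff)
  have d1: "(\<lambda>x. (?p x) ^ 3) differentiable (at x)" for x
    using dv by (intro differentiable_power)
  have d2: "(\<lambda>x. inverse (1 + v x)) differentiable (at x)" for x
    using dv v1 by (intro differentiable_inverse differentiable_add differentiable_const)
  have p1: "pdiff b (\<lambda>x. (?p x) ^ 3) x = 3 * (?p x)\<^sup>2 * ?q x" for x
    by (rule pdiff_chain[where F="\<lambda>t. t ^ 3"]) (auto intro!: derivative_eq_intros dv)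
  have p2: "pdiff b (\<lambda>x. inverse (1 + v x)) x = (- (inverse (1 + v x) * inverse (1 + v x))) * ?p x" for x
    by (rule pdiff_chain[where F="\<lambda>t. inverse (1 + t)"]) (use v1 in \<open>auto intro!: derivative_eq_intros dv\<close>)
  have pF: "pdiff b F = (\<lambda>x. 3 * (a x * ?q x) - (a x)\<^sup>2)"
  proof
    fix x
    have "pdiff b F x = 3 * (?p x)\<^sup>2 * ?q x * inverse (1 + v x)
        + (?p x) ^ 3 * ((- (inverse (1 + v x) * inverse (1 + v x))) * ?p x)"
      unfolding F_def pdiff_mult[OF d1 d2] p1 p2 ..
    then show "pdiff b F x = 3 * (a x * ?q x) - (a x)\<^sup>2"
      by (simp add: a_def divide_inverse power2_eq_square power3_eq_cube mult_ac)
  qed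
  have "(\<integral>x. pdiff b F x \<partial>lborel) = 0"
  proof (rule integral_pdiff_eq_0[OF _ _ C(1)])
    show "F differentiable (at x)" for x
      unfolding F_def by (intro differentiable_mult d1 d2)
    show "continuous_on UNIV (pdiff b F)"
      unfolding pF by (intro continuous_intros ca cont)
    show "supp_in C F"
      using sp by (simp add: supp_in_def F_def)
  qed
  moreover have l2a': "l2 a"
    by (rule l2_continuous[OF ca C(1) sa])
  ultimately have id: "nsq a = 3 * (\<integral>x. a x * ?q x \<partial>lborel)"
    using l2_mult_integrable[OF l2a' l2q] by (simp add: pF nsq_def l2_def)
  \<comment> \<open>The AM-GM weight leaves exactly half of \<open>nsq a\<close> on the right;
    absorbing it gives the factor 9.\<close>
  have "(\<integral>x. 3 * (a x * ?q x) \<partial>lborel) \<le> (\<integral>x. 1/2 * (a x)\<^sup>2 + 9/2 * (?q x)\<^sup>2 \<partial>lborel)"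
  proof (rule integral_mono)
    have "3 * (s * t) \<le> 1/2 * s\<^sup>2 + 9/2 * t\<^sup>2" for s t :: real
      using zero_le_power2[of "s - 3 * t"] by (simp add: power2_eq_square algebra_simps)
    then show "3 * (a x * ?q x) \<le> 1/2 * (a x)\<^sup>2 + 9/2 * (?q x)\<^sup>2" for x .
  qed (use l2_mult_integrable[OF l2a' l2q] l2a' l2q in \<open>auto simp: l2_def\<close>)
  also have "\<dots> = 1/2 * nsq a + 9/2 * nsq ?q"
    using l2a' l2q by (simp add: nsq_def l2_def)
  finally have "nsq a \<le> 1/2 * nsq a + 9/2 * nsq ?q"
    unfolding id by simp
  then have "nsq a \<le> 9 * nsq ?q"
    by simp
  also have "\<dots> \<le> 9 * nsq (lap v)"
    using nsq_pdiff2_le[OF v(1) b] by simp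
  finally show "nsq (\<lambda>x. (?p x)\<^sup>2 / (1 + v x)) \<le> 9 * nsq (lap v)"
    by (simp add: a_def[abs_def])
qed

section \<open>Removability\<close>

text \<open>The flat function read backwards from 1/2, the height guaranteed near K; the quotient
  normalises the value at 0 to 1.\<close>

definition profile :: "real \<Rightarrow> real" where
  "profile t = flat 0 (1/2 - t) / flat 0 (1/2)"

lemma smooth_profile: "smooth profile"
proof -
  have "smooth (\<lambda>t. (1 / flat 0 (1/2)) * flat 0 ((-1) *\<^sub>R t + 1/2))"
    by (intro smooth_cmult smooth_affine smooth_flat)
  then show ?thesis
    by (simp add: profile_def[abs_def])
qed

lemma profile_zero: "1/2 \<le> t \<Longrightarrow> profile t = 0"
  by (simp add: profile_def flat_def)

text \<open>Bounds on the half-line suffice since v is nonnegative, and there the derivatives live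
  on the compact interval [0, 1/2]. The weight 1 + t in the last bound matches the denominator of
  the squared-gradient estimate.\<close>

lemma profile_bounds:
  "\<exists>M>0. (\<forall>t\<ge>0. \<bar>profile t - 1\<bar> \<le> M * t) \<and> (\<forall>t\<ge>0. \<bar>pdiff 1 profile t\<bar> \<le> M) \<and>
    (\<forall>t\<ge>0. \<bar>pdiff 1 (pdiff 1 profile) t\<bar> * (1 + t) \<le> M)"
proof -
  have s1: "smooth (pdiff 1 profile)"
    by (intro smooth_pdiff smooth_profile) simp
  have s2: "smooth (pdiff 1 (pdiff 1 profile))"
    by (intro smooth_pdiff s1) simp
  have z0: "supp_in {..1/2} profile"
    by (auto simp: supp_in_def profile_zero)
  have z1: "supp_in {..1/2} (pdiff 1 profile)"
    by (rule supp_in_pdiff[OF z0]) simp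
  have z2: "supp_in {..1/2} (pdiff 1 (pdiff 1 profile))"
    by (rule supp_in_pdiff[OF z1]) simp
  have bd: "\<exists>B>0. \<forall>t\<ge>0. \<bar>f t\<bar> \<le> B" if f: "smooth f" "supp_in {..1/2} f" for f :: "real \<Rightarrow> real"
  proof -
    have "compact (f ` {0..1/2})"
      by (intro compact_continuous_image smooth_continuous f compact_Icc)
    then have "bounded (f ` {0..1/2})"
      by (rule compact_imp_bounded)
    then obtain B where B: "0 < B" "\<forall>y\<in>f ` {0..1/2}. norm y \<le> B"
      unfolding bounded_pos by blast
    have "\<bar>f t\<bar> \<le> B" if "0 \<le> t" for t
    proof (cases "t \<le> 1/2")
      case True
      then show ?thesis
        using B(2) that by auto
    next
      case False
      then show ?thesis
        using f(2) B(1) by (simp add: supp_in_def)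
    qed
    with B(1) show ?thesis
      by blast
  qed
  obtain B1 where B1: "0 < B1" "\<forall>t\<ge>0. \<bar>pdiff 1 profile t\<bar> \<le> B1"
    using bd[OF s1 z1] by blast
  obtain B2 where B2: "0 < B2" "\<forall>t\<ge>0. \<bar>pdiff 1 (pdiff 1 profile) t\<bar> \<le> B2"
    using bd[OF s2 z2] by blast
  have p0: "profile 0 = 1"
    by (simp add: profile_def flat_def)
  have 1: "\<bar>profile t - 1\<bar> \<le> B1 * t" if t: "0 \<le> t" for t
  proof -
    have "norm (profile t - profile 0) \<le> B1 * norm (t - 0)"
    proof (rule field_differentiable_bound[of "{0..}" profile "pdiff 1 profile"])
      show "(profile has_field_derivative pdiff 1 profile z) (at z within {0..})" for z
        by (rule has_field_derivative_at_within[OF smooth_real_has_derivative[OF smooth_profile]])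
      show "norm (pdiff 1 profile z) \<le> B1" if "z \<in> {0..}" for z
        using B1(2) that by simp
    qed (use t in auto)
    then show ?thesis
      using t by (simp add: p0)
  qed
  have 2: "\<bar>pdiff 1 (pdiff 1 profile) t\<bar> * (1 + t) \<le> 2 * B2" if t: "0 \<le> t" for t
  proof (cases "t \<le> 1/2")
    case True
    have "\<bar>pdiff 1 (pdiff 1 profile) t\<bar> * (1 + t) \<le> B2 * 2"
      using B2 t True by (intro mult_mono) auto
    then show ?thesis
      by simp
  next
    case False
    then show ?thesis
      using z2 B2(1) by (simp add: supp_in_def)
  qed
  let ?M = "max B1 (2 * B2)"
  show ?thesis
  proof (intro exI[of _ ?M] conjI allI impI)
    show "0 < ?M"
      using B1(1) by simp
    fix t :: real assume t: "0 \<le> t"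
    have "B1 * t \<le> ?M * t"
      using t by (intro mult_right_mono) auto
    with 1[OF t] show "\<bar>profile t - 1\<bar> \<le> ?M * t"
      by linarith
    have "\<bar>pdiff 1 profile t\<bar> \<le> B1"
      using B1(2) t by blast
    then show "\<bar>pdiff 1 profile t\<bar> \<le> ?M"
      by simp
    show "\<bar>pdiff 1 (pdiff 1 profile) t\<bar> * (1 + t) \<le> ?M"
      using 2[OF t] by simp
  qed
qed

lemma lap_compose:
  fixes v :: "'a::euclidean_space \<Rightarrow> real"
  assumes P: "smooth P" and v: "smooth v"
  shows "pdiff b (\<lambda>x. P (v x)) = (\<lambda>x. pdiff 1 P (v x) * pdiff b v x)"
    and "lap (\<lambda>x. P (v x)) x = pdiff 1 P (v x) * lap v x
      + (\<Sum>b\<in>Basis. pdiff 1 (pdiff 1 P) (v x) * (pdiff b v x)\<^sup>2)"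
proof -
  have s1: "smooth (pdiff 1 P)"
    by (intro smooth_pdiff P) simp
  have 1: "pdiff b (\<lambda>x. P (v x)) = (\<lambda>x. pdiff 1 P (v x) * pdiff b v x)" for b
    using pdiff_chain[OF smooth_real_has_derivative[OF P] smooth_differentiable[OF v]] by blast
  show "pdiff b (\<lambda>x. P (v x)) = (\<lambda>x. pdiff 1 P (v x) * pdiff b v x)"
    by (rule 1)
  have "pdiff b (pdiff b (\<lambda>x. P (v x))) x
      = pdiff 1 P (v x) * pdiff b (pdiff b v) x + pdiff 1 (pdiff 1 P) (v x) * (pdiff b v x)\<^sup>2" if b: "b \<in> Basis" for b
  proof -
    have "pdiff b (\<lambda>x. pdiff 1 P (v x) * pdiff b v x) x
        = pdiff b (\<lambda>x. pdiff 1 P (v x)) x * pdiff b v x + pdiff 1 P (v x) * pdiff b (pdiff b v) x"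
      by (rule pdiff_mult) (intro smooth_differentiable smooth_compose[OF s1 v] smooth_pdiff[OF v b])+
    also have "pdiff b (\<lambda>x. pdiff 1 P (v x)) x = pdiff 1 (pdiff 1 P) (v x) * pdiff b v x"
      by (rule pdiff_chain[OF smooth_real_has_derivative[OF s1] smooth_differentiable[OF v]])
    finally show ?thesis
      unfolding 1 by (simp add: power2_eq_square)
  qed
  then show "lap (\<lambda>x. P (v x)) x = pdiff 1 P (v x) * lap v x
      + (\<Sum>b\<in>Basis. pdiff 1 (pdiff 1 P) (v x) * (pdiff b v x)\<^sup>2)"
    by (simp add: lap_def sum.distrib sum_distrib_left)
qed

lemma l2_of_bound:
  assumes "l2 g" "f \<in> borel_measurable borel" "\<And>x. \<bar>f x\<bar> \<le> \<bar>c * g x\<bar>"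
  shows "l2 f" "nsq f \<le> c\<^sup>2 * nsq g"
proof -
  have cg: "l2 (\<lambda>x. c * g x)"
    using assms(1) by (rule l2_cmult)
  show "l2 f"
    using cg assms(2,3) by (intro l2_bound[where w="\<lambda>x. (c * g x)\<^sup>2"]) (auto simp: l2_def abs_le_square_iff)
  show "nsq f \<le> c\<^sup>2 * nsq g"
    using nsq_mono[OF cg assms(2,3)] by (simp add: nsq_cmult)
qed

text \<open>The factor P(v) - 1 is at most M v, so replacing P(v) by 1 costs a multiple of the norm
  of v. The other contributions to the Laplacian are linear in the gradient or the Laplacian of v,
  except one quadratic in the gradient, for which the quartic estimate was made. No upper bound on v
  is assumed anywhere.\<close>

lemma removal:
  fixes K :: "'a::euclidean_space set"
  assumes K: "compact K" and cap: "bessel_capacity2 2 K = 0" and \<psi>: "\<psi> \<in> testf UNIV" and \<delta>: "0 < \<delta>"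
  shows "\<exists>\<phi>\<in>testf (- K). nsq (\<lambda>x. \<phi> x - \<psi> x) < \<delta> \<and> nsq (\<lambda>x. lap \<phi> x - lap \<psi> x) < \<delta>"
proof -
  obtain M where M': "0 < M" "\<forall>t\<ge>0. \<bar>profile t - 1\<bar> \<le> M * t" "\<forall>t\<ge>0. \<bar>pdiff 1 profile t\<bar> \<le> M"
    "\<forall>t\<ge>0. \<bar>pdiff 1 (pdiff 1 profile) t\<bar> * (1 + t) \<le> M"
    using profile_bounds by (elim exE conjE) (rule that)
  note M = M'(1) M'(2)[rule_format] M'(3)[rule_format] M'(4)[rule_format]
  obtain B where B': "0 < B" "\<forall>x. \<bar>\<psi> x\<bar> \<le> B" "\<forall>b\<in>Basis. \<forall>x. \<bar>pdiff b \<psi> x\<bar> \<le> B" "\<forall>x. \<bar>lap \<psi> x\<bar> \<le> B"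
    using testf_derivs_bounded[OF \<psi>] by (elim exE conjE) (rule that)
  note B = B'(1) B'(2)[rule_format] B'(3)[rule_format] B'(4)[rule_format]
  define n where "n = real DIM('a)"
  have n: "0 \<le> n"
    by (simp add: n_def)
  \<comment> \<open>Each of the four terms enters with weight 4, and their bounds are 1, 4 n^2, 1
    and 9 n^2 times (B M)^2 S.\<close>
  define Q where "Q = 4 * (B * M)\<^sup>2 * (2 + 13 * n\<^sup>2)"
  have n2: "0 \<le> n\<^sup>2"
    by simp
  have Q: "0 < Q"
    unfolding Q_def using B(1) M(1) n2 by (intro mult_pos_pos) (auto intro: add_pos_nonneg)
  \<comment> \<open>Halved because S adds the squared norms of v and of its Laplacian.\<close>
  have d': "0 < \<delta> / (2 * Q)"
    using \<delta> Q by simp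
  obtain v V where v': "v \<in> testf UNIV" "\<forall>x. 0 \<le> v x" "open V" "K \<subseteq> V" "\<forall>x\<in>V. 1/2 \<le> v x"
    "nsq v < \<delta> / (2 * Q)" "nsq (lap v) < \<delta> / (2 * Q)"
    using capacity_zero_cutoff[OF K cap d'] by (elim exE conjE) (rule that)
  note v = v'(1) v'(2)[rule_format] v'(3,4) v'(5)[rule_format] v'(6,7)
  define S where "S = nsq v + nsq (lap v)"
  have S: "Q * S < \<delta>" "0 \<le> S" "nsq v \<le> S" "nsq (lap v) \<le> S"
    using v(6,7) Q by (auto simp: S_def field_simps)
  note sv = testf_smooth[OF v(1)] and s\<psi> = testf_smooth[OF \<psi>]
  let ?P = profile and ?P1 = "pdiff 1 profile" and ?P2 = "pdiff 1 (pdiff 1 profile)"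
  have s1: "smooth ?P1"
    by (intro smooth_pdiff smooth_profile) simp
  have s2: "smooth ?P2"
    by (intro smooth_pdiff s1) simp
  have sP: "smooth (\<lambda>x. ?P (v x))" "smooth (\<lambda>x. ?P1 (v x))" "smooth (\<lambda>x. ?P2 (v x))"
    using smooth_compose[OF smooth_profile sv] smooth_compose[OF s1 sv] smooth_compose[OF s2 sv] .
  define \<phi> where "\<phi> x = \<psi> x * ?P (v x)" for x
  obtain C where C: "compact C" "supp_in C \<psi>"
    using \<psi> by (rule testfE)
  have \<phi>: "\<phi> \<in> testf (- K)"
  proof (rule testfI)
    show "smooth \<phi>"
      unfolding \<phi>_def[abs_def] by (intro smooth_mult s\<psi> sP)
    \<comment> \<open>On the open set V the profile is evaluated at values of at least 1/2 and
      vanishes, so the support keeps away from K.\<close>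
    show "compact (C - V)"
      using C(1) v(3) by (rule compact_diff)
    show "C - V \<subseteq> - K"
      using v(4) by blast
    show "supp_in (C - V) \<phi>"
      using C(2) v(5) profile_zero by (auto simp: supp_in_def \<phi>_def)
  qed
  have Pv: "\<bar>?P (v x) - 1\<bar> \<le> M * \<bar>v x\<bar>" for x
    using M(2)[OF v(2)] v(2)[of x] by simp
  have l2v: "l2 v" "l2 (lap v)"
    using v(1) by (auto intro: l2_testf testf_lap)
  \<comment> \<open>Used twice: with h = \<psi> for the difference of the functions, and with h =
    \<Delta>\<psi> for the term T1.\<close>
  have est: "nsq f \<le> (B * M)\<^sup>2 * nsq v" "l2 f" if "\<And>x. f x = h x * (?P (v x) - 1)" "\<And>x. \<bar>h x\<bar> \<le> B" "smooth h" for f h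
  proof -
    have "smooth (\<lambda>x. h x * (?P (v x) - 1))"
      by (rule smooth_mult[OF that(3) smooth_diff[OF sP(1) smooth_const]])
    moreover have "f = (\<lambda>x. h x * (?P (v x) - 1))"
      using that(1) by (rule ext)
    ultimately have m: "f \<in> borel_measurable borel"
      by (simp only: smooth_measurable)
    have b: "\<bar>f x\<bar> \<le> \<bar>(B * M) * v x\<bar>" for x
    proof -
      have "\<bar>h x\<bar> * \<bar>?P (v x) - 1\<bar> \<le> B * (M * \<bar>v x\<bar>)"
        using that(2) Pv B(1) by (intro mult_mono) auto
      then show ?thesis
        using B(1) M(1) by (simp add: that(1) abs_mult mult.assoc)
    qed
    show "nsq f \<le> (B * M)\<^sup>2 * nsq v" "l2 f"
      using l2_of_bound[OF l2v(1) m b] by auto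
  qed
  have D0: "nsq (\<lambda>x. \<phi> x - \<psi> x) \<le> (B * M)\<^sup>2 * nsq v"
    by (rule est(1)[of _ \<psi>]) (auto simp: \<phi>_def algebra_simps B s\<psi>)
  define T1 where "T1 x = lap \<psi> x * (?P (v x) - 1)" for x
  define T2 where "T2 x = (\<Sum>b\<in>Basis. 2 * (pdiff b \<psi> x * (?P1 (v x) * pdiff b v x)))" for x
  define T3 where "T3 x = \<psi> x * (?P1 (v x) * lap v x)" for x
  define T4 where "T4 x = (\<Sum>b\<in>Basis. \<psi> x * (?P2 (v x) * (pdiff b v x)\<^sup>2))" for x
  have eq: "lap \<phi> x - lap \<psi> x = (T1 x + T2 x) + (T3 x + T4 x)" for x
  proof -
    have "lap \<phi> x = \<psi> x * lap (\<lambda>x. ?P (v x)) x + 2 * (\<Sum>b\<in>Basis. pdiff b \<psi> x * pdiff b (\<lambda>x. ?P (v x)) x)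
        + lap \<psi> x * ?P (v x)"
      unfolding \<phi>_def[abs_def] by (rule lap_mult[OF s\<psi> sP(1)])
    also have "(\<Sum>b\<in>Basis. pdiff b \<psi> x * pdiff b (\<lambda>x. ?P (v x)) x)
        = (\<Sum>b\<in>Basis. pdiff b \<psi> x * (?P1 (v x) * pdiff b v x))"
      by (simp add: lap_compose(1)[OF smooth_profile sv])
    also have "lap (\<lambda>x. ?P (v x)) x = ?P1 (v x) * lap v x + (\<Sum>b\<in>Basis. ?P2 (v x) * (pdiff b v x)\<^sup>2)"
      by (rule lap_compose(2)[OF smooth_profile sv])
    finally show ?thesis
      by (simp add: T1_def T2_def T3_def T4_def distrib_left right_diff_distrib sum_distrib_left)
  qed
  have T1: "nsq T1 \<le> (B * M)\<^sup>2 * S" "l2 T1"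
  proof -
    have "nsq T1 \<le> (B * M)\<^sup>2 * nsq v" "l2 T1"
      using est[of T1 "lap \<psi>"] by (auto simp: T1_def B smooth_lap s\<psi>)
    moreover have "(B * M)\<^sup>2 * nsq v \<le> (B * M)\<^sup>2 * S"
      using S by (intro mult_left_mono) auto
    ultimately show "nsq T1 \<le> (B * M)\<^sup>2 * S" "l2 T1"
      by auto
  qed
  have P1v: "\<bar>?P1 (v x)\<bar> \<le> M" for x
    using M(3)[OF v(2)] .
  have t2: "nsq (\<lambda>x. 2 * (pdiff b \<psi> x * (?P1 (v x) * pdiff b v x))) \<le> 4 * (B * M)\<^sup>2 * S"
      "l2 (\<lambda>x. 2 * (pdiff b \<psi> x * (?P1 (v x) * pdiff b v x)))" if b: "b \<in> Basis" for b
  proof -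
    have l: "l2 (pdiff b v)"
      using v(1) b by (intro l2_testf[of _ UNIV] testf_pdiff)
    have m: "(\<lambda>x. 2 * (pdiff b \<psi> x * (?P1 (v x) * pdiff b v x))) \<in> borel_measurable borel"
      by (intro smooth_measurable smooth_mult smooth_const smooth_pdiff s\<psi> sv sP b)
    have bd: "\<bar>2 * (pdiff b \<psi> x * (?P1 (v x) * pdiff b v x))\<bar> \<le> \<bar>(2 * (B * M)) * pdiff b v x\<bar>" for x
    proof -
      have "\<bar>pdiff b \<psi> x\<bar> * \<bar>?P1 (v x)\<bar> * \<bar>pdiff b v x\<bar> \<le> B * M * \<bar>pdiff b v x\<bar>"
        using B(1,3) M(1) P1v b by (intro mult_mono) auto
      then show ?thesis
        using B(1) M(1) by (simp add: abs_mult mult.assoc)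
    qed
    have "(2 * (B * M))\<^sup>2 * nsq (pdiff b v) \<le> (2 * (B * M))\<^sup>2 * S"
      using nsq_pdiff_le[OF v(1) b] by (intro mult_left_mono) (auto simp: S_def)
    then show "nsq (\<lambda>x. 2 * (pdiff b \<psi> x * (?P1 (v x) * pdiff b v x))) \<le> 4 * (B * M)\<^sup>2 * S"
      "l2 (\<lambda>x. 2 * (pdiff b \<psi> x * (?P1 (v x) * pdiff b v x)))"
      using l2_of_bound[OF l m bd] by (auto simp: power_mult_distrib)
  qed
  have T2: "nsq T2 \<le> 4 * n\<^sup>2 * ((B * M)\<^sup>2 * S)" "l2 T2"
  proof -
    have "nsq T2 \<le> n * (\<Sum>b\<in>Basis. nsq (\<lambda>x. 2 * (pdiff b \<psi> x * (?P1 (v x) * pdiff b v x))))"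
      unfolding T2_def[abs_def] n_def by (intro l2_sum_bound t2) auto
    also have "\<dots> \<le> n * (\<Sum>b\<in>(Basis :: 'a set). 4 * (B * M)\<^sup>2 * S)"
      using t2(1) n by (intro mult_left_mono sum_mono) auto
    finally show "nsq T2 \<le> 4 * n\<^sup>2 * ((B * M)\<^sup>2 * S)"
      by (simp add: n_def power2_eq_square mult_ac)
    show "l2 T2"
      unfolding T2_def[abs_def] by (intro l2_sum t2) auto
  qed
  have T3: "nsq T3 \<le> (B * M)\<^sup>2 * S" "l2 T3"
  proof -
    have m: "T3 \<in> borel_measurable borel"
      unfolding T3_def[abs_def] by (intro smooth_measurable smooth_mult smooth_lap s\<psi> sv sP)
    have bd: "\<bar>T3 x\<bar> \<le> \<bar>(B * M) * lap v x\<bar>" for x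
    proof -
      have "\<bar>\<psi> x\<bar> * \<bar>?P1 (v x)\<bar> * \<bar>lap v x\<bar> \<le> B * M * \<bar>lap v x\<bar>"
        using B(1,2) M(1) P1v by (intro mult_mono) auto
      then show ?thesis
        using B(1) M(1) by (simp add: T3_def abs_mult mult.assoc)
    qed
    have "(B * M)\<^sup>2 * nsq (lap v) \<le> (B * M)\<^sup>2 * S"
      using S by (intro mult_left_mono) auto
    then show "nsq T3 \<le> (B * M)\<^sup>2 * S" "l2 T3"
      using l2_of_bound[OF l2v(2) m bd] by auto
  qed
  have t4: "nsq (\<lambda>x. \<psi> x * (?P2 (v x) * (pdiff b v x)\<^sup>2)) \<le> 9 * (B * M)\<^sup>2 * S"
      "l2 (\<lambda>x. \<psi> x * (?P2 (v x) * (pdiff b v x)\<^sup>2))" if b: "b \<in> Basis" for b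
  proof -
    note g = nsq_gradient_squared_le[OF v(1,2) b]
    have m: "(\<lambda>x. \<psi> x * (?P2 (v x) * (pdiff b v x)\<^sup>2)) \<in> borel_measurable borel"
      unfolding power2_eq_square by (intro smooth_measurable smooth_mult smooth_pdiff s\<psi> sv sP b)
    \<comment> \<open>The weight 1 + v is shifted from the squared gradient to P'', where the
      weighted profile bound absorbs it.\<close>
    have bd: "\<bar>\<psi> x * (?P2 (v x) * (pdiff b v x)\<^sup>2)\<bar> \<le> \<bar>(B * M) * ((pdiff b v x)\<^sup>2 / (1 + v x))\<bar>" for x
    proof -
      have pos: "0 < 1 + v x"
        using v(2)[of x] by simp
      have "\<bar>?P2 (v x)\<bar> * (pdiff b v x)\<^sup>2 = (\<bar>?P2 (v x)\<bar> * (1 + v x)) * ((pdiff b v x)\<^sup>2 / (1 + v x))"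
        using pos by simp
      also have "\<dots> \<le> M * ((pdiff b v x)\<^sup>2 / (1 + v x))"
        using M(4)[OF v(2)] pos by (intro mult_right_mono) auto
      finally have "\<bar>\<psi> x\<bar> * (\<bar>?P2 (v x)\<bar> * (pdiff b v x)\<^sup>2) \<le> B * (M * ((pdiff b v x)\<^sup>2 / (1 + v x)))"
        by - (rule mult_mono, use B(1,2) in auto)
      also have "\<dots> \<le> \<bar>(B * M) * ((pdiff b v x)\<^sup>2 / (1 + v x))\<bar>"
        by (simp only: mult.assoc abs_ge_self)
      finally show ?thesis
        by (simp add: abs_mult)
    qed
    have "(B * M)\<^sup>2 * nsq (\<lambda>x. (pdiff b v x)\<^sup>2 / (1 + v x)) \<le> (B * M)\<^sup>2 * (9 * S)"
      using g(2) S(4) by (intro mult_left_mono) auto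
    then show "nsq (\<lambda>x. \<psi> x * (?P2 (v x) * (pdiff b v x)\<^sup>2)) \<le> 9 * (B * M)\<^sup>2 * S"
      "l2 (\<lambda>x. \<psi> x * (?P2 (v x) * (pdiff b v x)\<^sup>2))"
      using l2_of_bound[OF g(1) m bd] by (auto simp: mult_ac)
  qed
  have T4: "nsq T4 \<le> 9 * n\<^sup>2 * ((B * M)\<^sup>2 * S)" "l2 T4"
  proof -
    have "nsq T4 \<le> n * (\<Sum>b\<in>Basis. nsq (\<lambda>x. \<psi> x * (?P2 (v x) * (pdiff b v x)\<^sup>2)))"
      unfolding T4_def[abs_def] n_def by (intro l2_sum_bound t4) auto
    also have "\<dots> \<le> n * (\<Sum>b\<in>(Basis :: 'a set). 9 * (B * M)\<^sup>2 * S)"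
      using t4(1) n by (intro mult_left_mono sum_mono) auto
    finally show "nsq T4 \<le> 9 * n\<^sup>2 * ((B * M)\<^sup>2 * S)"
      by (simp add: n_def power2_eq_square mult_ac)
    show "l2 T4"
      unfolding T4_def[abs_def] by (intro l2_sum t4) auto
  qed
  have "nsq (\<lambda>x. lap \<phi> x - lap \<psi> x) \<le> 2 * nsq (\<lambda>x. T1 x + T2 x) + 2 * nsq (\<lambda>x. T3 x + T4 x)"
    unfolding eq by (intro nsq_add_le l2_add T1 T2 T3 T4)
  also have "\<dots> \<le> 2 * (2 * nsq T1 + 2 * nsq T2) + 2 * (2 * nsq T3 + 2 * nsq T4)"
    by (intro add_mono mult_left_mono nsq_add_le T1 T2 T3 T4) auto
  also have "\<dots> \<le> Q * S"
  proof -
    define Z where "Z = (B * M)\<^sup>2 * S"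
    define Y where "Y = n\<^sup>2 * Z"
    have T: "nsq T1 \<le> Z" "nsq T2 \<le> 4 * Y" "nsq T3 \<le> Z" "nsq T4 \<le> 9 * Y"
      using T1(1) T2(1) T3(1) T4(1) by (simp_all add: Z_def Y_def mult.assoc)
    have "2 * (2 * nsq T1 + 2 * nsq T2) + 2 * (2 * nsq T3 + 2 * nsq T4) \<le> 2 * (2 * Z + 2 * (4 * Y)) + 2 * (2 * Z + 2 * (9 * Y))"
      by (intro add_mono mult_left_mono T) auto
    also have "\<dots> = Q * S"
      by (simp add: Q_def Z_def Y_def algebra_simps)
    finally show ?thesis .
  qed
  also note S(1)
  finally have L: "nsq (\<lambda>x. lap \<phi> x - lap \<psi> x) < \<delta>" .
  have "(B * M)\<^sup>2 * nsq v \<le> Q * S"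
  proof (rule mult_mono)
    have "(B * M)\<^sup>2 * 1 \<le> (B * M)\<^sup>2 * (4 * (2 + 13 * n\<^sup>2))"
      using n2 by (intro mult_left_mono) auto
    then show "(B * M)\<^sup>2 \<le> Q"
      by (simp add: Q_def algebra_simps)
  qed (use S Q in auto)
  with D0 S(1) L \<phi> show ?thesis
    by (intro bexI[of _ \<phi>]) auto
qed

text \<open>Derivatives of \<eta>(c x) are O(c), so the commutator with the Laplacian tends to 0 in
  norm although w has no decay beyond square integrability of w and \<Delta>w. The multiplied terms
  converge by domination; for this only \<eta>(0) = 1 matters, not that \<eta> is constant near
  0.\<close>

lemma dilated_cutoff:
  fixes w :: "'a::euclidean_space \<Rightarrow> real"
  assumes w: "smooth w" "l2 w" "l2 (lap w)" and \<delta>: "0 < \<delta>"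
  shows "\<exists>\<psi>\<in>testf UNIV. nsq (\<lambda>x. \<psi> x - w x) < \<delta> \<and> nsq (\<lambda>x. lap \<psi> x - lap w x) < \<delta>"
proof -
  define \<eta> :: "'a \<Rightarrow> real" where "\<eta> x = bump 1 x / bump 1 (0 :: 'a)" for x
  have b0: "0 < bump 1 (0 :: 'a)"
    by (rule bump_pos) simp
  have \<eta>: "\<eta> \<in> testf UNIV"
    using testf_mult[OF testf_bump[of 1, where 'a='a] smooth_const, of "1 / bump 1 (0 :: 'a)"] by (simp add: \<eta>_def[abs_def])
  have \<eta>0: "\<eta> 0 = 1"
    using b0 by (simp add: \<eta>_def)
  obtain B where B': "0 < B" "\<forall>x. \<bar>\<eta> x\<bar> \<le> B" "\<forall>b\<in>Basis. \<forall>x. \<bar>pdiff b \<eta> x\<bar> \<le> B"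
    "\<forall>b\<in>Basis. \<forall>c\<in>Basis. \<forall>x. \<bar>pdiff c (pdiff b \<eta>) x\<bar> \<le> B"
    using testf_derivs_bounded[OF \<eta>] by (elim exE conjE) (rule that)
  note B = B'(1) B'(2)[rule_format] B'(3)[rule_format] B'(4)[rule_format]
  define c where "c k = inverse (real (Suc k))" for k
  have c: "0 < c k" "c k \<le> 1" for k
    by (auto simp: c_def divide_simps)
  have c0: "c \<longlonglongrightarrow> 0"
    unfolding c_def by (rule LIMSEQ_inverse_real_of_nat)
  define h where "h k x = \<eta> (c k *\<^sub>R x)" for k x
  have s\<eta>: "smooth \<eta>"
    by (rule testf_smooth[OF \<eta>])
  have sh: "smooth (h k)" for k
    unfolding h_def[abs_def] using smooth_affine[OF s\<eta>, of "c k" 0] by simp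
  obtain C where C: "compact C" "supp_in C \<eta>"
    using \<eta> by (rule testfE)
  have h: "h k \<in> testf UNIV" for k
  proof (rule testfI[OF sh])
    show "compact ((\<lambda>x. inverse (c k) *\<^sub>R x) ` C)"
      by (rule compact_scaling[OF C(1)])
    show "supp_in ((\<lambda>x. inverse (c k) *\<^sub>R x) ` C) (h k)"
      unfolding supp_in_def
    proof (intro allI impI)
      fix x assume x: "x \<notin> (\<lambda>x. inverse (c k) *\<^sub>R x) ` C"
      have "c k *\<^sub>R x \<notin> C"
      proof
        assume "c k *\<^sub>R x \<in> C"
        then have "inverse (c k) *\<^sub>R (c k *\<^sub>R x) \<in> (\<lambda>x. inverse (c k) *\<^sub>R x) ` C"
          by (rule imageI)
        with x c(1)[of k] show False
          by simp
      qed
      then show "h k x = 0"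
        using C(2) by (simp add: supp_in_def h_def)
    qed
  qed simp
  have ph: "pdiff b (h k) = (\<lambda>x. c k * pdiff b \<eta> (c k *\<^sub>R x))" for b k
    unfolding h_def[abs_def] using pdiff_affine[of \<eta> "c k" _ 0 b] smooth_differentiable[OF s\<eta>] by auto
  have pph: "pdiff b' (pdiff b (h k)) = (\<lambda>x. c k * (c k * pdiff b' (pdiff b \<eta>) (c k *\<^sub>R x)))" if b: "b \<in> Basis" for b b' k
  proof
    fix x
    note sb = smooth_pdiff[OF s\<eta> b]
    have "smooth (\<lambda>x. pdiff b \<eta> (c k *\<^sub>R x))"
      using smooth_affine[OF sb, of "c k" 0] by simp
    then have "pdiff b' (\<lambda>x. c k * pdiff b \<eta> (c k *\<^sub>R x)) x = c k * pdiff b' (\<lambda>x. pdiff b \<eta> (c k *\<^sub>R x)) x"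
      by (intro pdiff_compose_linear bounded_linear_mult_right smooth_differentiable)
    also have "pdiff b' (\<lambda>x. pdiff b \<eta> (c k *\<^sub>R x)) x = c k * pdiff b' (pdiff b \<eta>) (c k *\<^sub>R x)"
      using pdiff_affine[of "pdiff b \<eta>" "c k" x 0 b'] smooth_differentiable[OF sb] by simp
    finally show "pdiff b' (pdiff b (h k)) x = c k * (c k * pdiff b' (pdiff b \<eta>) (c k *\<^sub>R x))"
      unfolding ph .
  qed
  have e1: "\<bar>pdiff b (h k) x\<bar> \<le> c k * B" if "b \<in> Basis" for b k x
    using B(3)[OF that] c(1)[of k] unfolding ph by (simp add: abs_mult)
  \<comment> \<open>Second derivatives scale like c^2, which is at most c because c \<le> 1; one
    bound then serves both orders.\<close>
  have e2: "\<bar>pdiff b' (pdiff b (h k)) x\<bar> \<le> c k * B" if b: "b \<in> Basis" "b' \<in> Basis" for b b' k x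
  proof -
    have "c k * \<bar>pdiff b' (pdiff b \<eta>) (c k *\<^sub>R x)\<bar> \<le> 1 * B"
      using B(4)[OF b] c[of k] by (intro mult_mono) auto
    then show ?thesis
      using c(1)[of k] unfolding pph[OF b(1)] by (simp add: abs_mult)
  qed
  define A where "A = 10 * (real DIM('a))\<^sup>2 * (1 + 4 * real DIM('a))"
  have com: "l2 (\<lambda>x. lap (\<lambda>y. h k y * w y) x - h k x * lap w x)"
    "nsq (\<lambda>x. lap (\<lambda>y. h k y * w y) x - h k x * lap w x) \<le> A * (c k * B)\<^sup>2 * (nsq w + nsq (lap w))" for k
    unfolding A_def by (rule lap_commutator[OF h w e1 e2]; assumption)+
  have hlim: "(\<lambda>k. nsq (\<lambda>x. h k x * g x - g x)) \<longlonglongrightarrow> 0" if g: "l2 g" for g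
  proof (rule nsq_tendsto_dominated[OF _ g, where w="\<lambda>x. (B + 1) * \<bar>g x\<bar>"])
    show "(\<lambda>x. h k x * g x) \<in> borel_measurable borel" for k
      using smooth_measurable[OF sh] l2_measurable[OF g] by simp
    show "l2 (\<lambda>x. (B + 1) * \<bar>g x\<bar>)"
      using g by (intro l2_cmult) (auto simp: l2_def)
    show "AE x in lborel. (\<lambda>k. h k x * g x) \<longlonglongrightarrow> g x"
    proof (rule AE_I2)
      fix x :: 'a
      have "(\<lambda>k. c k *\<^sub>R x) \<longlonglongrightarrow> 0 *\<^sub>R x"
        by (intro tendsto_intros c0)
      then have "(\<lambda>k. h k x) \<longlonglongrightarrow> \<eta> 0"
        unfolding h_def using continuous_on_tendsto_compose[OF smooth_continuous[OF s\<eta>, of UNIV]] by simp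
      from tendsto_mult_right[OF this, of "g x"] show "(\<lambda>k. h k x * g x) \<longlonglongrightarrow> g x"
        by (simp add: \<eta>0)
    qed
    show "AE x in lborel. \<bar>h k x * g x - g x\<bar> \<le> (B + 1) * \<bar>g x\<bar>" for k
    proof (rule AE_I2)
      fix x
      have "\<bar>h k x * g x - g x\<bar> = \<bar>h k x - 1\<bar> * \<bar>g x\<bar>"
        by (simp add: abs_mult[symmetric] algebra_simps)
      also have "\<dots> \<le> (B + 1) * \<bar>g x\<bar>"
        using B(2)[of "c k *\<^sub>R x"] by (intro mult_right_mono) (auto simp: h_def)
      finally show "\<bar>h k x * g x - g x\<bar> \<le> (B + 1) * \<bar>g x\<bar>" .
    qed
  qed
  have comlim: "(\<lambda>k. nsq (\<lambda>x. lap (\<lambda>y. h k y * w y) x - h k x * lap w x)) \<longlonglongrightarrow> 0"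
  proof (rule tendsto_sandwich[OF _ _ tendsto_const])
    have "(\<lambda>k. A * (c k * B)\<^sup>2 * (nsq w + nsq (lap w))) \<longlonglongrightarrow> A * (0 * B)\<^sup>2 * (nsq w + nsq (lap w))"
      by (intro tendsto_intros c0)
    then show "(\<lambda>k. A * (c k * B)\<^sup>2 * (nsq w + nsq (lap w))) \<longlonglongrightarrow> 0"
      by simp
  qed (use com(2) in auto)
  have d4: "0 < \<delta> / 4"
    using \<delta> by simp
  have "\<forall>\<^sub>F k in sequentially. nsq (\<lambda>x. h k x * w x - w x) < \<delta> / 4 \<and>
      nsq (\<lambda>x. h k x * lap w x - lap w x) < \<delta> / 4 \<and>
      nsq (\<lambda>x. lap (\<lambda>y. h k y * w y) x - h k x * lap w x) < \<delta> / 4"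
    using order_tendstoD(2)[OF hlim[OF w(2)] d4] order_tendstoD(2)[OF hlim[OF w(3)] d4]
      order_tendstoD(2)[OF comlim d4] by eventually_elim blast
  then obtain k where k: "nsq (\<lambda>x. h k x * w x - w x) < \<delta> / 4" "nsq (\<lambda>x. h k x * lap w x - lap w x) < \<delta> / 4"
      "nsq (\<lambda>x. lap (\<lambda>y. h k y * w y) x - h k x * lap w x) < \<delta> / 4"
    using eventually_happens'[OF sequentially_bot] by blast
  have hl: "l2 (\<lambda>x. h k x * lap w x)"
    by (rule l2_testf[of _ UNIV]) (intro testf_mult h smooth_lap w)
  have "nsq (\<lambda>x. (lap (\<lambda>y. h k y * w y) x - h k x * lap w x) + (h k x * lap w x - lap w x))
      \<le> 2 * nsq (\<lambda>x. lap (\<lambda>y. h k y * w y) x - h k x * lap w x) + 2 * nsq (\<lambda>x. h k x * lap w x - lap w x)"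
    by (intro nsq_add_le com l2_diff hl w)
  then have "nsq (\<lambda>x. lap (\<lambda>y. h k y * w y) x - lap w x) < \<delta>"
    using k by simp
  moreover have "nsq (\<lambda>x. h k x * w x - w x) < \<delta>"
    using k(1) \<delta> by simp
  moreover have "(\<lambda>x. h k x * w x) \<in> testf UNIV"
    by (intro testf_mult h w)
  ultimately show ?thesis
    by (intro bexI[of _ "\<lambda>x. h k x * w x"]) auto
qed

text \<open>Splitting off the first difference doubles it and quadruples the other two: 2 + 4 + 4 =
  10.\<close>

lemma nsq_triangle3:
  assumes "l2 a" "l2 b" "l2 c" "l2 d" "nsq (\<lambda>x. a x - b x) < e" "nsq (\<lambda>x. b x - c x) < e" "nsq (\<lambda>x. c x - d x) < e"
  shows "nsq (\<lambda>x. a x - d x) < 10 * e"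
proof -
  have "nsq (\<lambda>x. (a x - b x) + ((b x - c x) + (c x - d x)))
      \<le> 2 * nsq (\<lambda>x. a x - b x) + 2 * nsq (\<lambda>x. (b x - c x) + (c x - d x))"
    by (intro nsq_add_le l2_add l2_diff assms)
  moreover have "nsq (\<lambda>x. (b x - c x) + (c x - d x)) \<le> 2 * nsq (\<lambda>x. b x - c x) + 2 * nsq (\<lambda>x. c x - d x)"
    by (intro nsq_add_le l2_diff assms)
  ultimately have "nsq (\<lambda>x. (a x - b x) + ((b x - c x) + (c x - d x))) < 10 * e"
    using assms(5-7) by linarith
  then show ?thesis
    by simp
qed

text \<open>The weak equation must first be extended to test functions on the whole space, because
  mollifying g at a point near K tests the equation with kernels that overlap K. Afterwards three
  approximations are chained: mollification gives smoothness, dilation gives compact support, and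
  removal clears a neighbourhood of K.\<close>

lemma graph_core:
  fixes K :: "'a::euclidean_space set"
  assumes K: "compact K" and cap: "bessel_capacity2 2 K = 0" and g: "l2 g" "l2 f"
    and weak: "\<And>\<phi>. \<phi> \<in> testf (- K) \<Longrightarrow> (\<integral>x. g x * lap \<phi> x \<partial>lborel) = (\<integral>x. f x * \<phi> x \<partial>lborel)"
    and \<delta>: "0 < \<delta>"
  shows "\<exists>\<phi>\<in>testf (- K). nsq (\<lambda>x. \<phi> x - g x) < \<delta> \<and> nsq (\<lambda>x. lap \<phi> x - f x) < \<delta>"
proof -
  \<comment> \<open>Both sides are continuous in \<psi> for the graph norm, so approximation by test
    functions that avoid K carries the equation over.\<close>
  have weak': "(\<integral>x. g x * lap \<psi> x \<partial>lborel) = (\<integral>x. f x * \<psi> x \<partial>lborel)" if \<psi>: "\<psi> \<in> testf UNIV" for \<psi>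
  proof -
    have "\<exists>\<phi>\<in>testf (- K). nsq (\<lambda>x. \<phi> x - \<psi> x) < inverse (real (Suc n)) \<and> nsq (\<lambda>x. lap \<phi> x - lap \<psi> x) < inverse (real (Suc n))" for n
      by (rule removal[OF K cap \<psi>]) simp
    then obtain \<phi> where \<phi>: "\<And>n. \<phi> n \<in> testf (- K)" "\<And>n. nsq (\<lambda>x. \<phi> n x - \<psi> x) < inverse (real (Suc n))"
      "\<And>n. nsq (\<lambda>x. lap (\<phi> n) x - lap \<psi> x) < inverse (real (Suc n))"
      by metis
    have l0: "X \<longlonglongrightarrow> 0" if X: "\<And>n. 0 \<le> X n" "\<And>n. X n < inverse (real (Suc n))" for X :: "nat \<Rightarrow> real"
    proof (rule tendsto_sandwich[OF _ _ tendsto_const LIMSEQ_inverse_real_of_nat])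
      show "\<forall>\<^sub>F n in sequentially. 0 \<le> X n"
        by (intro always_eventually allI X)
      show "\<forall>\<^sub>F n in sequentially. X n \<le> inverse (real (Suc n))"
        by (intro always_eventually allI less_imp_le X)
    qed
    note l = l0[OF nsq_nonneg \<phi>(2)] l0[OF nsq_nonneg \<phi>(3)]
    have "(\<lambda>n. \<integral>x. \<phi> n x * f x \<partial>lborel) \<longlonglongrightarrow> (\<integral>x. \<psi> x * f x \<partial>lborel)"
      by (rule l2_tendsto_inner[OF l2_testf[OF \<phi>(1)] l2_testf[OF \<psi>] g(2) l(1)])
    moreover have "(\<lambda>n. \<integral>x. lap (\<phi> n) x * g x \<partial>lborel) \<longlonglongrightarrow> (\<integral>x. lap \<psi> x * g x \<partial>lborel)"
      by (rule l2_tendsto_inner[OF l2_testf[OF testf_lap[OF \<phi>(1)]] l2_testf[OF testf_lap[OF \<psi>]] g(1) l(2)])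
    moreover have "(\<integral>x. lap (\<phi> n) x * g x \<partial>lborel) = (\<integral>x. \<phi> n x * f x \<partial>lborel)" for n
      using weak[OF \<phi>(1)] by (simp add: mult.commute)
    ultimately have "(\<integral>x. lap \<psi> x * g x \<partial>lborel) = (\<integral>x. \<psi> x * f x \<partial>lborel)"
      using LIMSEQ_unique by simp
    then show ?thesis
      by (simp add: mult.commute)
  qed
  \<comment> \<open>Three steps of size e add up to less than 10 e in squared norm.\<close>
  define e where "e = \<delta> / 10"
  have e: "0 < e"
    using \<delta> by (simp add: e_def)
  obtain d1 where d1: "0 < d1" "\<And>r. 0 < r \<Longrightarrow> r < d1 \<Longrightarrow> nsq (\<lambda>x. conv g (moll r) x - g x) < e"
    using conv_moll_l2_tendsto[OF g(1) e] by blast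
  obtain d2 where d2: "0 < d2" "\<And>r. 0 < r \<Longrightarrow> r < d2 \<Longrightarrow> nsq (\<lambda>x. conv f (moll r) x - f x) < e"
    using conv_moll_l2_tendsto[OF g(2) e] by blast
  define r where "r = min d1 d2 / 2"
  have r: "0 < r" "r < d1" "r < d2"
    using d1(1) d2(1) by (auto simp: r_def)
  define w where "w = conv g (moll r)"
  have lw: "lap w = conv f (moll r)"
    unfolding w_def by (rule lap_conv_weak[OF g(1) moll(1)[OF r(1)] weak'])
  have w: "smooth w" "l2 w" "l2 (lap w)"
    unfolding lw unfolding w_def using smooth_conv[OF g(1) moll(1)[OF r(1)]] conv_moll_l2(1)[OF _ r(1)] g by auto
  have w1: "nsq (\<lambda>x. w x - g x) < e" "nsq (\<lambda>x. lap w x - f x) < e"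
    unfolding lw unfolding w_def using d1(2)[OF r(1,2)] d2(2)[OF r(1,3)] by auto
  obtain \<psi> where \<psi>: "\<psi> \<in> testf UNIV" "nsq (\<lambda>x. \<psi> x - w x) < e" "nsq (\<lambda>x. lap \<psi> x - lap w x) < e"
    using dilated_cutoff[OF w e] by blast
  obtain \<phi> where \<phi>: "\<phi> \<in> testf (- K)" "nsq (\<lambda>x. \<phi> x - \<psi> x) < e" "nsq (\<lambda>x. lap \<phi> x - lap \<psi> x) < e"
    using removal[OF K cap \<psi>(1) e] by blast
  have "nsq (\<lambda>x. \<phi> x - g x) < 10 * e"
    by (rule nsq_triangle3[OF l2_testf[OF \<phi>(1)] l2_testf[OF \<psi>(1)] w(2) g(1) \<phi>(2) \<psi>(2) w1(1)])
  moreover have "nsq (\<lambda>x. lap \<phi> x - f x) < 10 * e"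
    by (rule nsq_triangle3[OF l2_testf[OF testf_lap[OF \<phi>(1)]] l2_testf[OF testf_lap[OF \<psi>(1)]] w(3) g(2) \<phi>(3) \<psi>(3) w1(2)])
  ultimately show ?thesis
    using \<phi>(1) by (intro bexI[of _ \<phi>]) (auto simp: e_def)
qed

section \<open>Real and imaginary parts of \<open>L\<^sup>2(\<Omega>)\<close>\<close>

text \<open>The indicator discards the meaningless values outside \<Omega> and extends by zero, so
  that the real theory on the whole space applies.\<close>

definition rp :: "'a::euclidean_space set \<Rightarrow> ('a \<Rightarrow> complex) \<Rightarrow> 'a \<Rightarrow> real" where
  "rp \<Omega> f = (\<lambda>x. indicator \<Omega> x * Re (f x))"

definition ip :: "'a::euclidean_space set \<Rightarrow> ('a \<Rightarrow> complex) \<Rightarrow> 'a \<Rightarrow> real" where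
  "ip \<Omega> f = (\<lambda>x. indicator \<Omega> x * Im (f x))"

lemma L2_rp_ip:
  assumes \<Omega>: "\<Omega> \<in> sets borel" and f: "f \<in> L2 (lebesgue_measure_on \<Omega>)"
  shows "l2 (rp \<Omega> f)" "l2 (ip \<Omega> f)"
proof -
  have m: "(\<lambda>x. indicator \<Omega> x *\<^sub>R f x) \<in> borel_measurable lborel"
    using f \<Omega> unfolding L2_def lebesgue_measure_on_def
    by (subst borel_measurable_restrict_space_iff[symmetric]) auto
  have int: "integrable lborel (\<lambda>x. indicator \<Omega> x *\<^sub>R (cmod (f x))\<^sup>2)"
    using f \<Omega> unfolding L2_def lebesgue_measure_on_def
    by (subst integrable_restrict_space[symmetric]) auto
  have rp: "rp \<Omega> f = (\<lambda>x. Re (indicator \<Omega> x *\<^sub>R f x))" and ip: "ip \<Omega> f = (\<lambda>x. Im (indicator \<Omega> x *\<^sub>R f x))"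
    by (simp_all add: rp_def ip_def)
  show "l2 (rp \<Omega> f)"
  proof (rule l2_bound[OF int])
    show "rp \<Omega> f \<in> borel_measurable borel"
      using measurable_compose[OF m borel_measurable_continuous_onI[OF linear_continuous_on[OF bounded_linear_Re]]]
      unfolding rp by simp
    show "AE x in lborel. (rp \<Omega> f x)\<^sup>2 \<le> indicator \<Omega> x *\<^sub>R (cmod (f x))\<^sup>2"
      by (intro AE_I2) (simp add: rp_def indicator_def cmod_power2)
  qed
  show "l2 (ip \<Omega> f)"
  proof (rule l2_bound[OF int])
    show "ip \<Omega> f \<in> borel_measurable borel"
      using measurable_compose[OF m borel_measurable_continuous_onI[OF linear_continuous_on[OF bounded_linear_Im]]]
      unfolding ip by simp
    show "AE x in lborel. (ip \<Omega> f x)\<^sup>2 \<le> indicator \<Omega> x *\<^sub>R (cmod (f x))\<^sup>2"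
      by (intro AE_I2) (simp add: ip_def indicator_def cmod_power2)
  qed
qed

lemma L2_Complex:
  assumes \<Omega>: "\<Omega> \<in> sets borel" and pq: "l2 p" "l2 q"
  shows "(\<lambda>x. Complex (p x) (q x)) \<in> L2 (lebesgue_measure_on \<Omega>)"
proof -
  have [measurable]: "p \<in> borel_measurable borel" "q \<in> borel_measurable borel"
    using pq by (auto intro: l2_measurable)
  have "(\<lambda>x. Complex (p x) (q x)) \<in> borel_measurable lborel"
    unfolding Complex_eq by measurable
  then have m: "(\<lambda>x. Complex (p x) (q x)) \<in> borel_measurable (lebesgue_measure_on \<Omega>)"
    unfolding lebesgue_measure_on_def by (rule measurable_restrict_space1)
  have "integrable lborel (\<lambda>x. (p x)\<^sup>2 + (q x)\<^sup>2)"
    using pq by (simp add: l2_def)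
  then have "integrable lborel (\<lambda>x. indicator \<Omega> x *\<^sub>R ((p x)\<^sup>2 + (q x)\<^sup>2))"
    using \<Omega> by (intro integrable_mult_indicator) auto
  then have "integrable (lebesgue_measure_on \<Omega>) (\<lambda>x. (cmod (Complex (p x) (q x)))\<^sup>2)"
    unfolding lebesgue_measure_on_def using \<Omega> by (subst integrable_restrict_space) (auto simp: cmod_power2)
  with m show ?thesis
    by (simp add: L2_def)
qed

lemma rp_ip_Complex:
  assumes "supp_in \<Omega> p" "supp_in \<Omega> q"
  shows "rp \<Omega> (\<lambda>x. Complex (p x) (q x)) = p" "ip \<Omega> (\<lambda>x. Complex (p x) (q x)) = q"
  using assms by (auto simp: rp_def ip_def supp_in_def indicator_def fun_eq_iff)

lemma supp_in_rp_ip: "supp_in \<Omega> (rp \<Omega> f)" "supp_in \<Omega> (ip \<Omega> f)"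
  by (simp_all add: supp_in_def rp_def ip_def)

lemma L2_norm_rp_ip:
  assumes \<Omega>: "\<Omega> \<in> sets borel" and f: "f \<in> L2 (lebesgue_measure_on \<Omega>)"
  shows "L2_norm (lebesgue_measure_on \<Omega>) f = sqrt (nsq (rp \<Omega> f) + nsq (ip \<Omega> f))"
proof -
  have "(\<integral>x. (cmod (f x))\<^sup>2 \<partial>lebesgue_measure_on \<Omega>) = (\<integral>x. indicator \<Omega> x *\<^sub>R (cmod (f x))\<^sup>2 \<partial>lborel)"
    unfolding lebesgue_measure_on_def using \<Omega> by (intro integral_restrict_space) auto
  also have "\<dots> = (\<integral>x. (rp \<Omega> f x)\<^sup>2 + (ip \<Omega> f x)\<^sup>2 \<partial>lborel)"
    by (intro Bochner_Integration.integral_cong) (auto simp: rp_def ip_def indicator_def cmod_power2)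
  also have "\<dots> = nsq (rp \<Omega> f) + nsq (ip \<Omega> f)"
    using L2_rp_ip[OF \<Omega> f] by (simp add: nsq_def l2_def)
  finally show ?thesis
    by (simp add: L2_norm_def)
qed

definition ri :: "('a::euclidean_space \<Rightarrow> real) \<Rightarrow> ('a \<Rightarrow> real) \<Rightarrow> real" where
  "ri f g = (\<integral>x. f x * g x \<partial>lborel)"

lemma L2_inner_integrable:
  assumes "f \<in> L2 M" "g \<in> L2 M"
  shows "integrable M (\<lambda>x. f x * cnj (g x))"
proof (rule Bochner_Integration.integrable_bound)
  show "integrable M (\<lambda>x. (cmod (f x))\<^sup>2 + (cmod (g x))\<^sup>2)"
    using assms by (simp add: L2_def)
  have [measurable]: "f \<in> borel_measurable M" "g \<in> borel_measurable M"
    using assms by (auto simp: L2_def)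
  have "(\<lambda>x. cnj (g x)) \<in> borel_measurable M"
    by (rule measurable_compose[OF \<open>g \<in> borel_measurable M\<close> borel_measurable_continuous_onI])
       (intro continuous_intros)
  then show "(\<lambda>x. f x * cnj (g x)) \<in> borel_measurable M"
    by (intro borel_measurable_times \<open>f \<in> borel_measurable M\<close>)
  have "a * b \<le> a\<^sup>2 + b\<^sup>2" if "0 \<le> a" "0 \<le> b" for a b :: real
    using sum_squares_bound[of a b] mult_nonneg_nonneg[OF that] by linarith
  then show "AE x in M. norm (f x * cnj (g x)) \<le> norm ((cmod (f x))\<^sup>2 + (cmod (g x))\<^sup>2)"
    by (simp add: norm_mult)
qed

lemma L2_inner_rp_ip:
  assumes \<Omega>: "\<Omega> \<in> sets borel" and f: "f \<in> L2 (lebesgue_measure_on \<Omega>)" and g: "g \<in> L2 (lebesgue_measure_on \<Omega>)"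
  shows "L2_inner (lebesgue_measure_on \<Omega>) f g = Complex (ri (rp \<Omega> f) (rp \<Omega> g) + ri (ip \<Omega> f) (ip \<Omega> g))
    (ri (ip \<Omega> f) (rp \<Omega> g) - ri (rp \<Omega> f) (ip \<Omega> g))"
proof -
  note l = L2_rp_ip[OF \<Omega> f] L2_rp_ip[OF \<Omega> g]
  have eq: "indicator \<Omega> x *\<^sub>R (f x * cnj (g x)) = Complex (rp \<Omega> f x * rp \<Omega> g x + ip \<Omega> f x * ip \<Omega> g x)
      (ip \<Omega> f x * rp \<Omega> g x - rp \<Omega> f x * ip \<Omega> g x)" for x
    by (simp add: rp_def ip_def indicator_def complex_eq_iff)
  have int: "integrable lborel (\<lambda>x. indicator \<Omega> x *\<^sub>R (f x * cnj (g x)))"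
    using L2_inner_integrable[OF f g] \<Omega> unfolding lebesgue_measure_on_def
    by (subst (asm) integrable_restrict_space) auto
  have "L2_inner (lebesgue_measure_on \<Omega>) f g = (\<integral>x. indicator \<Omega> x *\<^sub>R (f x * cnj (g x)) \<partial>lborel)"
    unfolding L2_inner_def lebesgue_measure_on_def using \<Omega> by (intro integral_restrict_space) auto
  moreover have "Re (\<integral>x. indicator \<Omega> x *\<^sub>R (f x * cnj (g x)) \<partial>lborel)
      = (\<integral>x. rp \<Omega> f x * rp \<Omega> g x + ip \<Omega> f x * ip \<Omega> g x \<partial>lborel)"
    by (subst integral_Re[OF int, symmetric]) (simp only: eq complex.sel)
  moreover have "Im (\<integral>x. indicator \<Omega> x *\<^sub>R (f x * cnj (g x)) \<partial>lborel)
      = (\<integral>x. ip \<Omega> f x * rp \<Omega> g x - rp \<Omega> f x * ip \<Omega> g x \<partial>lborel)"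
    by (subst integral_Im[OF int, symmetric]) (simp only: eq complex.sel)
  ultimately show ?thesis
    by (simp add: complex_eq_iff ri_def l2_mult_integrable l)
qed

lemma L2_add: 
  assumes "f \<in> L2 M" "g \<in> L2 M"
  shows "(\<lambda>x. f x + g x) \<in> L2 M"
proof -
  have m: "f \<in> borel_measurable M" "g \<in> borel_measurable M"
    using assms by (auto simp: L2_def)
  have "integrable M (\<lambda>x. (cmod (f x + g x))\<^sup>2)"
  proof (rule Bochner_Integration.integrable_bound)
    show "integrable M (\<lambda>x. 2 * (cmod (f x))\<^sup>2 + 2 * (cmod (g x))\<^sup>2)"
      using assms by (simp add: L2_def)
    have "(cmod (a + b))\<^sup>2 \<le> 2 * (cmod a)\<^sup>2 + 2 * (cmod b)\<^sup>2" for a b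
      using power_mono[OF norm_triangle_ineq[of a b] norm_ge_zero, of 2] sum_squared_le[of "cmod a" "cmod b"]
      by linarith
    then show "AE x in M. norm ((cmod (f x + g x))\<^sup>2) \<le> norm (2 * (cmod (f x))\<^sup>2 + 2 * (cmod (g x))\<^sup>2)"
      by (simp add: abs_of_nonneg)
  qed (use m in measurable)
  with m show ?thesis
    by (simp add: L2_def)
qed

lemma L2_cmult: "f \<in> L2 M \<Longrightarrow> (\<lambda>x. c * f x) \<in> L2 M"
  by (auto simp: L2_def norm_mult power_mult_distrib)

lemma L2_inner_add_right:
  assumes "f \<in> L2 M" "g \<in> L2 M" "h \<in> L2 M"
  shows "L2_inner M f (\<lambda>x. g x + h x) = L2_inner M f g + L2_inner M f h"
  using L2_inner_integrable[OF assms(1,2)] L2_inner_integrable[OF assms(1,3)]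
  by (simp add: L2_inner_def distrib_left)

lemma L2_inner_cmult_right: "L2_inner M f (\<lambda>x. c * g x) = cnj c * L2_inner M f g"
proof -
  have "(\<lambda>x. f x * cnj (c * g x)) = (\<lambda>x. cnj c * (f x * cnj (g x)))"
    by (auto simp: mult_ac)
  then show ?thesis
    unfolding L2_inner_def by (simp only: integral_mult_right_zero)
qed

lemma L2_inner_cong_right:
  assumes "f \<in> L2 M" "g \<in> L2 M" "h \<in> L2 M" "L2_eq M g h"
  shows "L2_inner M f g = L2_inner M f h"
  unfolding L2_inner_def
  by (rule integral_cong_AE)
     (use assms L2_inner_integrable[OF assms(1,2)] L2_inner_integrable[OF assms(1,3)]
       in \<open>auto simp: L2_eq_def elim: eventually_mono\<close>)

section \<open>Adjoints\<close>

lemma adjoint_antimono: "S \<subseteq> T \<Longrightarrow> adjoint_operator M T \<subseteq> adjoint_operator M S"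
  unfolding adjoint_operator_def by blast

lemma adjoint_operatorD:
  assumes "(g, v) \<in> adjoint_operator M S"
  shows "g \<in> L2 M" "v \<in> L2 M" "(f, u) \<in> S \<Longrightarrow> L2_inner M u g = L2_inner M f v"
  using assms unfolding adjoint_operator_def by blast+

lemma adjoint_operatorI:
  assumes "g \<in> L2 M" "v \<in> L2 M" "\<And>f u. (f, u) \<in> S \<Longrightarrow> L2_inner M u g = L2_inner M f v"
  shows "(g, v) \<in> adjoint_operator M S"
  using assms unfolding adjoint_operator_def by blast

text \<open>Apart from single-valuedness, every clause is inherited from sesquilinearity of the
  inner product. Single-valuedness depends on density of the domain and is left as a
  premise.\<close>

lemma linear_adjoint:
  assumes S: "S \<subseteq> L2 M \<times> L2 M"
    and sv: "\<And>f u v. (f, u) \<in> adjoint_operator M S \<Longrightarrow> (f, v) \<in> adjoint_operator M S \<Longrightarrow> L2_eq M u v"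
  shows "linear_operator M (adjoint_operator M S)"
proof -
  let ?A = "adjoint_operator M S"
  have SL: "f \<in> L2 M" "u \<in> L2 M" if "(f, u) \<in> S" for f u
    using S that by auto
  have zero: "(\<lambda>x. 0) \<in> L2 M"
    by (simp add: L2_def)
  have 1: "?A \<subseteq> L2 M \<times> L2 M"
    unfolding adjoint_operator_def by blast
  have 2: "((\<lambda>_. 0), (\<lambda>_. 0)) \<in> ?A"
    by (rule adjoint_operatorI[OF zero zero]) (simp add: L2_inner_def)
  have 3: "((\<lambda>x. f x + g x), (\<lambda>x. u x + v x)) \<in> ?A" if fu: "(f, u) \<in> ?A" and gv: "(g, v) \<in> ?A" for f u g v
  proof -
    note d = adjoint_operatorD[OF fu] adjoint_operatorD[OF gv]
    show ?thesis
    proof (rule adjoint_operatorI)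
      fix p q assume pq: "(p, q) \<in> S"
      show "L2_inner M q (\<lambda>x. f x + g x) = L2_inner M p (\<lambda>x. u x + v x)"
        using d(3)[OF pq] d(6)[OF pq] d(1,2,4,5) SL[OF pq] by (simp add: L2_inner_add_right)
    qed (intro L2_add d)+
  qed
  have 4: "((\<lambda>x. c * f x), (\<lambda>x. c * u x)) \<in> ?A" if fu: "(f, u) \<in> ?A" for f u c
  proof -
    note d = adjoint_operatorD[OF fu]
    show ?thesis
      by (rule adjoint_operatorI) (simp_all add: L2_cmult d L2_inner_cmult_right)
  qed
  have 5: "(g, v) \<in> ?A" if fu: "(f, u) \<in> ?A" and gv: "g \<in> L2 M" "v \<in> L2 M" "L2_eq M f g" "L2_eq M u v" for f u g v
  proof -
    note d = adjoint_operatorD[OF fu]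
    show ?thesis
    proof (rule adjoint_operatorI[OF gv(1,2)])
      fix p q assume pq: "(p, q) \<in> S"
      show "L2_inner M q g = L2_inner M p v"
        using d(3)[OF pq] L2_inner_cong_right[OF SL(2)[OF pq] d(1) gv(1,3)]
          L2_inner_cong_right[OF SL(1)[OF pq] d(2) gv(2,4)] by simp
    qed
  qed
  show ?thesis
    unfolding linear_operator_def
  proof (intro conjI)
    show "\<forall>(f, u)\<in>?A. \<forall>(g, v)\<in>?A. ((\<lambda>x. f x + g x), (\<lambda>x. u x + v x)) \<in> ?A"
      by clarify (rule 3)
    show "\<forall>(f, u)\<in>?A. \<forall>c. ((\<lambda>x. c * f x), (\<lambda>x. c * u x)) \<in> ?A"
      by clarify (rule 4)
    show "\<forall>(f, u)\<in>?A. \<forall>g\<in>L2 M. \<forall>v\<in>L2 M. L2_eq M f g \<and> L2_eq M u v \<longrightarrow> (g, v) \<in> ?A"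
      by clarify (rule 5)
    show "\<forall>f u v. (f, u) \<in> ?A \<and> (f, v) \<in> ?A \<longrightarrow> L2_eq M u v"
      using sv by blast
  qed (rule 1 2)+
qed

section \<open>Complex test functions\<close>

lemma partial_eq_pdiff: "partial b f = pdiff b f"
  by (simp add: partial_def pdiff_def)

lemma C_order_eq_Ck: "C_order k f = Ck k f"
  by (induction k arbitrary: f) (auto simp: partial_eq_pdiff)

lemma bounded_linear_imaginary: "bounded_linear (\<lambda>t. \<i> * complex_of_real t)"
  by (rule bounded_linear_compose[OF bounded_linear_mult_right bounded_linear_of_real])

lemma smooth_Complex: "smooth p \<Longrightarrow> smooth q \<Longrightarrow> smooth (\<lambda>x. Complex (p x) (q x))"
  unfolding Complex_eq
  by (intro smooth_add smooth_compose_linear[OF bounded_linear_of_real] smooth_compose_linear[OF bounded_linear_imaginary])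

lemma pdiff_Complex:
  assumes "smooth p" "smooth q"
  shows "pdiff b (\<lambda>x. Complex (p x) (q x)) = (\<lambda>x. Complex (pdiff b p x) (pdiff b q x))"
proof
  fix x
  have "pdiff b (\<lambda>x. complex_of_real (p x) + \<i> * complex_of_real (q x)) x
      = pdiff b (\<lambda>x. complex_of_real (p x)) x + pdiff b (\<lambda>x. \<i> * complex_of_real (q x)) x"
    by (rule pdiff_add) (rule smooth_differentiable, rule smooth_compose_linear[OF bounded_linear_of_real] smooth_compose_linear[OF bounded_linear_imaginary], rule assms)+
  also have "pdiff b (\<lambda>x. complex_of_real (p x)) x = complex_of_real (pdiff b p x)"
    by (rule pdiff_compose_linear[OF bounded_linear_of_real smooth_differentiable[OF assms(1)]])
  also have "pdiff b (\<lambda>x. \<i> * complex_of_real (q x)) x = \<i> * complex_of_real (pdiff b q x)"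
    by (rule pdiff_compose_linear[OF bounded_linear_imaginary smooth_differentiable[OF assms(2)]])
  finally show "pdiff b (\<lambda>x. Complex (p x) (q x)) x = Complex (pdiff b p x) (pdiff b q x)"
    by (simp add: Complex_eq)
qed

lemma laplacian_Complex:
  assumes "smooth p" "smooth q"
  shows "laplacian (\<lambda>x. Complex (p x) (q x)) = (\<lambda>x. Complex (lap p x) (lap q x))"
proof
  fix x
  have "laplacian (\<lambda>x. Complex (p x) (q x)) x
      = (\<Sum>b\<in>Basis. Complex (pdiff b (pdiff b p) x) (pdiff b (pdiff b q) x))"
    unfolding laplacian_def partial_eq_pdiff
    by (intro sum.cong refl) (simp add: pdiff_Complex assms smooth_pdiff)
  then show "laplacian (\<lambda>x. Complex (p x) (q x)) x = Complex (lap p x) (lap q x)"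
    by (simp add: lap_def complex_eq_iff Re_sum Im_sum)
qed

lemma test_functions_Complex:
  assumes p: "p \<in> testf \<Omega>" and q: "q \<in> testf \<Omega>"
  shows "(\<lambda>x. Complex (p x) (q x)) \<in> test_functions \<Omega>"
proof -
  obtain C where C: "compact C" "C \<subseteq> \<Omega>" "supp_in C p"
    using p by (rule testfE)
  obtain D where D: "compact D" "D \<subseteq> \<Omega>" "supp_in D q"
    using q by (rule testfE)
  have CD: "compact (C \<union> D)"
    using C D by (intro compact_Un)
  have "{x. Complex (p x) (q x) \<noteq> 0} \<subseteq> C \<union> D"
    using C(3) D(3) by (auto simp: supp_in_def complex_eq_iff)
  then have cl: "closure {x. Complex (p x) (q x) \<noteq> 0} \<subseteq> C \<union> D"
    using CD by (intro closure_minimal compact_imp_closed)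
  then have "closure {x. Complex (p x) (q x) \<noteq> 0} \<subseteq> \<Omega>"
    using C(2) D(2) by blast
  moreover have "compact (closure {x. Complex (p x) (q x) \<noteq> 0})"
    using compact_Int_closed[OF CD closed_closure, of "{x. Complex (p x) (q x) \<noteq> 0}"] cl
    by (simp add: Int_absorb1)
  moreover have "smooth (\<lambda>x. Complex (p x) (q x))"
    using p q by (intro smooth_Complex testf_smooth)
  ultimately show ?thesis
    by (simp add: test_functions_def C_order_eq_Ck smooth_def)
qed

lemma test_functions_Re_Im:
  assumes \<phi>: "\<phi> \<in> test_functions \<Omega>"
  shows "(\<lambda>x. Re (\<phi> x)) \<in> testf \<Omega>" "(\<lambda>x. Im (\<phi> x)) \<in> testf \<Omega>"
proof -
  let ?S = "closure {x. \<phi> x \<noteq> 0}"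
  have h: "(\<forall>k. C_order k \<phi>) \<and> compact ?S \<and> ?S \<subseteq> \<Omega>"
    using \<phi> unfolding test_functions_def by (rule CollectD)
  have s: "smooth \<phi>"
    unfolding smooth_def C_order_eq_Ck[symmetric] by (rule conjunct1[OF h])
  note c = conjunct1[OF conjunct2[OF h]] conjunct2[OF conjunct2[OF h]]
  have z: "\<phi> x = 0" if "x \<notin> ?S" for x
  proof (rule ccontr)
    assume "\<phi> x \<noteq> 0"
    then have "x \<in> ?S"
      by (intro subsetD[OF closure_subset]) simp
    with that show False ..
  qed
  have "supp_in ?S \<phi>"
    unfolding supp_in_def by (intro allI impI z)
  then have sp: "supp_in ?S (\<lambda>x. Re (\<phi> x))" "supp_in ?S (\<lambda>x. Im (\<phi> x))"
    unfolding supp_in_def by (metis zero_complex.sel)+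
  show "(\<lambda>x. Re (\<phi> x)) \<in> testf \<Omega>"
    by (rule testfI[OF smooth_compose_linear[OF bounded_linear_Re s] c sp(1)])
  show "(\<lambda>x. Im (\<phi> x)) \<in> testf \<Omega>"
    by (rule testfI[OF smooth_compose_linear[OF bounded_linear_Im s] c sp(2)])
qed

lemma testf_supp_in: "p \<in> testf \<Omega> \<Longrightarrow> supp_in \<Omega> p"
  by (erule testfE) (erule (1) supp_in_mono)

lemma minimal_laplacian_Complex:
  assumes \<Omega>: "\<Omega> \<in> sets borel" and p: "p \<in> testf \<Omega>" and q: "q \<in> testf \<Omega>"
  shows "((\<lambda>x. Complex (p x) (q x)), (\<lambda>x. Complex (- lap p x) (- lap q x))) \<in> minimal_laplacian \<Omega>"
proof -
  let ?c = "\<lambda>x. Complex (p x) (q x)" and ?d = "\<lambda>x. Complex (- lap p x) (- lap q x)"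
  have "laplacian ?c = (\<lambda>x. Complex (lap p x) (lap q x))"
    by (rule laplacian_Complex[OF testf_smooth[OF p] testf_smooth[OF q]])
  then have "?d x = - laplacian ?c x" for x
    by (simp add: complex_eq_iff)
  then have "L2_eq (lebesgue_measure_on \<Omega>) ?d (\<lambda>x. - laplacian ?c x)" "L2_eq (lebesgue_measure_on \<Omega>) ?c ?c"
    by (simp_all add: L2_eq_def)
  moreover have "?c \<in> L2 (lebesgue_measure_on \<Omega>)"
    by (rule L2_Complex[OF \<Omega> l2_testf[OF p] l2_testf[OF q]])
  moreover have "?d \<in> L2 (lebesgue_measure_on \<Omega>)"
    by (rule L2_Complex[OF \<Omega> l2_minus[OF l2_testf[OF testf_lap[OF p]]] l2_minus[OF l2_testf[OF testf_lap[OF q]]]])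
  ultimately show ?thesis
    using test_functions_Complex[OF p q] unfolding minimal_laplacian_def by blast
qed

lemma minimal_laplacianE:
  assumes \<Omega>: "\<Omega> \<in> sets borel" and fu: "(f, u) \<in> minimal_laplacian \<Omega>"
  shows "\<exists>p\<in>testf \<Omega>. \<exists>q\<in>testf \<Omega>. f \<in> L2 (lebesgue_measure_on \<Omega>) \<and> u \<in> L2 (lebesgue_measure_on \<Omega>) \<and>
    (AE x in lborel. rp \<Omega> f x = p x) \<and> (AE x in lborel. ip \<Omega> f x = q x) \<and>
    (AE x in lborel. rp \<Omega> u x = - lap p x) \<and> (AE x in lborel. ip \<Omega> u x = - lap q x)"
proof -
  let ?M = "lebesgue_measure_on \<Omega>"
  obtain \<phi> where f: "f \<in> L2 ?M" "u \<in> L2 ?M" and \<phi>: "\<phi> \<in> test_functions \<Omega>" "L2_eq ?M f \<phi>" "L2_eq ?M u (\<lambda>x. - laplacian \<phi> x)"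
    using fu unfolding minimal_laplacian_def by blast
  define p where "p x = Re (\<phi> x)" for x
  define q where "q x = Im (\<phi> x)" for x
  have pq: "p \<in> testf \<Omega>" "q \<in> testf \<Omega>"
    using test_functions_Re_Im[OF \<phi>(1)] by (simp_all add: p_def[abs_def] q_def[abs_def])
  have \<phi>eq: "\<phi> = (\<lambda>x. Complex (p x) (q x))"
    by (simp add: p_def q_def)
  have lap: "laplacian \<phi> = (\<lambda>x. Complex (lap p x) (lap q x))"
    unfolding \<phi>eq using pq by (intro laplacian_Complex testf_smooth)
  have AE1: "AE x in lborel. x \<in> \<Omega> \<longrightarrow> f x = \<phi> x"
    using \<phi>(2) \<Omega> by (simp add: L2_eq_def lebesgue_measure_on_def AE_restrict_space_iff)
  have AE2: "AE x in lborel. x \<in> \<Omega> \<longrightarrow> u x = - laplacian \<phi> x"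
    using \<phi>(3) \<Omega> by (simp add: L2_eq_def lebesgue_measure_on_def AE_restrict_space_iff)
  note sp = testf_supp_in[OF pq(1)] testf_supp_in[OF pq(2)]
    testf_supp_in[OF testf_lap[OF pq(1)]] testf_supp_in[OF testf_lap[OF pq(2)]]
  have 1: "AE x in lborel. rp \<Omega> f x = p x"
    using AE1 by eventually_elim (use sp(1) in \<open>auto simp: rp_def supp_in_def indicator_def p_def\<close>)
  have 2: "AE x in lborel. ip \<Omega> f x = q x"
    using AE1 by eventually_elim (use sp(2) in \<open>auto simp: ip_def supp_in_def indicator_def q_def\<close>)
  have 3: "AE x in lborel. rp \<Omega> u x = - lap p x"
    using AE2 by eventually_elim (use sp(3) in \<open>auto simp: rp_def supp_in_def indicator_def lap\<close>)
  have 4: "AE x in lborel. ip \<Omega> u x = - lap q x"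
    using AE2 by eventually_elim (use sp(4) in \<open>auto simp: ip_def supp_in_def indicator_def lap\<close>)
  show ?thesis
    by (intro bexI[of _ p] bexI[of _ q] conjI f 1 2 3 4 pq)
qed

section \<open>Essential self-adjointness\<close>

lemma ri_cong:
  assumes "l2 f" "l2 g" "l2 f'" "l2 g'" "AE x in lborel. f x = f' x" "AE x in lborel. g x = g' x"
  shows "ri f g = ri f' g'"
  unfolding ri_def
proof (rule integral_cong_AE)
  show "AE x in lborel. f x * g x = f' x * g' x"
    using assms(5,6) by eventually_elim simp
qed (use assms in \<open>auto intro: l2_measurable\<close>)

lemma ri_minus: "ri (\<lambda>x. - f x) g = - ri f g" "ri f (\<lambda>x. - g x) = - ri f g"
  by (simp_all add: ri_def)

lemma ri_commute: "ri f g = ri g f"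
  by (simp add: ri_def mult.commute)

lemma ri_lap_commute: "p \<in> testf \<Omega> \<Longrightarrow> q \<in> testf \<Omega> \<Longrightarrow> ri (lap p) q = ri p (lap q)"
  unfolding ri_def by (rule integral_lap_commute(2)[OF _ testf_smooth, symmetric])

lemma ri_lap_nonpos:
  assumes "p \<in> testf \<Omega>"
  shows "ri (lap p) p \<le> 0"
proof -
  have "ri p (lap p) = - (\<integral>x. (\<Sum>b\<in>Basis. pdiff b p x * pdiff b p x) \<partial>lborel)"
    unfolding ri_def by (rule integral_lap_commute(1)[OF assms testf_smooth[OF assms]])
  moreover have "0 \<le> (\<integral>x. (\<Sum>b\<in>Basis. pdiff b p x * pdiff b p x) \<partial>lborel)"
    by (intro integral_nonneg_AE AE_I2 sum_nonneg) auto
  ultimately show ?thesis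
    by (simp add: ri_commute)
qed

text \<open>Joint continuity: the product of the two differences is small by Cauchy-Schwarz, and the
  remaining terms vary in one slot only. The joint form is what the quadratic form of an operator
  calls for.\<close>

lemma ri_tendsto:
  assumes f: "\<And>n. l2 (f n)" "l2 f'" "(\<lambda>n. nsq (\<lambda>x. f n x - f' x)) \<longlonglongrightarrow> 0"
    and g: "\<And>n. l2 (g n)" "l2 g'" "(\<lambda>n. nsq (\<lambda>x. g n x - g' x)) \<longlonglongrightarrow> 0"
  shows "(\<lambda>n. ri (f n) (g n)) \<longlonglongrightarrow> ri f' g'"
proof -
  let ?d = "\<lambda>n. ri (\<lambda>x. f n x - f' x) (\<lambda>x. g n x - g' x)"
  have "(\<lambda>n. (?d n)\<^sup>2) \<longlonglongrightarrow> 0"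
  proof (rule tendsto_sandwich[OF _ _ tendsto_const])
    show "(\<lambda>n. nsq (\<lambda>x. f n x - f' x) * nsq (\<lambda>x. g n x - g' x)) \<longlonglongrightarrow> 0"
      using tendsto_mult[OF f(3) g(3)] by simp
    show "\<forall>\<^sub>F n in sequentially. (?d n)\<^sup>2 \<le> nsq (\<lambda>x. f n x - f' x) * nsq (\<lambda>x. g n x - g' x)"
      unfolding ri_def by (intro always_eventually allI l2_Cauchy_Schwarz l2_diff f g)
  qed auto
  from tendsto_real_sqrt[OF this] have d: "?d \<longlonglongrightarrow> 0"
    by (simp add: tendsto_rabs_zero_iff)
  have fg: "(\<lambda>n. ri (f n) g') \<longlonglongrightarrow> ri f' g'"
    unfolding ri_def by (rule l2_tendsto_inner[OF f(1,2) g(2) f(3)])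
  have gf: "(\<lambda>n. ri (g n) f') \<longlonglongrightarrow> ri g' f'"
    unfolding ri_def by (rule l2_tendsto_inner[OF g(1,2) f(2) g(3)])
  have "ri (f n) (g n) = ?d n + ri (f n) g' + ri (g n) f' - ri f' g'" for n
    using f(1,2) g(1,2)
    by (simp add: ri_def l2_mult_integrable right_diff_distrib left_diff_distrib mult.commute l2_diff)
  moreover have "(\<lambda>n. ?d n + ri (f n) g' + ri (g n) f' - ri f' g') \<longlonglongrightarrow> 0 + ri f' g' + ri g' f' - ri f' g'"
    by (intro tendsto_intros d fg gf)
  ultimately show ?thesis
    by (simp add: ri_commute[of g' f'])
qed

text \<open>A real test function decouples the real and imaginary parts of the adjoint relation, so
  the adjoint becomes two real weak equations.\<close>

lemma minimal_laplacian_adjointD: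
  assumes \<Omega>: "\<Omega> \<in> sets borel" and gv: "(g, v) \<in> adjoint_operator (lebesgue_measure_on \<Omega>) (minimal_laplacian \<Omega>)"
    and p: "p \<in> testf \<Omega>"
  shows "ri (rp \<Omega> g) (lap p) = - ri (rp \<Omega> v) p" "ri (ip \<Omega> g) (lap p) = - ri (ip \<Omega> v) p"
proof -
  let ?M = "lebesgue_measure_on \<Omega>"
  have z: "(\<lambda>x. 0) \<in> testf \<Omega>"
    by (rule testfI[of _ "{}"]) (auto simp: supp_in_def)
  note d = adjoint_operatorD[OF gv]
  have lz: "lap (\<lambda>x. 0) = (\<lambda>x. 0)"
    by (simp add: lap_def)
  let ?c = "\<lambda>x. Complex (p x) 0" and ?d = "\<lambda>x. Complex (- lap p x) 0"
  have cd: "(?c, ?d) \<in> minimal_laplacian \<Omega>"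
    using minimal_laplacian_Complex[OF \<Omega> p z] by (simp add: lz)
  have l: "?c \<in> L2 ?M" "?d \<in> L2 ?M"
    using p by (intro L2_Complex \<Omega> l2_zero l2_minus l2_testf testf_lap; assumption)+
  have s: "supp_in \<Omega> p" "supp_in \<Omega> (\<lambda>x. - lap p x)" "supp_in \<Omega> (\<lambda>x. 0)"
    using testf_supp_in[OF p] testf_supp_in[OF testf_lap[OF p]] by (auto simp: supp_in_def)
  have rz: "ri (\<lambda>x. 0) h = 0" for h
    by (simp add: ri_def)
  have "L2_inner ?M ?d g = L2_inner ?M ?c v"
    by (rule d(3)[OF cd])
  then show "ri (rp \<Omega> g) (lap p) = - ri (rp \<Omega> v) p" "ri (ip \<Omega> g) (lap p) = - ri (ip \<Omega> v) p"
    unfolding L2_inner_rp_ip[OF \<Omega> l(2) d(1)] L2_inner_rp_ip[OF \<Omega> l(1) d(2)]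
      rp_ip_Complex[OF s(1,3)] rp_ip_Complex[OF s(2,3)]
    by (simp_all add: rz ri_minus ri_commute[of "lap p"] ri_commute[of p])
qed

lemma minimal_laplacian_symmetric:
  assumes \<Omega>: "\<Omega> \<in> sets borel"
  shows "minimal_laplacian \<Omega> \<subseteq> adjoint_operator (lebesgue_measure_on \<Omega>) (minimal_laplacian \<Omega>)"
proof clarify
  let ?M = "lebesgue_measure_on \<Omega>"
  fix g v assume gv: "(g, v) \<in> minimal_laplacian \<Omega>"
  obtain p q where pq: "p \<in> testf \<Omega>" "q \<in> testf \<Omega>" and g: "g \<in> L2 ?M" "v \<in> L2 ?M"
    and ae: "AE x in lborel. rp \<Omega> g x = p x" "AE x in lborel. ip \<Omega> g x = q x"
      "AE x in lborel. rp \<Omega> v x = - lap p x" "AE x in lborel. ip \<Omega> v x = - lap q x"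
    using minimal_laplacianE[OF \<Omega> gv] by blast
  show "(g, v) \<in> adjoint_operator ?M (minimal_laplacian \<Omega>)"
  proof (rule adjoint_operatorI[OF g])
    fix f u assume fu: "(f, u) \<in> minimal_laplacian \<Omega>"
    obtain p' q' where pq': "p' \<in> testf \<Omega>" "q' \<in> testf \<Omega>" and f: "f \<in> L2 ?M" "u \<in> L2 ?M"
      and ae': "AE x in lborel. rp \<Omega> f x = p' x" "AE x in lborel. ip \<Omega> f x = q' x"
        "AE x in lborel. rp \<Omega> u x = - lap p' x" "AE x in lborel. ip \<Omega> u x = - lap q' x"
      using minimal_laplacianE[OF \<Omega> fu] by blast
    note L = L2_rp_ip[OF \<Omega> g(1)] L2_rp_ip[OF \<Omega> g(2)] L2_rp_ip[OF \<Omega> f(1)] L2_rp_ip[OF \<Omega> f(2)]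
    note T = l2_testf[OF pq(1)] l2_testf[OF pq(2)] l2_minus[OF l2_testf[OF testf_lap[OF pq(1)]]]
      l2_minus[OF l2_testf[OF testf_lap[OF pq(2)]]]
    note T' = l2_testf[OF pq'(1)] l2_testf[OF pq'(2)] l2_minus[OF l2_testf[OF testf_lap[OF pq'(1)]]]
      l2_minus[OF l2_testf[OF testf_lap[OF pq'(2)]]]
    have c: "ri (rp \<Omega> u) (rp \<Omega> g) = ri (\<lambda>x. - lap p' x) p" "ri (ip \<Omega> u) (ip \<Omega> g) = ri (\<lambda>x. - lap q' x) q"
      "ri (ip \<Omega> u) (rp \<Omega> g) = ri (\<lambda>x. - lap q' x) p" "ri (rp \<Omega> u) (ip \<Omega> g) = ri (\<lambda>x. - lap p' x) q"
      "ri (rp \<Omega> f) (rp \<Omega> v) = ri p' (\<lambda>x. - lap p x)" "ri (ip \<Omega> f) (ip \<Omega> v) = ri q' (\<lambda>x. - lap q x)"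
      "ri (ip \<Omega> f) (rp \<Omega> v) = ri q' (\<lambda>x. - lap p x)" "ri (rp \<Omega> f) (ip \<Omega> v) = ri p' (\<lambda>x. - lap q x)"
      by (rule ri_cong; fact)+
    show "L2_inner ?M u g = L2_inner ?M f v"
      unfolding L2_inner_rp_ip[OF \<Omega> f(2) g(1)] L2_inner_rp_ip[OF \<Omega> f(1) g(2)] c ri_minus
      using pq pq' by (simp add: ri_lap_commute)
  qed
qed

lemma minimal_laplacian_dense:
  assumes \<Omega>: "open \<Omega>"
  shows "densely_defined (lebesgue_measure_on \<Omega>) (minimal_laplacian \<Omega>)"
  unfolding densely_defined_def
proof (intro ballI allI impI)
  let ?M = "lebesgue_measure_on \<Omega>"
  fix f and \<epsilon> :: real assume f: "f \<in> L2 ?M" and \<epsilon>: "0 < \<epsilon>"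
  have \<Omega>b: "\<Omega> \<in> sets borel"
    using \<Omega> by simp
  note L = L2_rp_ip[OF \<Omega>b f]
  have e: "0 < \<epsilon>\<^sup>2 / 2"
    using \<epsilon> by simp
  obtain p where p: "p \<in> testf \<Omega>" "nsq (\<lambda>x. p x - rp \<Omega> f x) < \<epsilon>\<^sup>2 / 2"
    using l2_density[OF L(1) supp_in_rp_ip(1) \<Omega> e] by blast
  obtain q where q: "q \<in> testf \<Omega>" "nsq (\<lambda>x. q x - ip \<Omega> f x) < \<epsilon>\<^sup>2 / 2"
    using l2_density[OF L(2) supp_in_rp_ip(2) \<Omega> e] by blast
  let ?c = "\<lambda>x. Complex (p x) (q x)"
  have c: "?c \<in> Domain (minimal_laplacian \<Omega>)"
    using minimal_laplacian_Complex[OF \<Omega>b p(1) q(1)] by blast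
  have cl: "?c \<in> L2 ?M"
    using p q by (intro L2_Complex \<Omega>b l2_testf)
  have dl: "(\<lambda>x. f x - ?c x) \<in> L2 ?M"
    using L2_add[OF f L2_cmult[OF cl, of "-1"]] by simp
  have s: "supp_in \<Omega> p" "supp_in \<Omega> q"
    using testf_supp_in p q by auto
  have "rp \<Omega> (\<lambda>x. f x - ?c x) = (\<lambda>x. rp \<Omega> f x - p x)" "ip \<Omega> (\<lambda>x. f x - ?c x) = (\<lambda>x. ip \<Omega> f x - q x)"
    using s by (auto simp: rp_def ip_def supp_in_def indicator_def)
  then have "nsq (rp \<Omega> (\<lambda>x. f x - ?c x)) + nsq (ip \<Omega> (\<lambda>x. f x - ?c x)) < \<epsilon>\<^sup>2"
    using p(2) q(2) by (simp add: nsq_diff_commute[of p] nsq_diff_commute[of q])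
  then have "L2_norm ?M (\<lambda>x. f x - ?c x) < \<epsilon>"
    unfolding L2_norm_rp_ip[OF \<Omega>b dl] using \<epsilon> real_sqrt_less_mono by fastforce
  then show "\<exists>g\<in>Domain (minimal_laplacian \<Omega>). L2_norm ?M (\<lambda>x. f x - g x) < \<epsilon>"
    by (rule bexI[OF _ c])
qed

text \<open>For p orthogonal to d the squared distance is the sum of the squared norms, hence at
  least the squared norm of d; density makes this distance arbitrarily small.\<close>

lemma orthogonal_testf_zero:
  assumes \<Omega>: "open \<Omega>" and d: "l2 d" "supp_in \<Omega> d" and 0: "\<And>p. p \<in> testf \<Omega> \<Longrightarrow> ri d p = 0"
  shows "AE x in lborel. d x = 0"
proof -
  have "nsq d < \<delta>\<^sup>2" if \<delta>: "0 < \<delta>" for \<delta>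
  proof -
    have e: "0 < \<delta>\<^sup>2"
      using \<delta> by simp
    obtain p where p: "p \<in> testf \<Omega>" "nsq (\<lambda>x. p x - d x) < \<delta>\<^sup>2"
      using l2_density[OF d \<Omega> e] by blast
    have e: "(p x - d x)\<^sup>2 = (p x)\<^sup>2 - 2 * (d x * p x) + (d x)\<^sup>2" for x
      by (simp add: power2_eq_square algebra_simps)
    have i: "integrable lborel (\<lambda>x. (p x)\<^sup>2)" "integrable lborel (\<lambda>x. (d x)\<^sup>2)" "integrable lborel (\<lambda>x. d x * p x)"
      using d(1) l2_testf[OF p(1)] l2_mult_integrable[OF d(1) l2_testf[OF p(1)]] by (auto simp: l2_def)
    have "nsq (\<lambda>x. p x - d x) = nsq p - 2 * ri d p + nsq d"
      unfolding nsq_def ri_def e using i by simp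
    then have "nsq d \<le> nsq (\<lambda>x. p x - d x)"
      using 0[OF p(1)] by simp
    with p(2) show ?thesis
      by linarith
  qed
  \<comment> \<open>If \<open>nsq d\<close> were positive, this choice of \<delta> would give
    \<open>nsq d < nsq d\<close>.\<close>
  from this[of "sqrt (nsq d)"] have "nsq d = 0"
    using nsq_nonneg[of d] by (cases "nsq d = 0") auto
  then show ?thesis
    using d(1) integral_nonneg_eq_0_iff_AE[of lborel "\<lambda>x. (d x)\<^sup>2"] by (simp add: nsq_def l2_def)
qed

lemma minimal_laplacian_adjoint_linear:
  assumes \<Omega>: "open \<Omega>"
  shows "linear_operator (lebesgue_measure_on \<Omega>) (adjoint_operator (lebesgue_measure_on \<Omega>) (minimal_laplacian \<Omega>))"
proof (rule linear_adjoint)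
  let ?M = "lebesgue_measure_on \<Omega>"
  have \<Omega>b: "\<Omega> \<in> sets borel"
    using \<Omega> by simp
  show "minimal_laplacian \<Omega> \<subseteq> L2 ?M \<times> L2 ?M"
    unfolding minimal_laplacian_def by blast
  fix f u v assume fu: "(f, u) \<in> adjoint_operator ?M (minimal_laplacian \<Omega>)" and fv: "(f, v) \<in> adjoint_operator ?M (minimal_laplacian \<Omega>)"
  note L = L2_rp_ip[OF \<Omega>b adjoint_operatorD(2)[OF fu]] L2_rp_ip[OF \<Omega>b adjoint_operatorD(2)[OF fv]]
  have sub: "ri (\<lambda>x. a x - b x) p = ri a p - ri b p" if "l2 a" "l2 b" "l2 p" for a b p
    using that by (simp add: ri_def l2_mult_integrable left_diff_distrib)
  have "AE x in lborel. rp \<Omega> u x - rp \<Omega> v x = 0"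
  proof (rule orthogonal_testf_zero[OF \<Omega> l2_diff[OF L(1,3)]])
    show "ri (\<lambda>x. rp \<Omega> u x - rp \<Omega> v x) p = 0" if p: "p \<in> testf \<Omega>" for p
      using minimal_laplacian_adjointD(1)[OF \<Omega>b fu p] minimal_laplacian_adjointD(1)[OF \<Omega>b fv p]
        sub[OF L(1,3) l2_testf[OF p]] by simp
  qed (simp add: supp_in_def rp_def)
  moreover have "AE x in lborel. ip \<Omega> u x - ip \<Omega> v x = 0"
  proof (rule orthogonal_testf_zero[OF \<Omega> l2_diff[OF L(2,4)]])
    show "ri (\<lambda>x. ip \<Omega> u x - ip \<Omega> v x) p = 0" if p: "p \<in> testf \<Omega>" for p
      using minimal_laplacian_adjointD(2)[OF \<Omega>b fu p] minimal_laplacian_adjointD(2)[OF \<Omega>b fv p]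
        sub[OF L(2,4) l2_testf[OF p]] by simp
  qed (simp add: supp_in_def ip_def)
  ultimately have "AE x in lborel. x \<in> \<Omega> \<longrightarrow> u x = v x"
    by eventually_elim (auto simp: rp_def ip_def complex_eq_iff)
  then show "L2_eq ?M u v"
    unfolding L2_eq_def lebesgue_measure_on_def using \<Omega>b by (subst AE_restrict_space_iff) auto
qed

text \<open>Real and imaginary parts are approximated independently. The minus sign of the operator
  is carried by applying \<open>graph_core\<close> with the negated right-hand side.\<close>

lemma minimal_laplacian_graph_approx:
  fixes K :: "'a::euclidean_space set"
  assumes K: "compact K" and cap: "bessel_capacity2 2 K = 0" and \<Omega>: "\<Omega> = - K"
    and gv: "(g, v) \<in> adjoint_operator (lebesgue_measure_on \<Omega>) (minimal_laplacian \<Omega>)"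
  shows "\<exists>p q. (\<forall>n::nat. p n \<in> testf \<Omega> \<and> q n \<in> testf \<Omega>) \<and>
    (\<lambda>n. nsq (\<lambda>x. p n x - rp \<Omega> g x)) \<longlonglongrightarrow> 0 \<and> (\<lambda>n. nsq (\<lambda>x. q n x - ip \<Omega> g x)) \<longlonglongrightarrow> 0 \<and>
    (\<lambda>n. nsq (\<lambda>x. - lap (p n) x - rp \<Omega> v x)) \<longlonglongrightarrow> 0 \<and> (\<lambda>n. nsq (\<lambda>x. - lap (q n) x - ip \<Omega> v x)) \<longlonglongrightarrow> 0"
proof -
  have \<Omega>b: "\<Omega> \<in> sets borel"
    unfolding \<Omega> using borel_compact[OF K] by simp
  note d = adjoint_operatorD(1,2)[OF gv]
  have seq: "\<exists>p. (\<forall>n::nat. p n \<in> testf \<Omega>) \<and> (\<lambda>n. nsq (\<lambda>x. p n x - a x)) \<longlonglongrightarrow> 0 \<and>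
      (\<lambda>n. nsq (\<lambda>x. - lap (p n) x - b x)) \<longlonglongrightarrow> 0"
    if ab: "l2 a" "l2 b" "\<forall>\<phi>\<in>testf \<Omega>. ri a (lap \<phi>) = - ri b \<phi>" for a b
  proof -
    have w: "(\<integral>x. a x * lap \<phi> x \<partial>lborel) = (\<integral>x. - b x * \<phi> x \<partial>lborel)" if "\<phi> \<in> testf (- K)" for \<phi>
      using ab(3) that by (simp add: \<Omega> ri_def)
    have "\<exists>\<phi>\<in>testf (- K). nsq (\<lambda>x. \<phi> x - a x) < inverse (real (Suc n)) \<and> nsq (\<lambda>x. lap \<phi> x - - b x) < inverse (real (Suc n))" for n
      by (rule graph_core[OF K cap ab(1) l2_minus[OF ab(2)] w]) auto
    then obtain p where p: "\<And>n. p n \<in> testf (- K)" "\<And>n. nsq (\<lambda>x. p n x - a x) < inverse (real (Suc n))"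
      "\<And>n. nsq (\<lambda>x. lap (p n) x - - b x) < inverse (real (Suc n))"
      by metis
    have n: "nsq (\<lambda>x. - lap (p n) x - b x) = nsq (\<lambda>x. lap (p n) x - - b x)" for n
    proof -
      have "(- lap (p n) x - b x)\<^sup>2 = (lap (p n) x - - b x)\<^sup>2" for x
        by (simp add: power2_eq_square algebra_simps)
      then show ?thesis
        by (simp only: nsq_def)
    qed
    have l0: "X \<longlonglongrightarrow> 0" if X: "\<And>n. 0 \<le> X n" "\<And>n. X n < inverse (real (Suc n))" for X :: "nat \<Rightarrow> real"
    proof (rule tendsto_sandwich[OF _ _ tendsto_const LIMSEQ_inverse_real_of_nat])
      show "\<forall>\<^sub>F n in sequentially. 0 \<le> X n"
        by (intro always_eventually allI X)
      show "\<forall>\<^sub>F n in sequentially. X n \<le> inverse (real (Suc n))"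
        by (intro always_eventually allI less_imp_le X)
    qed
    show ?thesis
      using l0[OF nsq_nonneg p(2)] l0[OF nsq_nonneg p(3)]
      by (intro exI[of _ p] conjI allI) (simp_all only: n \<Omega> p(1))
  qed
  have w: "\<forall>\<phi>\<in>testf \<Omega>. ri (rp \<Omega> g) (lap \<phi>) = - ri (rp \<Omega> v) \<phi>"
    "\<forall>\<phi>\<in>testf \<Omega>. ri (ip \<Omega> g) (lap \<phi>) = - ri (ip \<Omega> v) \<phi>"
    using minimal_laplacian_adjointD[OF \<Omega>b gv] by auto
  obtain p where p: "\<forall>n. p n \<in> testf \<Omega>" "(\<lambda>n. nsq (\<lambda>x. p n x - rp \<Omega> g x)) \<longlonglongrightarrow> 0"
    "(\<lambda>n. nsq (\<lambda>x. - lap (p n) x - rp \<Omega> v x)) \<longlonglongrightarrow> 0"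
    using seq[OF L2_rp_ip(1)[OF \<Omega>b d(1)] L2_rp_ip(1)[OF \<Omega>b d(2)] w(1)] by (elim exE conjE) (rule that)
  obtain q where q: "\<forall>n. q n \<in> testf \<Omega>" "(\<lambda>n. nsq (\<lambda>x. q n x - ip \<Omega> g x)) \<longlonglongrightarrow> 0"
    "(\<lambda>n. nsq (\<lambda>x. - lap (q n) x - ip \<Omega> v x)) \<longlonglongrightarrow> 0"
    using seq[OF L2_rp_ip(2)[OF \<Omega>b d(1)] L2_rp_ip(2)[OF \<Omega>b d(2)] w(2)] by (elim exE conjE) (rule that)
  show ?thesis
    using p(1) q(1) by (intro exI[of _ p] exI[of _ q] conjI allI p(2,3) q(2,3)) auto
qed

text \<open>Graph approximation transfers properties of the minimal operator S to its adjoint A: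
  symmetry of the pairing in one slot and nonnegativity of the quadratic form both survive the
  limit. The reverse inclusion is formal.\<close>

lemma minimal_laplacian_adjoint_selfadjoint:
  fixes K :: "'a::euclidean_space set"
  assumes K: "compact K" and cap: "bessel_capacity2 2 K = 0" and \<Omega>: "\<Omega> = - K"
  defines "M \<equiv> lebesgue_measure_on \<Omega>"
  defines "A \<equiv> adjoint_operator M (minimal_laplacian \<Omega>)"
  shows "selfadjoint_operator M A" "nonneg_operator M A"
proof -
  have \<Omega>o: "open \<Omega>"
    unfolding \<Omega> using compact_imp_closed[OF K] by (rule open_Compl)
  then have \<Omega>b: "\<Omega> \<in> sets borel"
    by simp
  have SA: "minimal_laplacian \<Omega> \<subseteq> A"
    unfolding A_def M_def by (rule minimal_laplacian_symmetric[OF \<Omega>b])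
  \<comment> \<open>Three limits along one approximating sequence: each component against a fixed
    vector, for symmetry, and the two components against each other, for the quadratic form.\<close>
  have lim: "\<exists>p q. (\<forall>n::nat. p n \<in> testf \<Omega> \<and> q n \<in> testf \<Omega>) \<and>
      (\<forall>h\<in>L2 M. (\<lambda>n. L2_inner M (\<lambda>x. Complex (p n x) (q n x)) h) \<longlonglongrightarrow> L2_inner M f h) \<and>
      (\<forall>h\<in>L2 M. (\<lambda>n. L2_inner M (\<lambda>x. Complex (- lap (p n) x) (- lap (q n) x)) h) \<longlonglongrightarrow> L2_inner M u h) \<and>
      (\<lambda>n. L2_inner M (\<lambda>x. Complex (- lap (p n) x) (- lap (q n) x)) (\<lambda>x. Complex (p n x) (q n x))) \<longlonglongrightarrow> L2_inner M u f"
    if fu: "(f, u) \<in> A" for f u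
  proof -
    obtain p q where pq': "\<forall>n. p n \<in> testf \<Omega> \<and> q n \<in> testf \<Omega>" and
      lim: "(\<lambda>n. nsq (\<lambda>x. p n x - rp \<Omega> f x)) \<longlonglongrightarrow> 0" "(\<lambda>n. nsq (\<lambda>x. q n x - ip \<Omega> f x)) \<longlonglongrightarrow> 0"
      "(\<lambda>n. nsq (\<lambda>x. - lap (p n) x - rp \<Omega> u x)) \<longlonglongrightarrow> 0" "(\<lambda>n. nsq (\<lambda>x. - lap (q n) x - ip \<Omega> u x)) \<longlonglongrightarrow> 0"
      using minimal_laplacian_graph_approx[OF K cap \<Omega> fu[unfolded A_def M_def]] by (elim exE conjE) (rule that)
    have pq: "p n \<in> testf \<Omega>" "q n \<in> testf \<Omega>" for n
      using pq' by auto
    note l = l2_testf[OF pq(1)] l2_testf[OF pq(2)] l2_minus[OF l2_testf[OF testf_lap[OF pq(1)]]]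
      l2_minus[OF l2_testf[OF testf_lap[OF pq(2)]]]
    have s: "supp_in \<Omega> (p n)" "supp_in \<Omega> (q n)" "supp_in \<Omega> (\<lambda>x. - lap (p n) x)" "supp_in \<Omega> (\<lambda>x. - lap (q n) x)" for n
      using testf_supp_in[OF pq(1)] testf_supp_in[OF pq(2)] testf_supp_in[OF testf_lap[OF pq(1)]]
        testf_supp_in[OF testf_lap[OF pq(2)]] by (auto simp: supp_in_def)
    have c: "(\<lambda>x. Complex (p n x) (q n x)) \<in> L2 (lebesgue_measure_on \<Omega>)"
      "(\<lambda>x. Complex (- lap (p n) x) (- lap (q n) x)) \<in> L2 (lebesgue_measure_on \<Omega>)" for n
      by (intro L2_Complex \<Omega>b l)+
    have fL: "f \<in> L2 (lebesgue_measure_on \<Omega>)" "u \<in> L2 (lebesgue_measure_on \<Omega>)"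
      using adjoint_operatorD(1,2)[OF fu[unfolded A_def M_def]] .
    note L = L2_rp_ip[OF \<Omega>b fL(1)] L2_rp_ip[OF \<Omega>b fL(2)]
    have const: "(\<lambda>n. nsq (\<lambda>x. h x - h x)) \<longlonglongrightarrow> 0" for h :: "'a \<Rightarrow> real"
      by (simp add: nsq_def)
    have 1: "(\<lambda>n. L2_inner M (\<lambda>x. Complex (p n x) (q n x)) h) \<longlonglongrightarrow> L2_inner M f h" if h: "h \<in> L2 M" for h
    proof -
      note H = L2_rp_ip[OF \<Omega>b h[unfolded M_def]]
      show ?thesis
        unfolding M_def L2_inner_rp_ip[OF \<Omega>b c(1) h[unfolded M_def]] L2_inner_rp_ip[OF \<Omega>b fL(1) h[unfolded M_def]]
          rp_ip_Complex[OF s(1,2)]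
        by (intro tendsto_Complex tendsto_add tendsto_diff ri_tendsto[OF l(1) L(1) lim(1) H(1) H(1) const]
            ri_tendsto[OF l(2) L(2) lim(2) H(2) H(2) const] ri_tendsto[OF l(2) L(2) lim(2) H(1) H(1) const]
            ri_tendsto[OF l(1) L(1) lim(1) H(2) H(2) const])
    qed
    have 2: "(\<lambda>n. L2_inner M (\<lambda>x. Complex (- lap (p n) x) (- lap (q n) x)) h) \<longlonglongrightarrow> L2_inner M u h" if h: "h \<in> L2 M" for h
    proof -
      note H = L2_rp_ip[OF \<Omega>b h[unfolded M_def]]
      show ?thesis
        unfolding M_def L2_inner_rp_ip[OF \<Omega>b c(2) h[unfolded M_def]] L2_inner_rp_ip[OF \<Omega>b fL(2) h[unfolded M_def]]
          rp_ip_Complex[OF s(3,4)]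
        by (intro tendsto_Complex tendsto_add tendsto_diff ri_tendsto[OF l(3) L(3) lim(3) H(1) H(1) const]
            ri_tendsto[OF l(4) L(4) lim(4) H(2) H(2) const] ri_tendsto[OF l(4) L(4) lim(4) H(1) H(1) const]
            ri_tendsto[OF l(3) L(3) lim(3) H(2) H(2) const])
    qed
    have 3: "(\<lambda>n. L2_inner M (\<lambda>x. Complex (- lap (p n) x) (- lap (q n) x)) (\<lambda>x. Complex (p n x) (q n x))) \<longlonglongrightarrow> L2_inner M u f"
      unfolding M_def L2_inner_rp_ip[OF \<Omega>b c(2) c(1)] L2_inner_rp_ip[OF \<Omega>b fL(2) fL(1)]
        rp_ip_Complex[OF s(3,4)] rp_ip_Complex[OF s(1,2)]
      by (intro tendsto_Complex tendsto_add tendsto_diff ri_tendsto[OF l(3) L(3) lim(3) l(1) L(1) lim(1)]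
          ri_tendsto[OF l(4) L(4) lim(4) l(2) L(2) lim(2)] ri_tendsto[OF l(4) L(4) lim(4) l(1) L(1) lim(1)]
          ri_tendsto[OF l(3) L(3) lim(3) l(2) L(2) lim(2)])
    show ?thesis
      by (intro exI[of _ p] exI[of _ q] conjI ballI pq' 1 2 3)
  qed
  \<comment> \<open>The defining relation of A against the approximants, which belong to the graph
    of S, passes to the limit and yields the relation against all of A.\<close>
  have "A \<subseteq> adjoint_operator M A"
  proof clarify
    fix g v assume gv: "(g, v) \<in> A"
    note d = adjoint_operatorD[OF gv[unfolded A_def]]
    show "(g, v) \<in> adjoint_operator M A"
    proof (rule adjoint_operatorI[OF d(1,2)])
      fix f u assume "(f, u) \<in> A"
      from lim[OF this] obtain p q where pq: "\<forall>n::nat. p n \<in> testf \<Omega> \<and> q n \<in> testf \<Omega>"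
        and l1: "\<forall>h\<in>L2 M. (\<lambda>n. L2_inner M (\<lambda>x. Complex (p n x) (q n x)) h) \<longlonglongrightarrow> L2_inner M f h"
        and l2: "\<forall>h\<in>L2 M. (\<lambda>n. L2_inner M (\<lambda>x. Complex (- lap (p n) x) (- lap (q n) x)) h) \<longlonglongrightarrow> L2_inner M u h"
        by (elim exE conjE) (rule that)
      have "L2_inner M (\<lambda>x. Complex (- lap (p n) x) (- lap (q n) x)) g = L2_inner M (\<lambda>x. Complex (p n x) (q n x)) v" for n
        using pq by (intro d(3) minimal_laplacian_Complex \<Omega>b) auto
      then show "L2_inner M u g = L2_inner M f v"
        using l1[rule_format, OF d(2)] l2[rule_format, OF d(1)] LIMSEQ_unique by simp
    qed
  qed
  \<comment> \<open>Taking adjoints reverses the inclusion of S in A, and the adjoint of S is A by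
    definition.\<close>
  moreover have "adjoint_operator M A \<subseteq> A"
    using adjoint_antimono[OF SA, of M] by (simp add: A_def)
  ultimately have "adjoint_operator M A = A"
    by blast
  moreover have "linear_operator M A"
    unfolding A_def M_def by (rule minimal_laplacian_adjoint_linear[OF \<Omega>o])
  moreover have "densely_defined M A"
    using minimal_laplacian_dense[OF \<Omega>o] Domain_mono[OF SA] unfolding densely_defined_def M_def by blast
  ultimately show "selfadjoint_operator M A"
    by (simp add: selfadjoint_operator_def)
  show "nonneg_operator M A"
    unfolding nonneg_operator_def
  proof clarify
    fix f u assume "(f, u) \<in> A"
    from lim[OF this] obtain p q where pq': "\<forall>n::nat. p n \<in> testf \<Omega> \<and> q n \<in> testf \<Omega>"
      and l: "(\<lambda>n. L2_inner M (\<lambda>x. Complex (- lap (p n) x) (- lap (q n) x)) (\<lambda>x. Complex (p n x) (q n x))) \<longlonglongrightarrow> L2_inner M u f"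
      by (elim exE conjE) (rule that)
    have pq: "p n \<in> testf \<Omega>" "q n \<in> testf \<Omega>" for n
      using pq' by auto
    let ?z = "\<lambda>n. L2_inner M (\<lambda>x. Complex (- lap (p n) x) (- lap (q n) x)) (\<lambda>x. Complex (p n x) (q n x))"
    have z: "Im (?z n) = 0" "0 \<le> Re (?z n)" for n
    proof -
      have s: "supp_in \<Omega> (p n)" "supp_in \<Omega> (q n)" "supp_in \<Omega> (\<lambda>x. - lap (p n) x)" "supp_in \<Omega> (\<lambda>x. - lap (q n) x)"
        using testf_supp_in[OF pq(1)] testf_supp_in[OF pq(2)] testf_supp_in[OF testf_lap[OF pq(1)]]
          testf_supp_in[OF testf_lap[OF pq(2)]] by (auto simp: supp_in_def)
      have c: "(\<lambda>x. Complex (p n x) (q n x)) \<in> L2 (lebesgue_measure_on \<Omega>)"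
        "(\<lambda>x. Complex (- lap (p n) x) (- lap (q n) x)) \<in> L2 (lebesgue_measure_on \<Omega>)"
        by (intro L2_Complex \<Omega>b l2_minus l2_testf[OF pq(1)] l2_testf[OF pq(2)]
            l2_testf[OF testf_lap[OF pq(1)]] l2_testf[OF testf_lap[OF pq(2)]])+
      have "?z n = Complex (- ri (lap (p n)) (p n) - ri (lap (q n)) (q n)) (ri (lap (p n)) (q n) - ri (lap (q n)) (p n))"
        unfolding M_def L2_inner_rp_ip[OF \<Omega>b c(2,1)] rp_ip_Complex[OF s(3,4)] rp_ip_Complex[OF s(1,2)] ri_minus
        by simp
      moreover have "ri (lap (p n)) (q n) = ri (lap (q n)) (p n)"
        using ri_lap_commute[OF pq(1) pq(2), of n n] by (simp add: ri_commute)
      ultimately show "Im (?z n) = 0" "0 \<le> Re (?z n)"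
        using ri_lap_nonpos[OF pq(1), of n] ri_lap_nonpos[OF pq(2), of n] by auto
    qed
    have "(\<lambda>n. Im (?z n)) \<longlonglongrightarrow> Im (L2_inner M u f)" "(\<lambda>n. Re (?z n)) \<longlonglongrightarrow> Re (L2_inner M u f)"
      using l by (auto intro: tendsto_intros)
    then show "Im (L2_inner M u f) = 0 \<and> 0 \<le> Re (L2_inner M u f)"
      using z by (auto simp: LIMSEQ_const_iff intro: LIMSEQ_le_const)
  qed
qed

text \<open>Self-adjoint operators are maximal among symmetric ones. A self-adjoint B above S lies
  below the adjoint of S; taking adjoints once more, and using that the adjoint of S is its own
  adjoint, gives the converse.\<close>

lemma minimal_laplacian_unique_extension:
  fixes K :: "'a::euclidean_space set"
  assumes K: "compact K" and cap: "bessel_capacity2 2 K = 0" and \<Omega>: "\<Omega> = - K"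
  shows "nonneg_selfadjoint_extensions (lebesgue_measure_on \<Omega>) (minimal_laplacian \<Omega>)
    = {adjoint_operator (lebesgue_measure_on \<Omega>) (minimal_laplacian \<Omega>)}"
proof -
  let ?M = "lebesgue_measure_on \<Omega>" and ?S = "minimal_laplacian \<Omega>"
  have \<Omega>b: "\<Omega> \<in> sets borel"
    unfolding \<Omega> using borel_compact[OF K] by simp
  note A = minimal_laplacian_adjoint_selfadjoint[OF K cap \<Omega>]
  have "B = adjoint_operator ?M ?S" if B: "selfadjoint_operator ?M B" "?S \<subseteq> B" for B
  proof
    have Beq: "adjoint_operator ?M B = B"
      using B(1) by (simp add: selfadjoint_operator_def)
    show 1: "B \<subseteq> adjoint_operator ?M ?S"
      using adjoint_antimono[OF B(2), of ?M] unfolding Beq .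
    have "adjoint_operator ?M (adjoint_operator ?M ?S) = adjoint_operator ?M ?S"
      using A(1) by (simp add: selfadjoint_operator_def)
    then show "adjoint_operator ?M ?S \<subseteq> B"
      using adjoint_antimono[OF 1, of ?M] unfolding Beq by simp
  qed
  with A minimal_laplacian_symmetric[OF \<Omega>b] show ?thesis
    unfolding nonneg_selfadjoint_extensions_def by blast
qed

theorem theorem9p3:
  fixes K \<Omega> :: "(real ^ 'n) set"
  assumes "CARD('n) \<ge> 3"
    and "compact K"
    and "bessel_capacity2 2 K = 0"
    and "\<Omega> = UNIV - K"
  shows "friedrichs_extension (lebesgue_measure_on \<Omega>) (minimal_laplacian \<Omega>) =
           krein_extension (lebesgue_measure_on \<Omega>) (minimal_laplacian \<Omega>) \<and>
         (\<exists>!A. A \<in> nonneg_selfadjoint_extensions (lebesgue_measure_on \<Omega>) (minimal_laplacian \<Omega>))"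
proof -
  have "\<Omega> = - K"
    by (simp add: assms(4) Compl_eq_Diff_UNIV)
  note ext = minimal_laplacian_unique_extension[OF assms(2,3) this]
  show ?thesis
  proof
    show "friedrichs_extension (lebesgue_measure_on \<Omega>) (minimal_laplacian \<Omega>) =
        krein_extension (lebesgue_measure_on \<Omega>) (minimal_laplacian \<Omega>)"
      \<comment> \<open>Over a singleton both defining predicates say that A is its member T and
        that \<open>operator_le\<close> relates T to itself. They agree as predicates, hence so do
        the descriptions.\<close>
      unfolding friedrichs_extension_def krein_extension_def ext
      by (rule arg_cong[where f=The], rule HOL.ext) blast
    show "\<exists>!A. A \<in> nonneg_selfadjoint_extensions (lebesgue_measure_on \<Omega>) (minimal_laplacian \<Omega>)"
      unfolding ext by simp
  qed
qed

end
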